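(* Let $d\in\{1,2,3\}$, let $c>0$, and let $\hat u_0:\mathbb{R}^d\to\mathbb{C}$ be smooth with compact support. Let $\rho>0$ be arbitrary, let $W_\rho$ be a function as described in the context, and let $\hat{\mathcal{Q}}^\rho_0$ be the regularized reconstruction operator in Fourier space (with dispersion function $b\equiv 0$; it depends on $\varepsilon>0$) defined in the context. Then for every $\tau>0$ and every $k\in\mathbb{R}^d$ with $|k|>\rho$, $$\hat{\mathcal{Q}}^\rho_0\hat u_0(k,\tau/\varepsilon^2)-e^{-ic|k|\tau/\varepsilon^2}\,\hat u_0(k)\to 0\qquad\text{as }\varepsilon\to 0 .$$
   Context: Spaces: $X:=L^2(\mathbb{R}^d;\mathbb{C})$ and $X_S:=L^2(\mathbb{R}\times S^{d-1};\mathbb{C})$, where $S^{d-1}\subset\mathbb{R}^d$ is the unit sphere with surface measure $dS$ (for $d=1$, $S^0=\{+1,-1\}$ with counting measure). Powers of $1/i$ and of $i$ are principal values. Fourier transforms: $(\mathcal{F}_d u)(k)=\int_{\mathbb{R}^d}u(x)e^{-ik\cdot x}\,dx$ and $(\mathcal{F}_d^{-1}\hat u)(x)=(2\pi)^{-d}\int_{\mathbb{R}^d}e^{ix\cdot k}\hat u(k)\,dk$. The one-dimensional transform $\mathcal{F}_1$ acts on profiles with respect to the scalar variable ($z\leftrightarrow\xi$), with $q\in S^{d-1}$ and $\tau$ as parameters. Regularizing function: for $\rho>0$, $W_\rho\in C^{d-1}(\mathbb{R};\mathbb{R})$ satisfies $W_\rho(\xi)=0$ for $\xi\le 0$, $W_\rho(\xi)=|\xi|^{(d-1)/2}$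 for $\xi\ge\rho$, and $0\le W_\rho(\xi)\le|\xi|^{(d-1)/2}$ for $\xi\ge 0$. Restriction operator $\mathcal{R}_\rho:X\to X_S$: $\ \mathcal{R}_\rho\hat u_0(\xi,q):=\left(\frac{1}{2\pi i}\right)^{(d-1)/2}W_\rho(\xi)\,\hat u_0(|\xi|q)$. Profile evolution $J_b:X_S\to L^\infty(0,\infty;X_S)$ for $b:\mathbb{R}\to\mathbb{R}$: $\ (J_b\hat V_0)(\xi,q,\tau):=e^{-ib(\xi)\tau}\hat V_0(\xi,q)$. For $b\equiv 0$: $(J_0\hat V_0)(\xi,q,\tau)=\hat V_0(\xi,q)$. Shell operator $\mathcal{S}:L^\infty(0,\infty;X_S)\to L^\infty(0,\infty;X)$, depending on the parameter $\varepsilon>0$: $$(\mathcal{S}V)(x,t):=\frac{1}{(ct)^{(d-1)/2}}\,\mathbf{1}_{\{|x|<2ct\}}\,V\!\left(|x|-ct,\frac{x}{|x|},\varepsilon^2t\right).$$ Regularized reconstruction operators: $\mathcal{Q}_b^\rho:=\mathcal{S}\circ\mathcal{F}_1^{-1}\circ J_b\circ\mathcal{R}_\rho$ and $\hat{\mathcal{Q}}_b^\rho:=\mathcal{F}_d\circ\mathcal{Q}_b^\rho$ (with $\mathcal{F}_d$ acting in the spatial variable $x$); $\hat{\mathcal{Q}}_0^\rho$ is the case $b\equiv 0$. *)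

theory Defs
  imports "HOL-Analysis.Analysis"
begin

text \<open>
  \<open>Ck n f\<close>: \<open>f\<close> is of class \<open>C\<^sup>n\<close> on the whole space (all iterated directional
  derivatives up to order \<open>n\<close> exist and are continuous).
\<close>

primrec Ck :: "nat \<Rightarrow> ('a::euclidean_space \<Rightarrow> 'b::real_normed_vector) \<Rightarrow> bool" where
  "Ck 0 f \<longleftrightarrow> continuous_on UNIV f"
| "Ck (Suc n) f \<longleftrightarrow>
     (\<forall>x. f differentiable (at x)) \<and> (\<forall>v. Ck n (\<lambda>x. frechet_derivative f (at x) v))"

definition smooth :: "('a::euclidean_space \<Rightarrow> 'b::real_normed_vector) \<Rightarrow> bool" where
  "smooth f \<longleftrightarrow> (\<forall>n. Ck n f)"

definition compactly_supported :: "('a::euclidean_space \<Rightarrow> 'b::zero) \<Rightarrow> bool" where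
  "compactly_supported f \<longleftrightarrow> compact (closure {x. f x \<noteq> 0})"

text \<open>
  The transforms are given by their integral formulas on function representatives. For
  \<open>b = 0\<close>, a regularizing \<open>W\<close>, continuous \<open>u\<^sub>0\<close> with compact support, and \<open>t > 0\<close>, both
  transforms occurring in \<open>reconstruction_hat\<close> are applied to absolutely integrable functions:
  the restricted data is continuous with compact support in \<open>\<xi>\<close> for each unit vector \<open>q\<close>, and
  the shell function is measurable and bounded with bounded
  support. So they agree with the \<open>L\<^sup>2\<close> transforms there, and the result is defined at every
  single \<open>k\<close>. At type \<^typ>\<open>real\<close> the inner product is multiplication and the dimension is
  1, so \<open>inv_fourier\<close> is the one-dimensional inverse transform there.
\<close>

definition fourier :: "('a::euclidean_space \<Rightarrow> complex) \<Rightarrow> 'a \<Rightarrow> complex" where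
  "fourier u k = (LINT x|lborel. u x * exp (- (\<i> * of_real (k \<bullet> x))))"

definition inv_fourier :: "('a::euclidean_space \<Rightarrow> complex) \<Rightarrow> 'a \<Rightarrow> complex" where
  "inv_fourier v x =
     of_real (1 / (2 * pi) ^ DIM('a)) * (LINT k|lborel. exp (\<i> * of_real (x \<bullet> k)) * v k)"

definition regularizing :: "nat \<Rightarrow> real \<Rightarrow> (real \<Rightarrow> real) \<Rightarrow> bool" where
  "regularizing d \<rho> W \<longleftrightarrow>
     Ck (d - 1) W \<and>
     (\<forall>\<xi>\<le>0. W \<xi> = 0) \<and>
     (\<forall>\<xi>\<ge>\<rho>. W \<xi> = \<bar>\<xi>\<bar> powr ((real d - 1) / 2)) \<and>
     (\<forall>\<xi>\<ge>0. 0 \<le> W \<xi> \<and> W \<xi> \<le> \<bar>\<xi>\<bar> powr ((real d - 1) / 2))"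

text \<open>
  Functions on \<open>\<real> \<times> S\<^sup>d\<^sup>-\<^sup>1\<close> are represented as functions of \<open>\<xi>\<close> (or \<open>z\<close>) and of a vector
  \<open>q\<close> of the ambient space; only unit vectors \<open>q\<close> matter. The shell operator evaluates its
  argument at \<open>q = x / |x|\<close>, which for \<open>x = 0\<close> (a null set) is the conventional value 0.
\<close>

definition restriction ::
    "(real \<Rightarrow> real) \<Rightarrow> ('a::euclidean_space \<Rightarrow> complex) \<Rightarrow> real \<Rightarrow> 'a \<Rightarrow> complex" where
  "restriction W u \<xi> q =
     (1 / (2 * of_real pi * \<i>)) powr of_real ((real DIM('a) - 1) / 2) *
     of_real (W \<xi>) * u (\<bar>\<xi>\<bar> *\<^sub>R q)"

definition evolution ::
    "(real \<Rightarrow> real) \<Rightarrow> (real \<Rightarrow> 'a \<Rightarrow> complex) \<Rightarrow> real \<Rightarrow> 'a \<Rightarrow> real \<Rightarrow> complex" where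
  "evolution b V \<xi> q \<tau> = exp (- (\<i> * of_real (b \<xi> * \<tau>))) * V \<xi> q"

definition inv_fourier_profile ::
    "(real \<Rightarrow> 'a \<Rightarrow> real \<Rightarrow> complex) \<Rightarrow> real \<Rightarrow> 'a \<Rightarrow> real \<Rightarrow> complex" where
  "inv_fourier_profile V z q \<tau> = inv_fourier (\<lambda>\<xi>. V \<xi> q \<tau>) z"

definition shell ::
    "real \<Rightarrow> real \<Rightarrow> (real \<Rightarrow> 'a::euclidean_space \<Rightarrow> real \<Rightarrow> complex) \<Rightarrow> 'a \<Rightarrow> real \<Rightarrow> complex" where
  "shell c \<epsilon> V x t =
     of_real (1 / (c * t) powr ((real DIM('a) - 1) / 2)) *
     indicator {y. norm y < 2 * c * t} x *
     V (norm x - c * t) (x /\<^sub>R norm x) (\<epsilon>\<^sup>2 * t)"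

definition reconstruction ::
    "real \<Rightarrow> real \<Rightarrow> (real \<Rightarrow> real) \<Rightarrow> (real \<Rightarrow> real) \<Rightarrow>
     ('a::euclidean_space \<Rightarrow> complex) \<Rightarrow> 'a \<Rightarrow> real \<Rightarrow> complex" where
  "reconstruction c \<epsilon> W b =
     shell c \<epsilon> \<circ> inv_fourier_profile \<circ> evolution b \<circ> restriction W"

definition reconstruction_hat ::
    "real \<Rightarrow> real \<Rightarrow> (real \<Rightarrow> real) \<Rightarrow> (real \<Rightarrow> real) \<Rightarrow>
     ('a::euclidean_space \<Rightarrow> complex) \<Rightarrow> 'a \<Rightarrow> real \<Rightarrow> complex" where
  "reconstruction_hat c \<epsilon> W b u k t = fourier (\<lambda>x. reconstruction c \<epsilon> W b u x t) k"

end

(*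
  In polar coordinates about the axis k/|k|, the transform of the shell at time t (with R = c t) is
  R^(-m) times the integral over 0 < r < 2R of r^(2m) v(r - R, q) exp(-i k.rq), where m = (d - 1)/2
  and v is the one-dimensional inverse transform of the profile V. For d = 2, 3 one integrates by parts
  in the colatitude, so that v and its angular derivative are multiplied by integrals of a plane wave
  over spherical caps. Those are O((r|k|)^(-m)), with contributions of the two poles q = k/|k| and
  q = -k/|k|; for d = 2 they reduce to Fresnel integrals. Both v and its angular derivative are
  integrable in z = r - R, since V is C^1 with compact support in xi, so dominated convergence in z
  leaves only the poles. By Fourier inversion the pole k/|k| gives exp(-i R |k|) u(k), and the pole
  -k/|k| gives the value of V at xi = -|k|, where W vanishes. For d = 1 there are just two
  partial Fourier integrals, which converge by Dini's criterion since V is smooth near xi = |k| > rho.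
*)
theory Submission
  imports Defs "HOL-Probability.Sinc_Integral"
begin

section \<open>Oscillatory integrals\<close>

text \<open>The obstacle is integrability in z. In dimension two \<open>W\<close> is only of class
  C^1, so decay of v like 1 / z^2 does not follow; instead v and z v are both square integrable, and
  weighing them against 1 / (1 + z^2) gives an L^1 bound. The same scarcity decides where
  derivatives fall: angular derivatives act on u alone, and only one \<xi>-derivative ever meets
  \<open>W\<close>. Of R^(-m) r^(2m) and the decay r^(-m) of the caps there remains (r / R)^m, which
  is at most 2^m and tends to 1 for fixed z, so the size of the shell is harmless. The constants
  close up through principal values: (2 pi i)^(-m), the mass of the azimuthal sphere and the
  stationary-phase coefficient \<open>cap_coeff\<close> multiply to 1, while W(|k|) = |k|^m for |k|
  > \<rho> cancels the |k|^(-m) of the caps.\<close>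

lemma has_vector_derivative_cis:
  assumes "(f has_real_derivative f') (at x within S)"
  shows "((\<lambda>x. cis (f x)) has_vector_derivative (\<i> * of_real f' * cis (f x))) (at x within S)"
proof -
  have "(f has_derivative (\<lambda>h. f' * h)) (at x within S)"
    using assms by (simp add: has_field_derivative_def)
  from has_derivative_cis[OF this]
  show ?thesis
    by (simp add: has_vector_derivative_def scaleR_conv_of_real mult_ac)
qed

text \<open>Integration by parts with \<open>q = p / \<phi>'\<close>: the derivative of q e^(i l
  \<phi>) is i l p e^(i l \<phi>) plus a term with q' that stays bounded in l. So \<open>C\<close>
  collects the two boundary values and the L^1 norm of q'.\<close>

lemma nonstationary_phase_bound:
  fixes p p' :: "real \<Rightarrow> complex" and \<phi> \<phi>' \<phi>'' :: "real \<Rightarrow> real"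
  assumes "a \<le> b"
    and \<phi>: "\<And>x. x \<in> {a..b} \<Longrightarrow> (\<phi> has_real_derivative \<phi>' x) (at x within {a..b})"
    and \<phi>': "\<And>x. x \<in> {a..b} \<Longrightarrow> (\<phi>' has_real_derivative \<phi>'' x) (at x within {a..b})"
    and \<phi>'': "continuous_on {a..b} \<phi>''"
    and nz: "\<And>x. x \<in> {a..b} \<Longrightarrow> \<phi>' x \<noteq> 0"
    and p: "\<And>x. x \<in> {a..b} \<Longrightarrow> (p has_vector_derivative p' x) (at x within {a..b})"
    and p': "continuous_on {a..b} p'"
  shows "\<exists>C. \<forall>l>0. norm (integral {a..b} (\<lambda>x. p x * cis (l * \<phi> x))) \<le> C / l"
proof -
  define q where "q x = p x / of_real (\<phi>' x)" for x
  define q' where "q' x = p' x / of_real (\<phi>' x) - p x * of_real (\<phi>'' x) / (of_real (\<phi>' x))\<^sup>2" for x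
  have cont: "continuous_on {a..b} \<phi>" "continuous_on {a..b} \<phi>'" "continuous_on {a..b} p"
    using \<phi> \<phi>' p by (blast intro: continuous_on_vector_derivative DERIV_continuous_on)+
  have cq': "continuous_on {a..b} q'"
    unfolding q'_def using nz cont \<phi>'' p' by (auto intro!: continuous_intros)
  have dq: "(q has_vector_derivative q' x) (at x within {a..b})" if x: "x \<in> {a..b}" for x
  proof -
    have 1: "((\<lambda>x. inverse (\<phi>' x)) has_vector_derivative (- (\<phi>'' x) / (\<phi>' x)\<^sup>2)) (at x within {a..b})"
      using DERIV_inverse'[OF \<phi>'[OF x] nz[OF x]]
      by (simp add: has_real_derivative_iff_has_vector_derivative divide_inverse power2_eq_square mult_ac)
    have "((\<lambda>x. inverse (\<phi>' x) *\<^sub>R p x) has_vector_derivative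
       (inverse (\<phi>' x) *\<^sub>R p' x + (- (\<phi>'' x) / (\<phi>' x)\<^sup>2) *\<^sub>R p x)) (at x within {a..b})"
      by (rule has_vector_derivative_scaleR)
        (use 1 p[OF x] in \<open>auto simp: has_real_derivative_iff_has_vector_derivative\<close>)
    moreover have "(\<lambda>x. inverse (\<phi>' x) *\<^sub>R p x) = q"
      by (auto simp: fun_eq_iff q_def scaleR_conv_of_real divide_inverse mult_ac)
    moreover have "(inverse (\<phi>' x) *\<^sub>R p' x + (- (\<phi>'' x) / (\<phi>' x)\<^sup>2) *\<^sub>R p x) = q' x"
      by (auto simp: q'_def scaleR_conv_of_real divide_inverse mult_ac)
    ultimately show ?thesis by metis
  qed
  define C where "C = norm (q a) + norm (q b) + integral {a..b} (\<lambda>x. norm (q' x))"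
  have "norm (integral {a..b} (\<lambda>x. p x * cis (l * \<phi> x))) \<le> C / l" if l: "l > 0" for l
  proof -
    have d: "((\<lambda>x. q x * cis (l * \<phi> x)) has_vector_derivative
        (q' x * cis (l * \<phi> x) + \<i> * l * (p x * cis (l * \<phi> x)))) (at x within {a..b})" if x: "x \<in> {a..b}" for x
    proof -
      have "((\<lambda>x. l * \<phi> x) has_real_derivative l * \<phi>' x) (at x within {a..b})"
        using \<phi>[OF x] by (auto intro!: derivative_eq_intros)
      from has_vector_derivative_mult[OF dq[OF x] has_vector_derivative_cis[OF this]]
      have *: "((\<lambda>x. q x * cis (l * \<phi> x)) has_vector_derivative
        (q x * (\<i> * complex_of_real (l * \<phi>' x) * cis (l * \<phi> x)) + q' x * cis (l * \<phi> x))) (at x within {a..b})" .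
      have "q x * (\<i> * complex_of_real (l * \<phi>' x) * cis (l * \<phi> x)) = \<i> * l * (p x * cis (l * \<phi> x))"
        using nz[OF x] by (simp add: q_def)
      with * show ?thesis by (simp only: add.commute)
    qed
    have "((\<lambda>x. q' x * cis (l * \<phi> x) + \<i> * l * (p x * cis (l * \<phi> x))) has_integral
       (q b * cis (l * \<phi> b) - q a * cis (l * \<phi> a))) {a..b}"
      by (rule fundamental_theorem_of_calculus[OF \<open>a \<le> b\<close> d]) auto
    moreover have i1: "(\<lambda>x. q' x * cis (l * \<phi> x)) integrable_on {a..b}"
      using cq' cont by (intro integrable_continuous_real continuous_intros)
    ultimately have "((\<lambda>x. \<i> * l * (p x * cis (l * \<phi> x))) has_integral
       (q b * cis (l * \<phi> b) - q a * cis (l * \<phi> a) - integral {a..b} (\<lambda>x. q' x * cis (l * \<phi> x)))) {a..b}"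
      using has_integral_diff[OF _ integrable_integral[OF i1]] by fastforce
    moreover have i2: "(\<lambda>x. p x * cis (l * \<phi> x)) integrable_on {a..b}"
      using cont by (intro integrable_continuous_real continuous_intros)
    ultimately have eq: "\<i> * l * integral {a..b} (\<lambda>x. p x * cis (l * \<phi> x)) =
        q b * cis (l * \<phi> b) - q a * cis (l * \<phi> a) - integral {a..b} (\<lambda>x. q' x * cis (l * \<phi> x))"
      using has_integral_unique has_integral_mult_right[OF integrable_integral[OF i2]] by blast
    have "norm (integral {a..b} (\<lambda>x. q' x * cis (l * \<phi> x))) \<le> integral {a..b} (\<lambda>x. norm (q' x))"
      using i1 cont by (intro integral_norm_bound_integral integrable_continuous_real continuous_intros cq')
        (auto simp: norm_mult)
    hence "norm (\<i> * l * integral {a..b} (\<lambda>x. p x * cis (l * \<phi> x))) \<le> C"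
      unfolding eq C_def
      using norm_triangle_ineq4[of "q b * cis (l * \<phi> b) - q a * cis (l * \<phi> a)" "integral {a..b} (\<lambda>x. q' x * cis (l * \<phi> x))"]
        norm_triangle_ineq4[of "q b * cis (l * \<phi> b)" "q a * cis (l * \<phi> a)"]
      by (simp add: norm_mult)
    thus ?thesis using l by (simp add: norm_mult field_simps)
  qed
  thus ?thesis by blast
qed

text \<open>A Riemann-Lebesgue lemma for a phase that may be stationary at the two ends, as the
  cosine is at the poles. The end pieces are small by their length alone; in between, the merely
  continuous amplitude is replaced by a polynomial, to which the bound C / l applies.\<close>

lemma oscillatory_integral_tendsto_0:
  fixes g :: "real \<Rightarrow> complex" and \<phi> \<phi>' \<phi>'' :: "real \<Rightarrow> real"
  assumes "a < b"
    and \<phi>: "\<And>x. x \<in> {a..b} \<Longrightarrow> (\<phi> has_real_derivative \<phi>' x) (at x within {a..b})"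
    and \<phi>': "\<And>x. x \<in> {a..b} \<Longrightarrow> (\<phi>' has_real_derivative \<phi>'' x) (at x within {a..b})"
    and \<phi>'': "continuous_on {a..b} \<phi>''"
    and nz: "\<And>x. x \<in> {a<..<b} \<Longrightarrow> \<phi>' x \<noteq> 0"
    and g: "continuous_on {a..b} g"
  shows "((\<lambda>l. integral {a..b} (\<lambda>x. g x * cis (l * \<phi> x))) \<longlongrightarrow> 0) at_top"
proof (rule tendstoI)
  fix e :: real assume e: "e > 0"
  obtain M where M: "\<And>x. x \<in> {a..b} \<Longrightarrow> norm (g x) \<le> M"
    using compact_imp_bounded[OF compact_continuous_image[OF g compact_Icc]]
    unfolding bounded_iff by (metis imageI)
  have M0: "M \<ge> 0" using order_trans[OF norm_ge_zero M[of a]] \<open>a < b\<close> by auto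
  \<comment> \<open>The error budget: each end piece of length \<delta> costs at most M \<delta> <
    e/8, the polynomial approximation e/4, and the polynomial itself less than e/4 for large l. The
    third of \<open>b - a\<close> keeps the middle interval nonempty, and \<open>M + 1\<close>
    guards against \<open>M = 0\<close>.\<close>
  define \<delta> where "\<delta> = min ((b - a) / 3) (e / (8 * (M + 1)))"
  have \<delta>: "\<delta> > 0" "\<delta> \<le> (b-a)/3" "M * \<delta> < e / 8"
  proof -
    show "\<delta> > 0" using e M0 \<open>a<b\<close> by (auto simp: \<delta>_def)
    show "\<delta> \<le> (b-a)/3" unfolding \<delta>_def by (rule min.cobounded1)
    have "M * \<delta> \<le> M * (e / (8 * (M + 1)))" using M0 by (intro mult_left_mono) (auto simp: \<delta>_def)
    also have "\<dots> < e / 8" using M0 e by (simp add: field_simps)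
    finally show "M * \<delta> < e / 8" .
  qed
  obtain p where p: "polynomial_function p" "\<And>x. x \<in> {a..b} \<Longrightarrow> norm (g x - p x) < e / (4 * (b - a))"
    using Stone_Weierstrass_polynomial_function[OF compact_Icc g, of "e / (4 * (b - a))"] e \<open>a<b\<close> by auto
  obtain p' where p': "polynomial_function p'" "\<And>x. (p has_vector_derivative (p' x)) (at x)"
    using has_vector_derivative_polynomial_function[OF p(1)] by auto
  have sub: "{a+\<delta>..b-\<delta>} \<subseteq> {a..b}" "{a+\<delta>..b-\<delta>} \<subseteq> {a<..<b}" using \<delta> by auto
  have cont: "continuous_on {a..b} \<phi>" "continuous_on {a..b} p"
    using \<phi> continuous_on_polymonial_function[OF p(1)] by (blast intro: DERIV_continuous_on)+
  obtain C where C: "\<And>l. l > 0 \<Longrightarrow> norm (integral {a+\<delta>..b-\<delta>} (\<lambda>x. p x * cis (l * \<phi> x))) \<le> C / l"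
  proof -
    have "\<exists>C. \<forall>l>0. norm (integral {a+\<delta>..b-\<delta>} (\<lambda>x. p x * cis (l * \<phi> x))) \<le> C / l"
    proof (rule nonstationary_phase_bound)
      show "a + \<delta> \<le> b - \<delta>" using \<delta> by auto
      show "(\<phi> has_real_derivative \<phi>' x) (at x within {a + \<delta>..b - \<delta>})" if "x \<in> {a + \<delta>..b - \<delta>}" for x
        using \<phi>[of x] that sub by (auto intro: DERIV_subset)
      show "(\<phi>' has_real_derivative \<phi>'' x) (at x within {a + \<delta>..b - \<delta>})" if "x \<in> {a + \<delta>..b - \<delta>}" for x
        using \<phi>'[of x] that sub by (auto intro: DERIV_subset)
      show "continuous_on {a + \<delta>..b - \<delta>} \<phi>''" using \<phi>'' sub continuous_on_subset by blast
      show "\<phi>' x \<noteq> 0" if "x \<in> {a + \<delta>..b - \<delta>}" for x using nz that sub by blast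
      show "(p has_vector_derivative p' x) (at x within {a + \<delta>..b - \<delta>})" for x
        using p'(2) has_vector_derivative_at_within by blast
      show "continuous_on {a + \<delta>..b - \<delta>} p'"
        by (rule continuous_on_polymonial_function[OF p'(1)])
    qed
    thus ?thesis using that by blast
  qed
  have bound: "norm (integral {a..b} (\<lambda>x. g x * cis (l * \<phi> x))) < e" if l: "l > 0" "C / l < e / 4" for l
  proof -
    let ?f = "\<lambda>x. g x * cis (l * \<phi> x)"
    have sub': "continuous_on {c..d} \<phi>" "continuous_on {c..d} p" "continuous_on {c..d} g"
      if "a \<le> c" "d \<le> b" for c d
      using that cont g by (meson atLeastatMost_subset_iff continuous_on_subset)+
    have int: "?f integrable_on {c..d}" if "a \<le> c" "d \<le> b" for c d
      using that sub'
      by (intro integrable_continuous_real continuous_intros) blast+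
    have intp: "(\<lambda>x. p x * cis (l * \<phi> x)) integrable_on {a+\<delta>..b-\<delta>}"
      using sub'[of "a+\<delta>" "b-\<delta>"] \<delta> by (intro integrable_continuous_real continuous_intros) auto
    have "integral {a..b} ?f = integral {a..a+\<delta>} ?f + integral {a+\<delta>..b} ?f"
      using \<delta> int[of a b] by (subst Henstock_Kurzweil_Integration.integral_combine) auto
    also have "integral {a+\<delta>..b} ?f = integral {a+\<delta>..b-\<delta>} ?f + integral {b-\<delta>..b} ?f"
      using \<delta> int[of "a+\<delta>" b] by (subst Henstock_Kurzweil_Integration.integral_combine) auto
    also have "integral {a+\<delta>..b-\<delta>} ?f = integral {a+\<delta>..b-\<delta>} (\<lambda>x. p x * cis (l * \<phi> x)) +
        integral {a+\<delta>..b-\<delta>} (\<lambda>x. (g x - p x) * cis (l * \<phi> x))"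
      using int[of "a+\<delta>" "b-\<delta>"] intp \<delta> by (simp add: left_diff_distrib Henstock_Kurzweil_Integration.integral_diff)
    finally have eq: "integral {a..b} ?f = integral {a..a+\<delta>} ?f + (integral {a+\<delta>..b-\<delta>} (\<lambda>x. p x * cis (l * \<phi> x)) +
        integral {a+\<delta>..b-\<delta>} (\<lambda>x. (g x - p x) * cis (l * \<phi> x)) + integral {b-\<delta>..b} ?f)" .
    have 1: "norm (integral {a..a+\<delta>} ?f) \<le> M * (a + \<delta> - a)"
      using \<delta> sub'[of a "a+\<delta>"] M by (intro integral_bound continuous_intros) (auto simp: norm_mult)
    have 2: "norm (integral {b-\<delta>..b} ?f) \<le> M * (b - (b - \<delta>))"
      using \<delta> sub'[of "b-\<delta>" b] M by (intro integral_bound continuous_intros) (auto simp: norm_mult)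
    have 3: "norm (integral {a+\<delta>..b-\<delta>} (\<lambda>x. (g x - p x) * cis (l * \<phi> x))) \<le> e / (4 * (b - a)) * ((b-\<delta>) - (a+\<delta>))"
      using \<delta> sub'[of "a+\<delta>" "b-\<delta>"] p(2) by (intro integral_bound continuous_intros)
        (auto simp: norm_mult intro: less_imp_le)
    also have "\<dots> \<le> e / (4 * (b - a)) * (b - a)"
      using e \<delta> \<open>a<b\<close> by (intro mult_left_mono) auto
    also have "\<dots> = e / 4" using \<open>a<b\<close> by (simp del: right_diff_distrib_numeral)
    finally have 3: "norm (integral {a+\<delta>..b-\<delta>} (\<lambda>x. (g x - p x) * cis (l * \<phi> x))) \<le> e / 4" .
    have 4: "norm (integral {a+\<delta>..b-\<delta>} (\<lambda>x. p x * cis (l * \<phi> x))) < e / 4"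
      using C[OF l(1)] l(2) by linarith
    have "norm (integral {a..b} ?f) \<le> norm (integral {a..a+\<delta>} ?f) + (norm (integral {a+\<delta>..b-\<delta>} (\<lambda>x. p x * cis (l * \<phi> x))) +
        norm (integral {a+\<delta>..b-\<delta>} (\<lambda>x. (g x - p x) * cis (l * \<phi> x))) + norm (integral {b-\<delta>..b} ?f))"
      unfolding eq by (intro norm_triangle_mono order_refl)
    also have "\<dots> < e" using 1 2 3 4 \<delta>(3) e by simp
    finally show ?thesis .
  qed
  have "((\<lambda>l. C / l) \<longlongrightarrow> 0) at_top"
    by (rule real_tendsto_divide_at_top[OF tendsto_const filterlim_ident])
  hence "\<forall>\<^sub>F l in at_top. C / l < e / 4" using e by (intro order_tendstoD) auto
  with eventually_gt_at_top[of 0]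
  show "\<forall>\<^sub>F l in at_top. dist (integral {a..b} (\<lambda>x. g x * cis (l * \<phi> x))) 0 < e"
    by eventually_elim (use bound in auto)
qed

section \<open>Fresnel integrals\<close>

text \<open>Convergence is asked for in the open interval only, because it fails at end points in
  the applications: \<open>fresnel\<close> at 0 and \<open>cap_wave\<close> at \<open>pi\<close> are
  0 for every l and miss the limit found in the interior.\<close>

lemma tendsto_integral_Icc_dominated:
  fixes f :: "real \<Rightarrow> real \<Rightarrow> 'b::euclidean_space"
  assumes f: "\<And>l. l > 0 \<Longrightarrow> continuous_on {a..b} (f l)"
    and g: "continuous_on {a..b} g"
    and M: "\<And>l x. l > 0 \<Longrightarrow> x \<in> {a<..<b} \<Longrightarrow> norm (f l x) \<le> M"
    and lim: "\<And>x. x \<in> {a<..<b} \<Longrightarrow> ((\<lambda>l. f l x) \<longlongrightarrow> g x) at_top"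
  shows "((\<lambda>l. integral {a..b} (f l)) \<longlongrightarrow> integral {a..b} g) at_top"
proof (rule tendsto_at_topI_sequentially)
  fix X :: "nat \<Rightarrow> real" assume X: "filterlim X at_top sequentially"
  then obtain N where N: "\<And>n. n \<ge> N \<Longrightarrow> X n > 0"
    by (auto simp: filterlim_at_top_dense eventually_sequentially)
  have open_int: "integral {a<..<b} h = integral {a..b} h" for h :: "real \<Rightarrow> 'b"
    by (simp add: integral_open_interval_real)
  have "(\<lambda>n. integral {a<..<b} (f (X (n + N)))) \<longlonglongrightarrow> integral {a<..<b} g"
  proof (rule dominated_convergence(2)[where h = "\<lambda>_. M"])
    show "f (X (n + N)) integrable_on {a<..<b}" for n
      using integrable_continuous_real[OF f[OF N]] by (simp add: integrable_on_open_interval_real)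
    show "(\<lambda>_. M) integrable_on {a<..<b}"
      using integrable_continuous_real[OF continuous_on_const[of "{a..b}" M]]
      by (simp only: integrable_on_open_interval_real)
    show "norm (f (X (n + N)) x) \<le> M" if "x \<in> {a<..<b}" for n x
      using M[OF N that] by simp
    show "(\<lambda>n. f (X (n + N)) x) \<longlonglongrightarrow> g x" if "x \<in> {a<..<b}" for x
      using LIMSEQ_ignore_initial_segment[OF filterlim_compose[OF lim[OF that] X]] .
  qed
  thus "(\<lambda>n. integral {a..b} (f (X n))) \<longlonglongrightarrow> integral {a..b} g"
    unfolding open_int by (rule LIMSEQ_offset)
qed

definition fresnel :: "real \<Rightarrow> complex" where
  "fresnel T = integral {0..T} (\<lambda>s. cis (s\<^sup>2))"

lemma fresnel_0 [simp]: "fresnel 0 = 0"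
  by (simp add: fresnel_def)

lemma has_vector_derivative_fresnel:
  assumes "x \<in> {0..b}"
  shows "(fresnel has_vector_derivative cis (x\<^sup>2)) (at x within {0..b})"
proof -
  have "((\<lambda>u. integral {0..u} (\<lambda>s. cis (s\<^sup>2))) has_vector_derivative cis (x\<^sup>2)) (at x within {0..b})"
    using assms by (intro integral_has_vector_derivative continuous_intros) auto
  thus ?thesis by (simp add: fresnel_def [abs_def])
qed

text \<open>The substitution s = T x moves T from the interval into the integrand. The derivative 2
  e^(i T^2) F(T) of the square of F = \<open>fresnel\<close> thus becomes an integral over x in
  [0, 1] with the phase T^2 (1 + x^2).\<close>

lemma fresnel_rescale:
  assumes T: "T \<ge> 0"
  shows "fresnel T = T * integral {0..1} (\<lambda>x. cis (T\<^sup>2 * x\<^sup>2))"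
proof -
  have "((\<lambda>x. T *\<^sub>R cis ((T * x)\<^sup>2)) has_integral (fresnel (T * 1) - fresnel (T * 0))) {0..1}"
  proof (rule fundamental_theorem_of_calculus)
    fix x :: real assume x: "x \<in> {0..1}"
    have "(fresnel \<circ> (\<lambda>x. T * x) has_vector_derivative T *\<^sub>R cis ((T * x)\<^sup>2)) (at x within {0..1})"
    proof (rule vector_diff_chain_within)
      show "((*) T has_vector_derivative T) (at x within {0..1})"
        by (auto intro!: derivative_eq_intros)
      have "(*) T ` {0..1} \<subseteq> {0..T}" using T by (auto intro: mult_left_le)
      moreover have "T * x \<in> {0..T}" using T x by (auto intro: mult_left_le)
      ultimately show "(fresnel has_vector_derivative cis ((T * x)\<^sup>2)) (at (T * x) within (*) T ` {0..1})"
        using has_vector_derivative_fresnel has_vector_derivative_within_subset by blast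
    qed
    thus "((\<lambda>x. fresnel (T * x)) has_vector_derivative T *\<^sub>R cis ((T * x)\<^sup>2)) (at x within {0..1})"
      by (simp add: o_def)
  qed simp
  hence "((\<lambda>x. T * cis (T\<^sup>2 * x\<^sup>2)) has_integral fresnel T) {0..1}"
    by (simp add: scaleR_conv_of_real power_mult_distrib)
  hence "fresnel T = integral {0..1} (\<lambda>x. of_real T * cis (T\<^sup>2 * x\<^sup>2))"
    by (rule integral_unique [symmetric])
  thus ?thesis by (simp only: integral_mult_right)
qed

text \<open>As in the evaluation of the Gauss integral, both sides have the same derivative in \<open>T\<close>.\<close>

lemma fresnel_square:
  assumes T: "T \<ge> 0"
  shows "(fresnel T)\<^sup>2 = integral {0..1} (\<lambda>x. (cis (T\<^sup>2 * (1 + x\<^sup>2)) - 1) / (\<i> * of_real (1 + x\<^sup>2)))"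
    (is "_ = ?G T")
proof -
  have pos: "1 + x\<^sup>2 \<noteq> 0" for x :: real by (smt (verit) zero_le_power2)
  have nz: "1 + (complex_of_real x)\<^sup>2 \<noteq> 0" for x :: real
    using pos[of x] by (metis of_real_1 of_real_add of_real_eq_0_iff of_real_power)
  have G': "(?G has_vector_derivative integral {0..1} (\<lambda>x. of_real (2 * t) * cis (t\<^sup>2 * (1 + x\<^sup>2)))) (at t within {0..T})"
    if t: "t \<in> {0..T}" for t
  proof -
    have "((\<lambda>t. integral (cbox 0 1) (\<lambda>x. (cis (t\<^sup>2 * (1 + x\<^sup>2)) - 1) / (\<i> * of_real (1 + x\<^sup>2))))
        has_vector_derivative integral (cbox 0 1) (\<lambda>x. of_real (2 * t) * cis (t\<^sup>2 * (1 + x\<^sup>2)))) (at t within {0..T})"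
    proof (rule leibniz_rule_vector_derivative[where fx = "\<lambda>t x. complex_of_real (2 * t) * cis (t\<^sup>2 * (1 + x\<^sup>2))"])
      fix t x :: real
      have "((\<lambda>t. t\<^sup>2 * (1 + x\<^sup>2)) has_real_derivative 2 * t * (1 + x\<^sup>2)) (at t within {0..T})"
        by (auto intro!: derivative_eq_intros)
      from has_vector_derivative_cis[OF this]
      have "((\<lambda>t. (cis (t\<^sup>2 * (1 + x\<^sup>2)) - 1) * (1 / (\<i> * of_real (1 + x\<^sup>2)))) has_vector_derivative
         (\<i> * complex_of_real (2 * t * (1 + x\<^sup>2)) * cis (t\<^sup>2 * (1 + x\<^sup>2)) - 0) * (1 / (\<i> * of_real (1 + x\<^sup>2))))
          (at t within {0..T})"
        by (intro has_vector_derivative_mult_left has_vector_derivative_diff has_vector_derivative_const)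
      moreover have "(\<i> * complex_of_real (2 * t * (1 + x\<^sup>2)) * cis (t\<^sup>2 * (1 + x\<^sup>2)) - 0) * (1 / (\<i> * of_real (1 + x\<^sup>2)))
        = of_real (2 * t) * cis (t\<^sup>2 * (1 + x\<^sup>2))"
      proof -
        have "(\<i> * complex_of_real (2 * t * (1 + x\<^sup>2)) * c) * (1 / (\<i> * of_real (1 + x\<^sup>2))) = 2 * t * c" for c :: complex
          using nz[of x] by simp
        thus ?thesis by (simp only: diff_zero)
      qed
      ultimately show "((\<lambda>t. (cis (t\<^sup>2 * (1 + x\<^sup>2)) - 1) / (\<i> * of_real (1 + x\<^sup>2)))
         has_vector_derivative of_real (2 * t) * cis (t\<^sup>2 * (1 + x\<^sup>2))) (at t within {0..T})"
        by simp
    next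
      show "(\<lambda>x. (cis (t\<^sup>2 * (1 + x\<^sup>2)) - 1) / (\<i> * of_real (1 + x\<^sup>2))) integrable_on cbox 0 1" for t :: real
        using nz by (auto intro!: integrable_continuous_real continuous_intros)
    next
      show "continuous_on ({0..T} \<times> cbox 0 1) (\<lambda>(t, x). complex_of_real (2 * t) * cis (t\<^sup>2 * (1 + x\<^sup>2)))"
        by (auto simp: case_prod_unfold intro!: continuous_intros)
    qed (use t in auto)
    thus ?thesis by simp
  qed
  have F': "((\<lambda>t. fresnel t * fresnel t) has_vector_derivative integral {0..1} (\<lambda>x. of_real (2 * t) * cis (t\<^sup>2 * (1 + x\<^sup>2)))) (at t within {0..T})"
    if t: "t \<in> {0..T}" for t
  proof -
    have "fresnel t * cis (t\<^sup>2) + cis (t\<^sup>2) * fresnel t = 2 * cis (t\<^sup>2) * fresnel t" by simp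
    also have "\<dots> = integral {0..1} (\<lambda>x. 2 * cis (t\<^sup>2) * t * cis (t\<^sup>2 * x\<^sup>2))"
      using t fresnel_rescale[of t] by simp
    also have "(\<lambda>x. 2 * cis (t\<^sup>2) * t * cis (t\<^sup>2 * x\<^sup>2)) = (\<lambda>x. of_real (2 * t) * cis (t\<^sup>2 * (1 + x\<^sup>2)))"
      by (simp add: fun_eq_iff cis_mult distrib_left flip: mult.assoc)
    finally have eq: "fresnel t * cis (t\<^sup>2) + cis (t\<^sup>2) * fresnel t = integral {0..1} (\<lambda>x. of_real (2 * t) * cis (t\<^sup>2 * (1 + x\<^sup>2)))" .
    show ?thesis
      using has_vector_derivative_mult[OF has_vector_derivative_fresnel[OF t] has_vector_derivative_fresnel[OF t]]
      by (simp only: eq)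
  qed
  have "((\<lambda>t. fresnel t * fresnel t - ?G t) has_vector_derivative 0) (at t within {0..T})" if t: "t \<in> {0..T}" for t
    using has_vector_derivative_diff[OF F'[OF t] G'[OF t]] by simp
  then obtain c where c: "\<And>t. t \<in> {0..T} \<Longrightarrow> fresnel t * fresnel t - ?G t = c"
    using has_vector_derivative_zero_constant[OF convex_real_interval(5)] by blast
  from c[of 0] c[of T] show ?thesis using T by (simp add: power2_eq_square)
qed

lemma norm_fresnel_le:
  assumes "t \<ge> 0"
  shows "norm (fresnel t) \<le> t"
proof -
  have "continuous_on {0..t} (\<lambda>s. cis (s\<^sup>2))" by (intro continuous_intros)
  from integral_bound[OF assms this, of 1] show ?thesis by (simp add: fresnel_def)
qed

text \<open>This selects the right square root of the limit of \<open>(fresnel T)\<^sup>2\<close>.\<close>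

lemma Im_fresnel_nonneg:
  assumes T: "T \<ge> 0"
  shows "Im (fresnel T) \<ge> 0"
proof (cases "T = 0")
  case False
  with T have T: "T > 0" by simp
  \<comment> \<open>Integration by parts of sin(s^2) = 2 s sin(s^2) / (2 s), with 1 - cos(s^2) as
    antiderivative of the numerator, leaves the nonnegative integrand (1 - cos(s^2)) / (2 s^2); this
    is the derivative of \<open>H\<close>. The denominators exclude s = 0, so \<open>H\<close> is
    compared between d > 0 and T.\<close>
  define H where "H s = Im (fresnel s) - (1 - cos (s\<^sup>2)) / (2 * s)" for s
  \<comment> \<open>The loss d comes from |F(d)| <= d and d / 2 from 1 - cos(d^2) <= d^2; both
    disappear as d tends to 0.\<close>
  have low: "Im (fresnel T) \<ge> - d - d / 2" if d: "0 < d" "d < T" for d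
  proof -
    have "H d \<le> H T"
    proof (rule DERIV_nonneg_imp_increasing_open[OF less_imp_le[OF d(2)]])
      fix s assume s: "d < s" "s < T"
      have "(fresnel has_vector_derivative cis (s\<^sup>2)) (at s within {0..T})"
        using s d by (intro has_vector_derivative_fresnel) auto
      hence "(fresnel has_vector_derivative cis (s\<^sup>2)) (at s)"
        using s d by (simp add: at_within_Icc_at)
      hence "((\<lambda>s. Im (fresnel s)) has_real_derivative sin (s\<^sup>2)) (at s)"
        using bounded_linear.has_vector_derivative[OF bounded_linear_Im]
        by (fastforce simp: has_real_derivative_iff_has_vector_derivative)
      moreover have "((\<lambda>s. (1 - cos (s\<^sup>2)) / (2 * s)) has_real_derivative sin (s\<^sup>2) - (1 - cos (s\<^sup>2)) / (2 * s\<^sup>2)) (at s)"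
        using s d by (auto intro!: derivative_eq_intros simp: field_simps power2_eq_square)
      ultimately have "(H has_real_derivative (1 - cos (s\<^sup>2)) / (2 * s\<^sup>2)) (at s)"
        unfolding H_def using DERIV_diff by fastforce
      moreover have "(1 - cos (s\<^sup>2)) / (2 * s\<^sup>2) \<ge> 0" by simp
      ultimately show "\<exists>y. (H has_real_derivative y) (at s) \<and> 0 \<le> y" by blast
    next
      have "continuous_on {0..T} fresnel"
        using has_vector_derivative_fresnel by (rule continuous_on_vector_derivative)
      hence "continuous_on {d..T} fresnel" by (rule continuous_on_subset) (use d in auto)
      thus "continuous_on {d..T} H" unfolding H_def using d by (intro continuous_intros) auto
    qed
    moreover have "H T \<le> Im (fresnel T)" unfolding H_def using T by simp
    moreover have "- d \<le> Im (fresnel d)"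
      using norm_fresnel_le[of d] d abs_Im_le_cmod[of "fresnel d"] by linarith
    moreover have "(1 - cos (d\<^sup>2)) / (2 * d) \<le> d / 2"
    proof -
      have "1 - cos (d\<^sup>2) \<le> d\<^sup>2"
      proof (cases "d\<^sup>2 \<le> 2")
        case True
        have "1 - cos (d\<^sup>2) = 2 * sin (d\<^sup>2 / 2) * sin (d\<^sup>2 / 2)"
          using cos_double_sin[of "d\<^sup>2/2"] by (simp add: power2_eq_square)
        also have "\<dots> \<le> 2 * (d\<^sup>2 / 2)"
        proof -
          have "\<bar>sin (d\<^sup>2 / 2)\<bar> \<le> d\<^sup>2/2" using abs_sin_x_le_abs_x[of "d\<^sup>2/2"] by simp
          moreover have "\<bar>sin (d\<^sup>2 / 2)\<bar> \<le> 1" by simp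
          ultimately have "\<bar>sin (d\<^sup>2 / 2)\<bar> * \<bar>sin (d\<^sup>2 / 2)\<bar> \<le> (d\<^sup>2/2) * 1" by (intro mult_mono) auto
          thus ?thesis by (simp flip: abs_mult)
        qed
        finally show ?thesis by simp
      next
        case False
        thus ?thesis using cos_ge_minus_one[of "d\<^sup>2"] by linarith
      qed
      thus ?thesis using d by (simp add: field_simps power2_eq_square)
    qed
    ultimately show ?thesis unfolding H_def by linarith
  qed
  show ?thesis
  proof (rule ccontr)
    assume neg: "\<not> ?thesis"
    define d where "d = min (T / 2) (- Im (fresnel T) / 2)"
    have "0 < d" "d < T" "d \<le> - Im (fresnel T) / 2" using neg T by (auto simp: d_def)
    with low[of d] neg show False by simp
  qed
qed simp

definition fresnel_limit :: complex where
  "fresnel_limit = of_real (sqrt pi / 2) * cis (pi / 4)"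

text \<open>In the formula for the square the oscillating part tends to 0, its phase 1 + x^2 being
  stationary only at the end x = 0, and the rest is i arctan 1 = i pi / 4. To return from F^2 to F,
  write F^2 - L^2 = (F - L)(F + L) and use |F + L| >= Im L > 0, which holds because Im F is
  nonnegative.\<close>

lemma tendsto_fresnel: "(fresnel \<longlongrightarrow> fresnel_limit) at_top"
proof -
  have pos: "1 + x\<^sup>2 \<noteq> 0" for x :: real by (smt (verit) zero_le_power2)
  have nz: "1 + (complex_of_real x)\<^sup>2 \<noteq> 0" for x :: real
    using pos[of x] by (metis of_real_1 of_real_add of_real_eq_0_iff of_real_power)
  have "((\<lambda>l. integral {0..1} (\<lambda>x. 1 / (\<i> * of_real (1 + x\<^sup>2)) * cis (l * (1 + x\<^sup>2)))) \<longlongrightarrow> 0) at_top"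
    by (rule oscillatory_integral_tendsto_0[where \<phi>' = "\<lambda>x. 2 * x" and \<phi>'' = "\<lambda>x. 2"])
      (use nz in \<open>auto intro!: derivative_eq_intros continuous_intros\<close>)
  moreover have "filterlim (\<lambda>T::real. T\<^sup>2) at_top at_top"
    by (rule filterlim_pow_at_top) (auto simp: filterlim_ident)
  ultimately have lim: "((\<lambda>T. integral {0..1} (\<lambda>x. 1 / (\<i> * of_real (1 + x\<^sup>2)) * cis (T\<^sup>2 * (1 + x\<^sup>2)))) \<longlongrightarrow> 0) at_top"
    using filterlim_compose by blast
  have "((\<lambda>x. inverse (1 + x\<^sup>2)) has_integral (arctan 1 - arctan 0)) {0..1}"
    by (rule fundamental_theorem_of_calculus)
      (auto intro!: derivative_eq_intros simp flip: has_real_derivative_iff_has_vector_derivative)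
  hence "((\<lambda>x. of_real (inverse (1 + x\<^sup>2)) :: complex) has_integral of_real (pi / 4)) {0..1}"
    using has_integral_linear[OF _ bounded_linear_of_real, of "\<lambda>x. inverse (1 + x\<^sup>2)" "pi/4" "{0..1}"]
    by (simp add: arctan_one o_def del: of_real_inverse of_real_add of_real_divide)
  note has_integral_mult_right[OF this, of "- \<i>"]
  moreover have "(\<lambda>x. - \<i> * of_real (inverse (1 + x\<^sup>2))) = (\<lambda>x. 1 / (\<i> * of_real (1 + x\<^sup>2)))"
    by (simp add: fun_eq_iff divide_inverse)
  ultimately have pi4: "((\<lambda>x. 1 / (\<i> * of_real (1 + x\<^sup>2))) has_integral (- \<i> * of_real (pi / 4))) {0..1}"
    by (simp only:)
  have eq: "(fresnel T)\<^sup>2 = integral {0..1} (\<lambda>x. 1 / (\<i> * of_real (1 + x\<^sup>2)) * cis (T\<^sup>2 * (1 + x\<^sup>2))) + \<i> * of_real (pi / 4)"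
    if "T \<ge> 0" for T
  proof -
    have "(fresnel T)\<^sup>2 = integral {0..1} (\<lambda>x. 1 / (\<i> * of_real (1 + x\<^sup>2)) * cis (T\<^sup>2 * (1 + x\<^sup>2)) - 1 / (\<i> * of_real (1 + x\<^sup>2)))"
      unfolding fresnel_square[OF that] by (simp add: diff_divide_distrib)
    also have "\<dots> = integral {0..1} (\<lambda>x. 1 / (\<i> * of_real (1 + x\<^sup>2)) * cis (T\<^sup>2 * (1 + x\<^sup>2))) - (- \<i> * of_real (pi / 4))"
      using pi4 nz
      by (subst Henstock_Kurzweil_Integration.integral_diff)
        (auto simp: integral_unique intro!: integrable_continuous_real continuous_intros)
    finally show ?thesis by simp
  qed
  have sq: "fresnel_limit\<^sup>2 = \<i> * of_real (pi / 4)"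
    by (simp add: fresnel_limit_def power_mult_distrib power_divide flip: of_real_power)
      (simp add: power2_eq_square cis_mult flip: of_real_mult)
  have "((\<lambda>T. (fresnel T)\<^sup>2 - fresnel_limit\<^sup>2) \<longlongrightarrow> 0) at_top"
    by (rule Lim_transform_eventually[OF lim eventually_mono[OF eventually_ge_at_top[of 0]]])
      (simp add: eq sq)
  hence "((\<lambda>T. norm ((fresnel T)\<^sup>2 - fresnel_limit\<^sup>2) / Im fresnel_limit) \<longlongrightarrow> 0 / Im fresnel_limit) at_top"
    by (intro tendsto_divide tendsto_norm_zero tendsto_const) (simp_all add: fresnel_limit_def sin_45)
  hence 0: "((\<lambda>T. norm ((fresnel T)\<^sup>2 - fresnel_limit\<^sup>2) / Im fresnel_limit) \<longlongrightarrow> 0) at_top" by simp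
  have Im: "Im fresnel_limit > 0" by (simp add: fresnel_limit_def sin_45)
  have "\<forall>\<^sub>F T in at_top. norm (fresnel T - fresnel_limit) \<le> norm ((fresnel T)\<^sup>2 - fresnel_limit\<^sup>2) / Im fresnel_limit"
    using eventually_ge_at_top[of 0]
  proof eventually_elim
    case (elim T)
    have "norm (fresnel T - fresnel_limit) * Im fresnel_limit \<le> norm (fresnel T - fresnel_limit) * norm (fresnel T + fresnel_limit)"
      using Im_fresnel_nonneg[OF elim] abs_Im_le_cmod[of "fresnel T + fresnel_limit"]
      by (intro mult_left_mono) auto
    also have "\<dots> = norm ((fresnel T)\<^sup>2 - fresnel_limit\<^sup>2)"
      by (simp add: power2_eq_square algebra_simps flip: norm_mult)
    finally show ?case using Im by (simp add: field_simps)
  qed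
  hence "((\<lambda>T. fresnel T - fresnel_limit) \<longlongrightarrow> 0) at_top"
    by (rule Lim_null_comparison) (rule 0)
  thus ?thesis by (simp add: LIM_zero_iff)
qed

lemma fresnel_bounded: obtains M where "M > 0" "\<And>T. T \<ge> 0 \<Longrightarrow> norm (fresnel T) \<le> M"
proof -
  have "\<forall>\<^sub>F T in at_top. dist (fresnel T) fresnel_limit < 1"
    using tendsto_fresnel by (rule tendstoD) simp
  then obtain N where N: "\<And>T. T \<ge> N \<Longrightarrow> dist (fresnel T) fresnel_limit < 1"
    by (auto simp: eventually_at_top_linorder)
  have "norm (fresnel T) \<le> \<bar>N\<bar> + norm fresnel_limit + 1" if "T \<ge> 0" for T
  proof (cases "T \<ge> N")
    case True
    from N[OF this] norm_triangle_sub[of "fresnel T" fresnel_limit] show ?thesis by (simp add: dist_norm)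
  next
    case False
    with norm_fresnel_le[OF that] norm_ge_zero[of fresnel_limit] show ?thesis by linarith
  qed
  moreover have "\<bar>N\<bar> + norm fresnel_limit + 1 > 0" using norm_ge_zero[of fresnel_limit] by linarith
  ultimately show ?thesis using that by blast
qed

section \<open>Plane waves on spherical caps\<close>

text \<open>Up to the azimuthal factor, the integral of a plane wave over the cap of colatitudes in
  \<open>[\<theta>, \<pi>]\<close> of the unit sphere in dimension \<open>p + 2\<close>; \<open>l\<close> is radius times wave number.\<close>

definition cap_wave :: "nat \<Rightarrow> real \<Rightarrow> real \<Rightarrow> complex" where
  "cap_wave p l \<theta> = integral {\<theta>..pi} (\<lambda>t. of_real (sin t ^ p) * cis (- (l * cos t)))"

text \<open>The stationary-phase coefficient of a pole: the pole \<open>\<theta> = 0\<close>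
  contributes \<open>cap_coeff p * cis (- l)\<close> to l^((p + 1) / 2) times the wave over the
  whole half circle, the opposite pole the conjugate. Both cases are values of 2^((p - 1) / 2)
  Gamma((p + 1) / 2) e^(i pi (p + 1) / 4).\<close>

definition cap_coeff :: "nat \<Rightarrow> complex" where
  "cap_coeff p = (if p = 0 then of_real (sqrt (pi / 2)) * cis (pi / 4) else \<i>)"

section \<open>Cap waves: an exact formula for p = 1, reduction to Fresnel integrals for p =
  0\<close>

lemma has_vector_derivative_cap_wave:
  assumes "\<theta> \<in> {0..pi}"
  shows "(cap_wave p l has_vector_derivative - (of_real (sin \<theta> ^ p) * cis (- (l * cos \<theta>)))) (at \<theta> within {0..pi})"
  unfolding cap_wave_def [abs_def] using assms
  by (intro integral_has_vector_derivative' continuous_intros) auto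

lemma cap_wave_pi [simp]: "cap_wave p l pi = 0"
  by (simp add: cap_wave_def)

lemma continuous_on_cap_wave: "continuous_on {0..pi} (cap_wave p l)"
  using has_vector_derivative_cap_wave by (rule continuous_on_vector_derivative)

text \<open>For p = 1 the weight sin t is, up to the factor l, the derivative of the phase, so -i
  e^(-i l cos t) is an antiderivative of l times the integrand. The formula is exact; the rim of the
  cap contributes an oscillation of the same size as the pole.\<close>

lemma cap_wave_1:
  assumes "\<theta> \<in> {0..pi}" "l > 0"
  shows "l * cap_wave 1 l \<theta> = \<i> * cis (- (l * cos \<theta>)) - \<i> * cis l"
proof -
  have "((\<lambda>t. l * (of_real (sin t ^ 1) * cis (- (l * cos t)))) has_integral
      (- \<i> * cis (- (l * cos pi)) - - \<i> * cis (- (l * cos \<theta>)))) {\<theta>..pi}"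
  proof (rule fundamental_theorem_of_calculus)
    fix t assume t: "t \<in> {\<theta>..pi}"
    have "((\<lambda>t. - (l * cos t)) has_real_derivative l * sin t) (at t within {\<theta>..pi})"
      by (auto intro!: derivative_eq_intros)
    note has_vector_derivative_mult_right[OF has_vector_derivative_cis[OF this], of "- \<i>"]
    moreover have "- \<i> * (\<i> * complex_of_real (l * sin t) * cis (- (l * cos t))) = l * (of_real (sin t ^ 1) * cis (- (l * cos t)))"
      by (simp add: mult.assoc)
    ultimately show "((\<lambda>t. - \<i> * cis (- (l * cos t))) has_vector_derivative l * (of_real (sin t ^ 1) * cis (- (l * cos t)))) (at t within {\<theta>..pi})"
      by (simp only:)
  qed (use assms in auto)
  from integral_unique[OF this] show ?thesis by (simp add: cap_wave_def)
qed

text \<open>A piece of \<open>cap_wave 0\<close> adjacent to a pole, with the phase factor of the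
  pole divided out: the phase l (1 - cos t) vanishes at the stationary point t = 0.\<close>

definition half_wave :: "real \<Rightarrow> real \<Rightarrow> complex" where
  "half_wave l a = integral {0..a} (\<lambda>t. cis (l * (1 - cos t)))"

lemma half_wave_0 [simp]: "half_wave l 0 = 0"
  by (simp add: half_wave_def)

text \<open>The variable s = sqrt(2 l) sin(t / 2) satisfies s^2 = l (1 - cos t) and ds = sqrt(l / 2)
  cos(t / 2) dt, so the integral is one of e^(i s^2) with the amplitude 1 / cos(t / 2). Integrating
  by parts moves the derivative to this amplitude and leaves \<open>fresnel\<close> itself, which is
  bounded and convergent, under the integral. The range a <= pi / 2 keeps cos(t / 2) away from
  0.\<close>

lemma half_wave_eq:
  assumes a: "a \<in> {0..pi/2}" and l: "l > 0"
  shows "sqrt (l / 2) * half_wave l a = of_real (inverse (cos (a / 2))) * fresnel (sqrt (2 * l) * sin (a / 2))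
     - integral {0..a} (\<lambda>t. of_real (sin (t / 2) / (2 * (cos (t / 2))\<^sup>2)) * fresnel (sqrt (2 * l) * sin (t / 2)))"
proof -
  have cos_pos: "cos (t / 2) > 0" if "t \<in> {0..a}" for t using that a pi_gt_zero by (intro cos_gt_zero_pi) (auto simp del: pi_gt_zero)
  have sin_nn: "sin (t / 2) \<ge> 0" if "t \<in> {0..a}" for t using that a by (intro sin_ge_zero) auto
  let ?s = "\<lambda>t. sqrt (2 * l) * sin (t / 2)"
  let ?w = "\<lambda>t. sin (t / 2) / (2 * (cos (t / 2))\<^sup>2)"
  have s_range: "?s t \<in> {0..sqrt (2 * l)}" if "t \<in> {0..a}" for t
    using sin_nn[OF that] l by (auto intro: mult_left_le)
  have dF: "((\<lambda>t. fresnel (?s t)) has_vector_derivative (sqrt (2 * l) * cos (t / 2) / 2) *\<^sub>R cis (l * (1 - cos t))) (at t within {0..a})"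
    if t: "t \<in> {0..a}" for t
  proof -
    have "(fresnel \<circ> ?s has_vector_derivative (sqrt (2 * l) * cos (t / 2) / 2) *\<^sub>R cis ((?s t)\<^sup>2)) (at t within {0..a})"
    proof (rule vector_diff_chain_within)
      show "(?s has_vector_derivative (sqrt (2 * l) * cos (t / 2) / 2)) (at t within {0..a})"
        by (auto intro!: derivative_eq_intros simp flip: has_real_derivative_iff_has_vector_derivative)
      have "(fresnel has_vector_derivative cis ((?s t)\<^sup>2)) (at (?s t) within {0..sqrt (2 * l)})"
        by (rule has_vector_derivative_fresnel[OF s_range[OF t]])
      thus "(fresnel has_vector_derivative cis ((?s t)\<^sup>2)) (at (?s t) within ?s ` {0..a})"
        by (rule has_vector_derivative_within_subset) (use s_range in blast)
    qed
    moreover have "(?s t)\<^sup>2 = l * (1 - cos t)"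
      using cos_double_sin[of "t / 2"] l by (simp add: power_mult_distrib)
    ultimately show ?thesis by (simp only: o_def)
  qed
  have dN: "((\<lambda>t. inverse (cos (t / 2))) has_vector_derivative ?w t) (at t within {0..a})" if t: "t \<in> {0..a}" for t
    using cos_pos[OF t]
    by (auto intro!: derivative_eq_intros simp: field_simps power2_eq_square simp flip: has_real_derivative_iff_has_vector_derivative)
  have cont_F: "continuous_on {0..a} (\<lambda>t. fresnel (?s t))"
    using dF by (rule continuous_on_vector_derivative)
  have int: "(\<lambda>t. of_real (?w t) * fresnel (?s t)) integrable_on {0..a}"
    using cos_pos[THEN less_imp_neq] by (intro integrable_continuous_real continuous_intros cont_F ballI) auto
  have "((\<lambda>t. sqrt (l / 2) * cis (l * (1 - cos t)) + of_real (?w t) * fresnel (?s t)) has_integral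
     (inverse (cos (a / 2)) *\<^sub>R fresnel (?s a) - inverse (cos (0 / 2)) *\<^sub>R fresnel (?s 0))) {0..a}"
  proof (rule fundamental_theorem_of_calculus)
    fix t assume t: "t \<in> {0..a}"
    have "inverse (cos (t / 2)) *\<^sub>R ((sqrt (2 * l) * cos (t / 2) / 2) *\<^sub>R cis (l * (1 - cos t))) = sqrt (l / 2) * cis (l * (1 - cos t))"
    proof -
      have "inverse (cos (t / 2)) * (sqrt (2 * l) * cos (t / 2) / 2) = sqrt (l / 2)"
        using cos_pos[OF t] by (simp add: real_sqrt_mult real_sqrt_divide field_simps)
      thus ?thesis by (simp only: scaleR_scaleR) (simp only: scaleR_conv_of_real)
    qed
    moreover have "?w t *\<^sub>R fresnel (?s t) = of_real (?w t) * fresnel (?s t)"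
      by (simp only: scaleR_conv_of_real)
    moreover have "((\<lambda>t. inverse (cos (t / 2)) *\<^sub>R fresnel (?s t)) has_vector_derivative
       (inverse (cos (t / 2)) *\<^sub>R ((sqrt (2 * l) * cos (t / 2) / 2) *\<^sub>R cis (l * (1 - cos t))) + ?w t *\<^sub>R fresnel (?s t))) (at t within {0..a})"
      by (rule has_vector_derivative_scaleR[OF _ dF[OF t]])
        (use dN[OF t] in \<open>simp add: has_real_derivative_iff_has_vector_derivative\<close>)
    ultimately show "((\<lambda>t. inverse (cos (t / 2)) *\<^sub>R fresnel (?s t)) has_vector_derivative
       (sqrt (l / 2) * cis (l * (1 - cos t)) + of_real (?w t) * fresnel (?s t))) (at t within {0..a})"
      by (simp only:)
  qed (use a in auto)
  from has_integral_diff[OF this integrable_integral[OF int]]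
  have "((\<lambda>t. sqrt (l / 2) * cis (l * (1 - cos t))) has_integral
     (inverse (cos (a / 2)) *\<^sub>R fresnel (?s a) - integral {0..a} (\<lambda>t. of_real (?w t) * fresnel (?s t)))) {0..a}"
    by simp
  hence "integral {0..a} (\<lambda>t. sqrt (l / 2) * cis (l * (1 - cos t))) =
     (inverse (cos (a / 2)) *\<^sub>R fresnel (?s a) - integral {0..a} (\<lambda>t. of_real (?w t) * fresnel (?s t)))"
    by (rule integral_unique)
  thus ?thesis
    by (simp only: half_wave_def integral_mult_right scaleR_conv_of_real)
qed

text \<open>Boundedness of \<open>fresnel\<close> and cos(t / 2) >= 1/2 for t <= pi / 2 bound both
  terms of the formula for the half wave. Uniformity in \<open>a\<close> as well as in l is what
  dominated convergence in the colatitude requires.\<close>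

lemma half_wave_bounded:
  obtains M where "M > 0" "\<And>l a. l > 0 \<Longrightarrow> a \<in> {0..pi/2} \<Longrightarrow> norm (sqrt l * half_wave l a) \<le> M"
proof -
  obtain M where M: "M > 0" "\<And>T. T \<ge> 0 \<Longrightarrow> norm (fresnel T) \<le> M" using fresnel_bounded by blast
  have "norm (sqrt l * half_wave l a) \<le> sqrt 2 * (2 * M + 2 * pi * M)" if l: "l > 0" and a: "a \<in> {0..pi/2}" for l a
  proof -
    have cos_ge: "cos (t / 2) \<ge> 1/2" if "t \<in> {0..a}" for t
    proof -
      have "cos (pi / 3) \<le> cos (t / 2)" using that a by (intro cos_monotone_0_pi_le) auto
      thus ?thesis by (simp add: cos_60)
    qed
    have cos_nz: "cos (t / 2) \<noteq> 0" if "t \<in> {0..a}" for t using cos_ge[OF that] by auto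
  have sin_nn: "sin (t / 2) \<ge> 0" if "t \<in> {0..a}" for t using that a by (intro sin_ge_zero) auto
    have inv: "inverse (cos (t / 2)) \<le> 2" "inverse (cos (t / 2)) \<ge> 0" if "t \<in> {0..a}" for t
      using cos_ge[OF that] by (auto simp: field_simps)
    have contF: "continuous_on {0..a} (\<lambda>t. fresnel (sqrt (2 * l) * sin (t / 2)))"
    proof (rule continuous_on_compose2[of "{0..sqrt (2*l)}" fresnel])
      show "continuous_on {0..sqrt (2 * l)} fresnel"
        using has_vector_derivative_fresnel by (rule continuous_on_vector_derivative)
      show "(\<lambda>t. sqrt (2 * l) * sin (t / 2)) ` {0..a} \<subseteq> {0..sqrt (2*l)}"
        using sin_nn l by (auto intro: mult_left_le)
    qed (intro continuous_intros, simp)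
    have 1: "norm (of_real (inverse (cos (a / 2))) * fresnel (sqrt (2 * l) * sin (a / 2))) \<le> 2 * M"
      unfolding norm_mult using inv[of a] sin_nn[of a] a l M by (intro mult_mono) (auto simp: norm_inverse)
    have "norm (integral {0..a} (\<lambda>t. of_real (sin (t / 2) / (2 * (cos (t / 2))\<^sup>2)) * fresnel (sqrt (2 * l) * sin (t / 2)))) \<le> (2 * M) * (a - 0)"
    proof (rule integral_bound)
      show "continuous_on {0..a} (\<lambda>t. of_real (sin (t / 2) / (2 * (cos (t / 2))\<^sup>2)) * fresnel (sqrt (2 * l) * sin (t / 2)))"
        using cos_nz by (intro continuous_intros contF ballI) auto
      fix t assume t: "t \<in> {0..a}"
      have "sin (t / 2) / (2 * (cos (t / 2))\<^sup>2) \<le> 1 / (2 * (1/2)\<^sup>2)"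
        using cos_ge[OF t] by (intro frac_le mult_left_mono power_mono) auto
      moreover have "sin (t / 2) / (2 * (cos (t / 2))\<^sup>2) \<ge> 0" using sin_nn[OF t] by simp
      ultimately have "\<bar>sin (t / 2) / (2 * (cos (t / 2))\<^sup>2)\<bar> \<le> 2" by (simp add: power2_eq_square)
      thus "norm (of_real (sin (t / 2) / (2 * (cos (t / 2))\<^sup>2)) * fresnel (sqrt (2 * l) * sin (t / 2))) \<le> 2 * M"
        unfolding norm_mult norm_of_real using M sin_nn[OF t] l by (intro mult_mono) auto
    qed (use a in auto)
    also have "\<dots> \<le> 2 * pi * M" using a M(1) by (simp add: mult_right_mono)
    finally have 2: "norm (integral {0..a} (\<lambda>t. of_real (sin (t / 2) / (2 * (cos (t / 2))\<^sup>2)) * fresnel (sqrt (2 * l) * sin (t / 2)))) \<le> 2 * pi * M" .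
    have "norm (sqrt (l / 2) * half_wave l a) \<le> 2 * M + 2 * pi * M"
      unfolding half_wave_eq[OF a l] using 1 2 by (intro norm_triangle_le_diff add_mono)
    moreover have "sqrt l = sqrt 2 * sqrt (l / 2)" using l by (simp add: real_sqrt_divide)
    hence "norm (sqrt l * half_wave l a) = sqrt 2 * norm (sqrt (l / 2) * half_wave l a)"
      by (simp only: of_real_mult norm_mult) simp
    ultimately show ?thesis by simp
  qed
  moreover have "sqrt 2 * (2 * M + 2 * pi * M) > 0" using M(1) by (intro mult_pos_pos add_pos_pos) auto
  ultimately show ?thesis using that by blast
qed

text \<open>Only the stationary point counts, so the limit is the same for all a > 0. In the formula
  for the half wave every \<open>fresnel\<close> with t > 0 tends to its limit L, and the weight is
  the derivative of 1 / cos(t / 2): the terms 1 / cos(a / 2) cancel and L remains. The factor sqrt 2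
  turns L into \<open>cap_coeff 0\<close>.\<close>

lemma tendsto_half_wave:
  assumes a: "a \<in> {0<..pi/2}"
  shows "((\<lambda>l. sqrt l * half_wave l a) \<longlongrightarrow> cap_coeff 0) at_top"
proof -
  obtain M where M: "M > 0" "\<And>T. T \<ge> 0 \<Longrightarrow> norm (fresnel T) \<le> M" using fresnel_bounded by blast
  have cos_ge: "cos (t / 2) \<ge> 1/2" if "t \<in> {0..a}" for t
  proof -
    have "cos (pi / 3) \<le> cos (t / 2)" using that a by (intro cos_monotone_0_pi_le) auto
    thus ?thesis by (simp add: cos_60)
  qed
  have cos_nz: "cos (t / 2) \<noteq> 0" if "t \<in> {0..a}" for t using cos_ge[OF that] by auto
  have sin_nn: "sin (t / 2) \<ge> 0" if "t \<in> {0..a}" for t using that a by (intro sin_ge_zero) auto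
  have lim: "((\<lambda>l. fresnel (sqrt (2 * l) * sin (t / 2))) \<longlongrightarrow> fresnel_limit) at_top" if t: "t \<in> {0<..a}" for t
  proof -
    have "sin (t / 2) > 0" using t a by (intro sin_gt_zero) auto
    moreover have "filterlim (\<lambda>l. sqrt (2 * l)) at_top at_top"
      by (rule filterlim_compose[OF sqrt_at_top])
        (rule filterlim_tendsto_pos_mult_at_top[OF tendsto_const _ filterlim_ident], simp)
    ultimately have "filterlim (\<lambda>l. sqrt (2 * l) * sin (t / 2)) at_top at_top"
      using filterlim_at_top_mult_tendsto_pos[OF tendsto_const] by blast
    thus ?thesis by (rule filterlim_compose[OF tendsto_fresnel])
  qed
  let ?w = "\<lambda>t. sin (t / 2) / (2 * (cos (t / 2))\<^sup>2)"
  have "((\<lambda>l. integral {0..a} (\<lambda>t. of_real (?w t) * fresnel (sqrt (2 * l) * sin (t / 2)))) \<longlongrightarrow>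
      integral {0..a} (\<lambda>t. of_real (?w t) * fresnel_limit)) at_top"
  proof (rule tendsto_integral_Icc_dominated[where M = "2 * M"])
    fix l :: real assume l: "l > 0"
    have contF: "continuous_on {0..a} (\<lambda>t. fresnel (sqrt (2 * l) * sin (t / 2)))"
    proof (rule continuous_on_compose2[of "{0..sqrt (2*l)}" fresnel])
      show "continuous_on {0..sqrt (2 * l)} fresnel"
        using has_vector_derivative_fresnel by (rule continuous_on_vector_derivative)
      show "(\<lambda>t. sqrt (2 * l) * sin (t / 2)) ` {0..a} \<subseteq> {0..sqrt (2*l)}"
        using sin_nn l by (auto intro: mult_left_le)
    qed (intro continuous_intros, simp)
    show "continuous_on {0..a} (\<lambda>t. of_real (?w t) * fresnel (sqrt (2 * l) * sin (t / 2)))"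
      using cos_nz by (intro continuous_intros contF ballI) auto
    fix t assume "t \<in> {0<..<a}"
    hence t: "t \<in> {0..a}" by auto
    have "?w t \<le> 1 / (2 * (1/2)\<^sup>2)"
      using cos_ge[OF t] by (intro frac_le mult_left_mono power_mono) auto
    moreover have "?w t \<ge> 0" using sin_nn[OF t] by simp
    ultimately have "\<bar>?w t\<bar> \<le> 2" by (simp add: power2_eq_square)
    thus "norm (of_real (?w t) * fresnel (sqrt (2 * l) * sin (t / 2))) \<le> 2 * M"
      unfolding norm_mult norm_of_real using M sin_nn[OF t] l by (intro mult_mono) auto
  next
    show "continuous_on {0..a} (\<lambda>t. of_real (?w t) * fresnel_limit)"
      using cos_nz by (intro continuous_intros ballI) auto
  next
    fix t assume "t \<in> {0<..<a}"
    thus "((\<lambda>l. of_real (?w t) * fresnel (sqrt (2 * l) * sin (t / 2))) \<longlongrightarrow> of_real (?w t) * fresnel_limit) at_top"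
      by (intro tendsto_mult tendsto_const lim) auto
  qed
  also have "integral {0..a} (\<lambda>t. of_real (?w t) * fresnel_limit) = (of_real (inverse (cos (a / 2))) - 1) * fresnel_limit"
  proof -
    have "(?w has_integral (inverse (cos (a / 2)) - inverse (cos (0 / 2)))) {0..a}"
    proof (rule fundamental_theorem_of_calculus)
      fix t assume t: "t \<in> {0..a}"
      show "((\<lambda>t. inverse (cos (t / 2))) has_vector_derivative ?w t) (at t within {0..a})"
        using cos_ge[OF t] by (auto intro!: derivative_eq_intros
            simp: field_simps power2_eq_square simp flip: has_real_derivative_iff_has_vector_derivative)
    qed (use a in auto)
    from has_integral_mult_left[OF has_integral_linear[OF this bounded_linear_of_real], of fresnel_limit]
    show ?thesis by (intro integral_unique) (simp add: o_def)
  qed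
  finally have "((\<lambda>l. of_real (inverse (cos (a / 2))) * fresnel (sqrt (2 * l) * sin (a / 2)) -
      integral {0..a} (\<lambda>t. of_real (?w t) * fresnel (sqrt (2 * l) * sin (t / 2)))) \<longlongrightarrow>
      of_real (inverse (cos (a / 2))) * fresnel_limit - (of_real (inverse (cos (a / 2))) - 1) * fresnel_limit) at_top"
    using lim[of a] a by (intro tendsto_diff tendsto_mult tendsto_const) auto
  also have "of_real (inverse (cos (a / 2))) * fresnel_limit - (of_real (inverse (cos (a / 2))) - 1) * fresnel_limit = fresnel_limit"
    by (simp add: algebra_simps)
  finally have *: "((\<lambda>l. of_real (inverse (cos (a / 2))) * fresnel (sqrt (2 * l) * sin (a / 2)) -
      integral {0..a} (\<lambda>t. of_real (?w t) * fresnel (sqrt (2 * l) * sin (t / 2)))) \<longlongrightarrow> fresnel_limit) at_top" .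
  have "((\<lambda>l. sqrt (l / 2) * half_wave l a) \<longlongrightarrow> fresnel_limit) at_top"
    by (rule Lim_transform_eventually[OF * eventually_mono[OF eventually_gt_at_top[of 0]]])
      (rule half_wave_eq[symmetric], use a in auto)
  hence "((\<lambda>l. of_real (sqrt 2) * (sqrt (l / 2) * half_wave l a)) \<longlongrightarrow> of_real (sqrt 2) * fresnel_limit) at_top"
    by (intro tendsto_intros)
  also have "(\<lambda>l. of_real (sqrt 2) * (sqrt (l / 2) * half_wave l a)) = (\<lambda>l. sqrt l * half_wave l a)"
    by (simp add: real_sqrt_divide fun_eq_iff)
  also have "of_real (sqrt 2) * fresnel_limit = cap_coeff 0"
  proof -
    have "sqrt 2 * (sqrt pi / 2) = sqrt (pi / 2)"
      by (simp add: real_sqrt_divide field_simps)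
    thus ?thesis by (simp only: fresnel_limit_def cap_coeff_def if_True simp_thms mult.assoc [symmetric] of_real_mult [symmetric])
  qed
  finally show ?thesis .
qed

text \<open>Cutting at the equator leaves one stationary point in each part. On the far side the
  shift by pi changes the sign of the cosine, that is, it conjugates the wave, so the part around
  the opposite pole is the conjugate of a half wave.\<close>

lemma cap_wave_0_minus:
  assumes "0 \<le> \<theta>" "\<theta> \<le> pi / 2"
  shows "cap_wave 0 l \<theta> = cis (- l) * (half_wave l (pi / 2) - half_wave l \<theta>) + cnj (cis (- l) * half_wave l (pi / 2))"
proof -
  have ii: "(\<lambda>t. cis (- (l * cos t))) integrable_on {u..v}" for u v
    by (intro integrable_continuous_real continuous_intros)
  have eq: "cis (- (l * cos t)) = cis (- l) * cis (l * (1 - cos t))" for t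
    by (simp add: cis_mult algebra_simps)
  have hw: "integral {0..a} (\<lambda>t. cis (- (l * cos t))) = cis (- l) * half_wave l a" for a
    unfolding eq half_wave_def by (rule integral_mult_right)
  have "cap_wave 0 l \<theta> = integral {\<theta>..pi/2} (\<lambda>t. cis (- (l * cos t))) + integral {pi/2..pi} (\<lambda>t. cis (- (l * cos t)))"
    using Henstock_Kurzweil_Integration.integral_combine[OF assms(2) _ ii, of pi] by (simp add: cap_wave_def)
  also have "integral {\<theta>..pi/2} (\<lambda>t. cis (- (l * cos t))) = cis (- l) * (half_wave l (pi / 2) - half_wave l \<theta>)"
    using Henstock_Kurzweil_Integration.integral_combine[OF assms ii] by (simp add: hw algebra_simps)
  also have "integral {pi/2..pi} (\<lambda>t. cis (- (l * cos t))) = integral {- pi..- (pi/2)} (\<lambda>t. cis (- (l * cos (- t))))"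
    by (subst Henstock_Kurzweil_Integration.integral_reflect_real[symmetric]) simp
  also have "\<dots> = integral {0..pi/2} ((\<lambda>t. cis (- (l * cos t))) \<circ> (+) (- pi))"
    using integral_shift_Icc_real[of 0 "pi/2" "\<lambda>t. cis (- (l * cos t))" "- pi"] by simp
  also have "\<dots> = integral {0..pi/2} (\<lambda>t. cnj (cis (- (l * cos t))))"
    by (simp add: o_def cis_cnj)
  also have "\<dots> = cnj (cis (- l) * half_wave l (pi / 2))"
    unfolding hw [symmetric] by (rule integral_cnj [symmetric])
  finally show ?thesis .
qed

text \<open>A cap that starts beyond the equator sees the pole \<open>pi\<close> alone, so a single
  conjugated half wave remains.\<close>

lemma cap_wave_0_plus:
  assumes "pi / 2 \<le> \<theta>" "\<theta> \<le> pi"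
  shows "cap_wave 0 l \<theta> = cnj (cis (- l) * half_wave l (pi - \<theta>))"
proof -
  have eq: "cis (- (l * cos t)) = cis (- l) * cis (l * (1 - cos t))" for t
    by (simp add: cis_mult algebra_simps)
  have hw: "integral {0..a} (\<lambda>t. cis (- (l * cos t))) = cis (- l) * half_wave l a" for a
    unfolding eq half_wave_def by (rule integral_mult_right)
  have "cap_wave 0 l \<theta> = integral {- pi..- \<theta>} (\<lambda>t. cis (- (l * cos (- t))))"
    unfolding cap_wave_def by (subst Henstock_Kurzweil_Integration.integral_reflect_real[symmetric]) simp
  also have "\<dots> = integral {0..pi - \<theta>} ((\<lambda>t. cis (- (l * cos t))) \<circ> (+) (- pi))"
    using integral_shift_Icc_real[of 0 "pi - \<theta>" "\<lambda>t. cis (- (l * cos t))" "- pi"] by simp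
  also have "\<dots> = integral {0..pi - \<theta>} (\<lambda>t. cnj (cis (- (l * cos t))))"
    by (simp add: o_def cis_cnj)
  also have "\<dots> = cnj (cis (- l) * half_wave l (pi - \<theta>))"
    unfolding hw [symmetric] by (rule integral_cnj [symmetric])
  finally show ?thesis .
qed

text \<open>The power of l is the exact decay rate, and the bound is uniform in the colatitude; it
  will dominate the integrals over \<theta>, over z and over the azimuth. For p = 0 at most three
  half waves occur, for p = 1 two terms of modulus 1.\<close>

lemma cap_wave_bounded:
  assumes "p \<in> {0, 1}"
  obtains C where "C > 0" "\<And>l \<theta>. l > 0 \<Longrightarrow> \<theta> \<in> {0..pi} \<Longrightarrow> norm (of_real (l powr ((real p + 1) / 2)) * cap_wave p l \<theta>) \<le> C"
proof (cases "p = 0")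
  case True
  obtain M where M: "M > 0" "\<And>l a. l > 0 \<Longrightarrow> a \<in> {0..pi/2} \<Longrightarrow> norm (sqrt l * half_wave l a) \<le> M"
    using half_wave_bounded by blast
  have "norm (of_real (l powr ((real p + 1) / 2)) * cap_wave p l \<theta>) \<le> 3 * M" if l: "l > 0" and th: "\<theta> \<in> {0..pi}" for l \<theta>
  proof -
    have "of_real (l powr ((real p + 1) / 2)) = complex_of_real (sqrt l)"
      using True l by (simp add: powr_half_sqrt)
    moreover have "norm (sqrt l * cap_wave 0 l \<theta>) \<le> 3 * M"
    proof (cases "\<theta> \<le> pi / 2")
      case le: True
      have "sqrt l * cap_wave 0 l \<theta> = cis (- l) * (sqrt l * half_wave l (pi / 2)) - cis (- l) * (sqrt l * half_wave l \<theta>)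
          + cnj (cis (- l) * (sqrt l * half_wave l (pi / 2)))"
        using th le by (subst cap_wave_0_minus) (auto simp: algebra_simps)
      also have "norm \<dots> \<le> M + M + M"
        using M(2)[OF l, of "pi/2"] M(2)[OF l, of \<theta>] th le
        by (intro norm_triangle_mono norm_triangle_le_diff[OF add_mono]) (auto simp only: norm_mult norm_cis complex_mod_cnj mult_1 atLeastAtMost_iff, auto)
      finally show ?thesis by simp
    next
      case False
      have "sqrt l * cap_wave 0 l \<theta> = cnj (cis (- l) * (sqrt l * half_wave l (pi - \<theta>)))"
        using th False by (subst cap_wave_0_plus) (auto simp: algebra_simps)
      also have "norm \<dots> = norm (sqrt l * half_wave l (pi - \<theta>))" by (simp only: norm_mult norm_cis complex_mod_cnj mult_1)
      also have "\<dots> \<le> M" using th False by (intro M(2)[OF l]) auto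
      finally show ?thesis using M(1) by linarith
    qed
    ultimately show ?thesis using True by simp
  qed
  thus ?thesis using that[of "3 * M"] M(1) by simp
next
  case False
  with assms have p: "p = 1" by simp
  have "norm (of_real (l powr ((real p + 1) / 2)) * cap_wave p l \<theta>) \<le> 2" if l: "l > 0" and th: "\<theta> \<in> {0..pi}" for l \<theta>
    using l cap_wave_1[OF th l] norm_triangle_ineq4[of "\<i> * cis (- (l * cos \<theta>))" "\<i> * cis l"]
    by (simp add: p norm_mult)
  thus ?thesis using that[of 2] by simp
qed

lemma tendsto_cis_mult_zero:
  assumes "(h \<longlongrightarrow> 0) F"
  shows "((\<lambda>l. cis (f l) * h l) \<longlongrightarrow> 0) F"
  by (rule tendsto_norm_zero_cancel) (simp only: norm_mult norm_cis mult_1 tendsto_norm_zero[OF assms])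

text \<open>At \<open>\<theta> = 0\<close> both poles belong to the cap, so both coefficients
  appear. The main term oscillates in l and has no limit, hence the statement about a difference.
  For p = 1 the difference is 0 for every l > 0.\<close>

lemma tendsto_cap_wave_pole:
  assumes "p \<in> {0, 1}"
  shows "((\<lambda>l. of_real (l powr ((real p + 1) / 2)) * cap_wave p l 0 - (cap_coeff p * cis (- l) + cnj (cap_coeff p) * cis l)) \<longlongrightarrow> 0) at_top"
proof (cases "p = 0")
  case True
  let ?h = "\<lambda>l. sqrt l * half_wave l (pi/2) - cap_coeff 0"
  have h: "(?h \<longlongrightarrow> 0) at_top" by (rule LIM_zero[OF tendsto_half_wave]) auto
  have "((\<lambda>l. cis (- l) * ?h l + cnj (cis (- l) * ?h l)) \<longlongrightarrow> 0) at_top"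
  proof -
    have "((\<lambda>l. cis (- l) * ?h l) \<longlongrightarrow> 0) at_top"
      by (rule tendsto_cis_mult_zero[OF h])
    from tendsto_add[OF this tendsto_cnj[OF this]] show ?thesis by simp
  qed
  thus ?thesis
  proof (rule Lim_transform_eventually[OF _ eventually_mono[OF eventually_gt_at_top[of 0]]])
    fix l :: real assume "l > 0"
    thus "cis (- l) * ?h l + cnj (cis (- l) * ?h l) = of_real (l powr ((real p + 1) / 2)) * cap_wave p l 0 - (cap_coeff p * cis (- l) + cnj (cap_coeff p) * cis l)"
      using True cap_wave_0_minus[of 0 l] by (simp add: powr_half_sqrt algebra_simps cis_cnj)
  qed
next
  case False
  with assms have p: "p = 1" by simp
  show ?thesis
    by (rule Lim_transform_eventually[OF tendsto_const eventually_mono[OF eventually_gt_at_top[of 0]]])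
      (use cap_wave_1[of 0] in \<open>auto simp: p cap_coeff_def\<close>)
qed

text \<open>For 0 < \<theta> < pi only the pole \<open>pi\<close> lies inside the cap. For p = 0 the
  convergence is pointwise in \<theta> and dominated. For p = 1 it is not pointwise: the rim leaves
  the term i e^(-i l cos \<theta>) of modulus 1, which disappears only after integration against
  \<open>g\<close>, by the Riemann-Lebesgue lemma with the phase -cos \<theta>. This is why the
  statement is about integrals.\<close>

lemma tendsto_integral_cap_wave:
  assumes "p \<in> {0, 1}" and g: "continuous_on {0..pi} g"
  shows "((\<lambda>l. integral {0..pi} (\<lambda>\<theta>. g \<theta> * (of_real (l powr ((real p + 1) / 2)) * cap_wave p l \<theta> - cnj (cap_coeff p) * cis l))) \<longlongrightarrow> 0) at_top"
proof (cases "p = 0")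
  case True
  obtain C where C: "C > 0" "\<And>l \<theta>. l > 0 \<Longrightarrow> \<theta> \<in> {0..pi} \<Longrightarrow> norm (of_real (l powr ((real p + 1) / 2)) * cap_wave p l \<theta>) \<le> C"
    using cap_wave_bounded[OF assms(1)] by blast
  obtain G where G: "\<And>x. x \<in> {0..pi} \<Longrightarrow> norm (g x) \<le> G"
    using compact_imp_bounded[OF compact_continuous_image[OF g compact_Icc]]
    unfolding bounded_iff by (metis imageI)
  have G0: "G \<ge> 0" using order_trans[OF norm_ge_zero G[of 0]] by auto
  have "((\<lambda>l. integral {0..pi} (\<lambda>\<theta>. g \<theta> * (of_real (l powr ((real p + 1) / 2)) * cap_wave p l \<theta> - cnj (cap_coeff p) * cis l))) \<longlongrightarrow>
     integral {0..pi} (\<lambda>\<theta>. 0)) at_top"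
  proof (rule tendsto_integral_Icc_dominated[where M = "G * (C + norm (cap_coeff p))"])
    show "continuous_on {0..pi} (\<lambda>\<theta>. g \<theta> * (of_real (l powr ((real p + 1) / 2)) * cap_wave p l \<theta> - cnj (cap_coeff p) * cis l))" for l
      by (intro continuous_intros g continuous_on_cap_wave)
    show "norm (g \<theta> * (of_real (l powr ((real p + 1) / 2)) * cap_wave p l \<theta> - cnj (cap_coeff p) * cis l)) \<le> G * (C + norm (cap_coeff p))"
      if "l > 0" "\<theta> \<in> {0<..<pi}" for l \<theta>
    proof -
      have "norm (of_real (l powr ((real p + 1) / 2)) * cap_wave p l \<theta> - cnj (cap_coeff p) * cis l) \<le> C + norm (cap_coeff p)"
        by (rule norm_triangle_le_diff[OF add_mono]) (use C(2)[of l \<theta>] that in \<open>auto simp: norm_mult\<close>)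
      thus ?thesis unfolding norm_mult using G[of \<theta>] that G0 by (intro mult_mono) (auto simp: norm_mult)
    qed
    show "((\<lambda>l. g \<theta> * (of_real (l powr ((real p + 1) / 2)) * cap_wave p l \<theta> - cnj (cap_coeff p) * cis l)) \<longlongrightarrow> 0) at_top"
      if th: "\<theta> \<in> {0<..<pi}" for \<theta>
    proof -
      have "((\<lambda>l. of_real (l powr ((real p + 1) / 2)) * cap_wave p l \<theta> - cnj (cap_coeff p) * cis l) \<longlongrightarrow> 0) at_top"
      proof (cases "\<theta> \<le> pi / 2")
        case le: True
        let ?h = "\<lambda>a l. sqrt l * half_wave l a - cap_coeff 0"
        have h: "(?h a \<longlongrightarrow> 0) at_top" if "a \<in> {0<..pi/2}" for a
          by (rule LIM_zero[OF tendsto_half_wave[OF that]])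
        have c: "((\<lambda>l. cis (- l) * ?h a l) \<longlongrightarrow> 0) at_top" if "a \<in> {0<..pi/2}" for a
          by (rule tendsto_cis_mult_zero[OF h[OF that]])
        have "((\<lambda>l. cis (- l) * ?h (pi/2) l - cis (- l) * ?h \<theta> l + cnj (cis (- l) * ?h (pi/2) l)) \<longlongrightarrow> 0 - 0 + cnj 0) at_top"
          using th le by (intro tendsto_intros c) auto
        hence "((\<lambda>l. cis (- l) * ?h (pi/2) l - cis (- l) * ?h \<theta> l + cnj (cis (- l) * ?h (pi/2) l)) \<longlongrightarrow> 0) at_top" by simp
        thus ?thesis
        proof (rule Lim_transform_eventually[OF _ eventually_mono[OF eventually_gt_at_top[of 0]]])
          fix l :: real assume "l > 0"
          thus "cis (- l) * ?h (pi/2) l - cis (- l) * ?h \<theta> l + cnj (cis (- l) * ?h (pi/2) l) = of_real (l powr ((real p + 1) / 2)) * cap_wave p l \<theta> - cnj (cap_coeff p) * cis l"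
            using True th le by (simp add: cap_wave_0_minus powr_half_sqrt algebra_simps cis_cnj)
        qed
      next
        case False
        have h: "((\<lambda>l. sqrt l * half_wave l (pi - \<theta>) - cap_coeff 0) \<longlongrightarrow> 0) at_top"
          by (rule LIM_zero[OF tendsto_half_wave]) (use th False in auto)
        have "((\<lambda>l. cnj (cis (- l) * (sqrt l * half_wave l (pi - \<theta>) - cap_coeff 0))) \<longlongrightarrow> 0) at_top"
          using tendsto_cnj[OF tendsto_cis_mult_zero[OF h]] by simp
        thus ?thesis
        proof (rule Lim_transform_eventually[OF _ eventually_mono[OF eventually_gt_at_top[of 0]]])
          fix l :: real assume "l > 0"
          thus "cnj (cis (- l) * (sqrt l * half_wave l (pi - \<theta>) - cap_coeff 0)) = of_real (l powr ((real p + 1) / 2)) * cap_wave p l \<theta> - cnj (cap_coeff p) * cis l"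
            using True th False cap_wave_0_plus[of \<theta> l] by (simp add: powr_half_sqrt algebra_simps cis_cnj)
        qed
      qed
      from tendsto_mult[OF tendsto_const this] show ?thesis by simp
    qed
  qed auto
  thus ?thesis by simp
next
  case False
  with assms have p: "p = 1" by simp
  have "((\<lambda>l. integral {0..pi} (\<lambda>\<theta>. \<i> * g \<theta> * cis (l * - cos \<theta>))) \<longlongrightarrow> 0) at_top"
  proof (rule oscillatory_integral_tendsto_0[where \<phi>' = sin and \<phi>'' = cos])
    show "sin x \<noteq> 0" if "x \<in> {0<..<pi}" for x using sin_gt_zero[of x] that by auto
  qed (auto intro!: derivative_eq_intros continuous_intros g)
  thus ?thesis
  proof (rule Lim_transform_eventually[OF _ eventually_mono[OF eventually_gt_at_top[of 0]]])
    fix l :: real assume l: "l > 0"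
    show "integral {0..pi} (\<lambda>\<theta>. \<i> * g \<theta> * cis (l * - cos \<theta>)) = integral {0..pi} (\<lambda>\<theta>. g \<theta> * (of_real (l powr ((real p + 1) / 2)) * cap_wave p l \<theta> - cnj (cap_coeff p) * cis l))"
    proof (rule Henstock_Kurzweil_Integration.integral_cong)
      fix \<theta> assume th: "\<theta> \<in> {0..pi}"
      show "\<i> * g \<theta> * cis (l * - cos \<theta>) = g \<theta> * (of_real (l powr ((real p + 1) / 2)) * cap_wave p l \<theta> - cnj (cap_coeff p) * cis l)"
        using cap_wave_1[OF th l] l by (simp add: p cap_coeff_def)
    qed
  qed
qed

section \<open>One-dimensional Fourier transforms\<close>

text \<open>The transform of a compactly supported weight has \<open>L\<^sup>1\<close> norm bounded independently of \<open>L\<close>;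
  this replaces Plancherel's theorem below.\<close>

lemma fourier_parabola_bound:
  fixes L x :: real
  assumes L: "L > 0"
  shows "norm (integral {-L..L} (\<lambda>z. of_real (1 - z\<^sup>2 / L\<^sup>2) * cis (z * x))) \<le> 10 * L / (1 + (L * x)\<^sup>2)"
    (is "norm ?I \<le> _")
\<comment> \<open>The threshold 4 and the constant 10 belong together: below it the trivial bound 2
  L is enough since 2 (1 + 4) = 10, above it 8 (1 + y) <= 10 y holds for y = (L x)^2 >= 4.\<close>
proof (cases "(L * x)\<^sup>2 \<le> 4")
  case True
  have "norm ?I \<le> 1 * (L - (-L))"
  proof (rule integral_bound)
    fix z assume "z \<in> {-L..L}"
    hence "\<bar>z\<bar>\<^sup>2 \<le> L\<^sup>2" by (intro power_mono) auto
    hence "z\<^sup>2 / L\<^sup>2 \<le> 1" using L by simp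
    moreover have "0 \<le> z\<^sup>2 / L\<^sup>2" by simp
    ultimately have "\<bar>1 - z\<^sup>2 / L\<^sup>2\<bar> \<le> 1" by linarith
    thus "norm (of_real (1 - z\<^sup>2 / L\<^sup>2) * cis (z * x)) \<le> 1" by (simp only: norm_mult norm_of_real norm_cis mult_1_right)
  qed (use L in \<open>auto intro!: continuous_intros\<close>)
  also have "\<dots> \<le> 10 * L / (1 + (L * x)\<^sup>2)"
  proof -
    have "1 * (L - (-L)) * (1 + (L * x)\<^sup>2) \<le> 2 * L * 5"
      using True L by (simp del: mult_1)
    moreover have "1 + (L * x)\<^sup>2 > 0" by (smt (verit) zero_le_power2)
    ultimately show ?thesis by (simp add: pos_le_divide_eq)
  qed
  finally show ?thesis .
next
  case False
  have big: "L * \<bar>x\<bar> > 2"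
  proof (rule ccontr)
    assume "\<not> ?thesis"
    hence "(L * \<bar>x\<bar>)\<^sup>2 \<le> 2\<^sup>2" using L by (intro power_mono) auto
    thus False using False by (simp add: power_mult_distrib)
  qed
  hence x: "x \<noteq> 0" using L by auto
  define w where "w z = complex_of_real (1 - z\<^sup>2 / L\<^sup>2)" for z
  \<comment> \<open>Since the weight is quadratic, repeated integration by parts stops after three
    terms and gives an exact antiderivative. The weight vanishes at both ends, so the term of order
    1 / x drops out and the boundary values decay like 1 / (L x^2), which is integrable in
    x.\<close>
  define G where "G z = cis (z * x) * (w z / (\<i> * x) - of_real (- 2 * z / L\<^sup>2) / (\<i> * x)\<^sup>2 + of_real (- 2 / L\<^sup>2) / (\<i> * x) ^ 3)" for z
  have "((\<lambda>z. w z * cis (z * x)) has_integral (G L - G (- L))) {-L..L}"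
  proof (rule fundamental_theorem_of_calculus)
    fix z assume "z \<in> {-L..L}"
    have 1: "((\<lambda>z. z * x) has_real_derivative x) (at z within {-L..L})" by (auto intro!: derivative_eq_intros)
    have 2: "((\<lambda>z. w z / (\<i> * x) - of_real (- 2 * z / L\<^sup>2) / (\<i> * x)\<^sup>2 + of_real (- 2 / L\<^sup>2) / (\<i> * x) ^ 3) has_vector_derivative
        (of_real (- 2 * z / L\<^sup>2) / (\<i> * x) - of_real (- 2 / L\<^sup>2) / (\<i> * x)\<^sup>2 + 0)) (at z within {-L..L})"
    proof -
      have "((\<lambda>z. 1 - z\<^sup>2 / L\<^sup>2) has_real_derivative - 2 * z / L\<^sup>2) (at z within {-L..L})"
        by (rule derivative_eq_intros refl | use L in \<open>simp add: power2_eq_square\<close>)+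
      hence "(w has_vector_derivative of_real (- 2 * z / L\<^sup>2)) (at z within {-L..L})"
        unfolding w_def by (intro has_vector_derivative_of_real) (simp only: has_real_derivative_iff_has_vector_derivative)
      moreover have "((\<lambda>z. - 2 * z / L\<^sup>2) has_real_derivative - 2 / L\<^sup>2) (at z within {-L..L})"
        by (rule derivative_eq_intros refl | use L in \<open>simp add: power2_eq_square\<close>)+
      hence "((\<lambda>z. complex_of_real (- 2 * z / L\<^sup>2)) has_vector_derivative of_real (- 2 / L\<^sup>2)) (at z within {-L..L})"
        by (intro has_vector_derivative_of_real) (simp only: has_real_derivative_iff_has_vector_derivative)
      ultimately show ?thesis
        by (intro has_vector_derivative_add has_vector_derivative_diff has_vector_derivative_divide has_vector_derivative_const)
    qed
    have "cis (z * x) * (of_real (- 2 * z / L\<^sup>2) / (\<i> * x) - of_real (- 2 / L\<^sup>2) / (\<i> * x)\<^sup>2 + 0)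
       + \<i> * of_real x * cis (z * x) * (w z / (\<i> * x) - of_real (- 2 * z / L\<^sup>2) / (\<i> * x)\<^sup>2 + of_real (- 2 / L\<^sup>2) / (\<i> * x) ^ 3) = w z * cis (z * x)"
    proof -
      have "c * (a1 / y - a2 / y\<^sup>2 + 0) + y * c * (a0 / y - a1 / y\<^sup>2 + a2 / y ^ 3) = a0 * c" if "y \<noteq> 0" for a0 a1 a2 c y :: complex
        using that by (simp add: field_simps power2_eq_square power3_eq_cube)
      thus ?thesis by this (use x in simp)
    qed
    with has_vector_derivative_mult[OF has_vector_derivative_cis[OF 1] 2]
    show "(G has_vector_derivative w z * cis (z * x)) (at z within {-L..L})"
      unfolding G_def [abs_def] by (simp only:)
  qed (use L in auto)
  hence I: "?I = G L - G (- L)" by (simp add: w_def integral_unique)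
  have nG: "norm (G s) \<le> 4 / (L * x\<^sup>2)" if s: "s = L \<or> s = - L" for s
  proof -
    have w0: "w s = 0" using s L by (auto simp: w_def)
    have "norm (G s) = norm (w s / (\<i> * x) - of_real (- 2 * s / L\<^sup>2) / (\<i> * x)\<^sup>2 + of_real (- 2 / L\<^sup>2) / (\<i> * x) ^ 3)"
      by (simp add: G_def norm_mult)
    also have "\<dots> \<le> norm (of_real (- 2 * s / L\<^sup>2) / (\<i> * x)\<^sup>2) + norm (of_real (- 2 / L\<^sup>2) / (\<i> * x) ^ 3)"
      proof -
      have "norm (0 / c - a + b) \<le> norm a + norm b" for a b c :: complex
        using norm_triangle_ineq4[of b a] by (simp add: add.commute)
      thus ?thesis unfolding w0 .
    qed
    also have "norm (of_real (- 2 * s / L\<^sup>2) / (\<i> * x)\<^sup>2) = 2 / (L * x\<^sup>2)"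
      using s L by (auto simp: norm_divide norm_mult norm_power power2_eq_square abs_mult)
    also have "norm (of_real (- 2 / L\<^sup>2) / (\<i> * x) ^ 3) = 2 / (L\<^sup>2 * \<bar>x\<bar> ^ 3)"
      by (simp add: norm_divide norm_mult norm_power)
    also have "2 / (L\<^sup>2 * \<bar>x\<bar> ^ 3) \<le> 2 / (L * x\<^sup>2)"
    proof (rule divide_left_mono)
      have "L * x\<^sup>2 * 1 \<le> L * x\<^sup>2 * (L * \<bar>x\<bar>)" using big L by (intro mult_left_mono) auto
      also have "\<dots> = L\<^sup>2 * \<bar>x\<bar> ^ 3" by (simp add: power2_eq_square power3_eq_cube abs_mult_self_eq[of x, symmetric] mult_ac del: abs_mult_self_eq)
      finally show "L * x\<^sup>2 \<le> L\<^sup>2 * \<bar>x\<bar> ^ 3" by simp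
    qed (use L x in auto)
    finally show ?thesis by simp
  qed
  have "norm ?I \<le> norm (G L) + norm (G (- L))" unfolding I by (rule norm_triangle_ineq4)
  also have "\<dots> \<le> 8 / (L * x\<^sup>2)" using nG[of L] nG[of "-L"] by simp
  also have "\<dots> \<le> 10 * L / (1 + (L * x)\<^sup>2)"
  proof -
    have "8 * (1 + (L * x)\<^sup>2) \<le> 10 * (L * x)\<^sup>2" using False by simp
    also have "\<dots> = 10 * L * (L * x\<^sup>2)" by (simp add: power2_eq_square)
    finally have "8 * (1 + (L * x)\<^sup>2) \<le> 10 * L * (L * x\<^sup>2)" .
    moreover have "1 + (L * x)\<^sup>2 > 0" by (smt (verit) zero_le_power2)
    moreover have "L * x\<^sup>2 > 0" using L x by simp
    ultimately show ?thesis by (simp only: pos_divide_le_eq times_divide_eq_left pos_le_divide_eq)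
  qed
  finally show ?thesis .
qed

text \<open>With the parabola w as weight, Fubini turns the integral of w |v|^2 into a double
  integral of V(x), the conjugate of V(y) and K(x - y), where K is the transform of w. As K has L^1
  norm at most 10 pi for every L, the result is at most 10 pi M^2 times the length 2 N. Dividing by
  3/4, a lower bound for w on [-Z, Z], gives less than 30 pi N M^2, independently of Z.\<close>

lemma fourier_square_bound:
  fixes V :: "real \<Rightarrow> complex"
  assumes N: "N > 0" and cont: "continuous_on UNIV V" and M: "\<And>x. norm (V x) \<le> M" and Z: "Z > 0"
  shows "integral {-Z..Z} (\<lambda>z. (norm (integral {-N..N} (\<lambda>x. V x * cis (z * x))))\<^sup>2) \<le> 30 * pi * N * M\<^sup>2"
proof -
  \<comment> \<open>Twice \<open>Z\<close>, so that the weight is at least 1 - 1/4 on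
    [-Z, Z].\<close>
  define L where "L = 2 * Z"
  have L: "L > 0" using Z by (simp add: L_def)
  define v where "v z = integral {-N..N} (\<lambda>x. V x * cis (z * x))" for z
  have cV: "continuous_on A (\<lambda>y. V (f y))" if "continuous_on A f" for A and f :: "'b::topological_space \<Rightarrow> real"
    by (rule continuous_on_compose2[OF cont that]) auto
  have "continuous_on UNIV v"
    unfolding v_def cbox_interval [symmetric]
    by (intro integral_continuous_on_param) (auto simp: case_prod_unfold intro!: continuous_intros cV)
  hence cv: "continuous_on A (\<lambda>y. v (f y))" if "continuous_on A f" for A and f :: "'b::topological_space \<Rightarrow> real"
    using that by (rule continuous_on_compose2) auto
  define w where "w z = 1 - z\<^sup>2 / L\<^sup>2" for z
  define K where "K x = integral {-L..L} (\<lambda>z. of_real (w z) * cis (z * x))" for x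
  have cw: "continuous_on A (\<lambda>y. w (f y))" if "continuous_on A f" for A and f :: "'b::topological_space \<Rightarrow> real"
    unfolding w_def using that by (intro continuous_intros) (use L in auto)
  have M0: "M \<ge> 0" using order_trans[OF norm_ge_zero M] .
  have K_bound: "norm (K x) \<le> 10 * L / (1 + (L * x)\<^sup>2)" for x
    using fourier_parabola_bound[OF L] by (simp add: K_def w_def)
  \<comment> \<open>The majorant 10 L / (1 + (L (x - y))^2) of \<open>K (x - y)\<close> is the
    derivative of 10 arctan(L (y - x)) in y, so its integral is at most 10 pi whatever L is.\<close>
  have inner: "norm (integral {-N..N} (\<lambda>y. cnj (V y) * K (x - y))) \<le> M * (10 * pi)" for x
  proof -
    have pos: "1 + (L * (x - y))\<^sup>2 > 0" for y by (smt (verit) zero_le_power2)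
    have cK: "continuous_on UNIV K"
      unfolding K_def cbox_interval [symmetric]
      by (intro integral_continuous_on_param) (auto simp: case_prod_unfold intro!: continuous_intros cw)
    have "norm (integral {-N..N} (\<lambda>y. cnj (V y) * K (x - y))) \<le> integral {-N..N} (\<lambda>y. M * (10 * L / (1 + (L * (x - y))\<^sup>2)))"
    proof (rule integral_norm_bound_integral)
      show "(\<lambda>y. cnj (V y) * K (x - y)) integrable_on {-N..N}"
        by (intro integrable_continuous_real continuous_intros cV continuous_on_compose2[OF cK]) auto
      show "(\<lambda>y. M * (10 * L / (1 + (L * (x - y))\<^sup>2))) integrable_on {-N..N}"
        using pos by (intro integrable_continuous_real continuous_intros) (metis less_irrefl)
      show "norm (cnj (V y) * K (x - y)) \<le> M * (10 * L / (1 + (L * (x - y))\<^sup>2))" for y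
        unfolding norm_mult using M M0 K_bound by (intro mult_mono) auto
    qed
    also have "\<dots> = M * (10 * (arctan (L * (N - x)) - arctan (L * (- N - x))))"
    proof -
      have "((\<lambda>y. M * (10 * L / (1 + (L * (x - y))\<^sup>2))) has_integral
         (M * (10 * arctan (L * (N - x))) - M * (10 * arctan (L * (- N - x))))) {-N..N}"
      proof (rule fundamental_theorem_of_calculus)
        fix y
        have "((\<lambda>y. M * (10 * arctan (L * (y - x)))) has_real_derivative M * (10 * L / (1 + (L * (y - x))\<^sup>2))) (at y within {-N..N})"
          using pos[of y] by (auto intro!: derivative_eq_intros simp: field_simps)
        also have "(L * (y - x))\<^sup>2 = (L * (x - y))\<^sup>2" by (simp add: power_mult_distrib power2_commute)
        finally show "((\<lambda>y. M * (10 * arctan (L * (y - x)))) has_vector_derivative M * (10 * L / (1 + (L * (x - y))\<^sup>2))) (at y within {-N..N})"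
          by (simp only: has_real_derivative_iff_has_vector_derivative)
      qed (use N in auto)
      thus ?thesis by (simp add: integral_unique right_diff_distrib)
    qed
    also have "\<dots> \<le> M * (10 * pi)"
    proof (intro mult_left_mono M0)
      show "arctan (L * (N - x)) - arctan (L * (- N - x)) \<le> pi"
        using arctan_ubound[of "L * (N - x)"] arctan_lbound[of "L * (- N - x)"] by linarith
    qed auto
    finally show ?thesis .
  qed
  have "integral {-L..L} (\<lambda>z. of_real (w z) * (v z * cnj (v z))) = integral {-N..N} (\<lambda>x. V x * integral {-N..N} (\<lambda>y. cnj (V y) * K (x - y)))"
  proof -
    have "integral {-L..L} (\<lambda>z. of_real (w z) * (v z * cnj (v z))) =
       integral {-L..L} (\<lambda>z. integral {-N..N} (\<lambda>x. of_real (w z) * cnj (v z) * (V x * cis (z * x))))"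
    proof -
      have "integral {-N..N} (\<lambda>x. of_real (w z) * cnj (v z) * (V x * cis (z * x))) = of_real (w z) * (v z * cnj (v z))" for z
        by (simp only: integral_mult_right flip: v_def) (simp only: mult_ac)
      thus ?thesis by (simp only:)
    qed
    also have "\<dots> = integral {-N..N} (\<lambda>x. integral {-L..L} (\<lambda>z. of_real (w z) * cnj (v z) * (V x * cis (z * x))))"
    proof -
      have "continuous_on (cbox (-L, -N) (L, N)) (\<lambda>(z, x). of_real (w z) * cnj (v z) * (V x * cis (z * x)))"
        unfolding case_prod_unfold by (intro continuous_intros cV cw cv)
      from integral_swap_continuous[OF this] show ?thesis by (simp only: cbox_interval)
    qed
    also have "\<dots> = integral {-N..N} (\<lambda>x. V x * integral {-N..N} (\<lambda>y. cnj (V y) * K (x - y)))"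
    proof (rule arg_cong[where f = "integral _"], rule ext)
      fix x
      have "integral {-L..L} (\<lambda>z. of_real (w z) * cnj (v z) * (V x * cis (z * x)))
         = V x * integral {-L..L} (\<lambda>z. of_real (w z) * cis (z * x) * cnj (v z))"
        by (simp add: mult_ac flip: integral_mult_right)
      also have "integral {-L..L} (\<lambda>z. of_real (w z) * cis (z * x) * cnj (v z))
         = integral {-L..L} (\<lambda>z. integral {-N..N} (\<lambda>y. of_real (w z) * cis (z * x) * cnj (V y * cis (z * y))))"
        by (simp only: v_def integral_cnj integral_mult_right)
      also have "\<dots> = integral {-N..N} (\<lambda>y. integral {-L..L} (\<lambda>z. of_real (w z) * cis (z * x) * cnj (V y * cis (z * y))))"
      proof -
        have "continuous_on (cbox (-L, -N) (L, N)) (\<lambda>(z, y). of_real (w z) * cis (z * x) * cnj (V y * cis (z * y)))"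
          unfolding case_prod_unfold by (intro continuous_intros cV cw)
        from integral_swap_continuous[OF this] show ?thesis by (simp only: cbox_interval)
      qed
      also have "\<dots> = integral {-N..N} (\<lambda>y. cnj (V y) * K (x - y))"
      proof (rule arg_cong[where f = "integral _"], rule ext)
        fix y
        have "of_real (w z) * cis (z * x) * cnj (V y * cis (z * y)) = cnj (V y) * (of_real (w z) * cis (z * (x - y)))" for z
        proof -
          have "cis (z * (x - y)) = cis (z * x) * cnj (cis (z * y))"
            by (simp add: cis_cnj cis_mult right_diff_distrib)
          thus ?thesis by simp
        qed
        thus "integral {-L..L} (\<lambda>z. of_real (w z) * cis (z * x) * cnj (V y * cis (z * y))) = cnj (V y) * K (x - y)"
          by (simp only: K_def integral_mult_right)
      qed
      finally show "integral {-L..L} (\<lambda>z. of_real (w z) * cnj (v z) * (V x * cis (z * x))) = V x * integral {-N..N} (\<lambda>y. cnj (V y) * K (x - y))" .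
    qed
    finally show ?thesis .
  qed
  also have "norm \<dots> \<le> (M * (M * (10 * pi))) * (N - (- N))"
  proof (rule integral_bound)
    have cK: "continuous_on UNIV K"
      unfolding K_def cbox_interval [symmetric]
      by (intro integral_continuous_on_param) (auto simp: case_prod_unfold intro!: continuous_intros cw)
    have "continuous_on {-N..N} (\<lambda>x. integral (cbox (-N) N) (\<lambda>y. cnj (V y) * K (x - y)))"
      by (intro integral_continuous_on_param)
        (auto simp: case_prod_unfold intro!: continuous_intros cV continuous_on_compose2[OF cK])
    thus "continuous_on {-N..N} (\<lambda>x. V x * integral {-N..N} (\<lambda>y. cnj (V y) * K (x - y)))"
      by (intro continuous_intros cV) auto
    show "norm (V x * integral {-N..N} (\<lambda>y. cnj (V y) * K (x - y))) \<le> M * (M * (10 * pi))" for x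
      unfolding norm_mult using inner M M0 by (intro mult_mono) auto
  qed (use N in auto)
  finally have main: "norm (integral {-L..L} (\<lambda>z. of_real (w z) * (v z * cnj (v z)))) \<le> 20 * pi * N * M\<^sup>2"
    by (simp add: power2_eq_square mult_ac)
  have eq: "of_real (w z) * (v z * cnj (v z)) = of_real (w z * (norm (v z))\<^sup>2)" for z
    by (simp only: complex_norm_square [symmetric] of_real_mult)
  have int: "(\<lambda>z. w z * (norm (v z))\<^sup>2) integrable_on {-L..L}"
    by (intro integrable_continuous_real continuous_intros cw cv)
  have "integral {-L..L} (\<lambda>z. complex_of_real (w z * (norm (v z))\<^sup>2)) = of_real (integral {-L..L} (\<lambda>z. w z * (norm (v z))\<^sup>2))"
    using integral_linear[OF int bounded_linear_of_real] by (simp only: o_def)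
  with main have "\<bar>integral {-L..L} (\<lambda>z. w z * (norm (v z))\<^sup>2)\<bar> \<le> 20 * pi * N * M\<^sup>2"
    by (simp only: eq norm_of_real)
  hence "integral {-L..L} (\<lambda>z. w z * (norm (v z))\<^sup>2) \<le> 20 * pi * N * M\<^sup>2" by linarith
  moreover have "integral {-Z..Z} (\<lambda>z. (3/4) * (norm (v z))\<^sup>2) \<le> integral {-L..L} (\<lambda>z. w z * (norm (v z))\<^sup>2)"
  proof -
    have "integral {-Z..Z} (\<lambda>z. (3/4) * (norm (v z))\<^sup>2) \<le> integral {-Z..Z} (\<lambda>z. w z * (norm (v z))\<^sup>2)"
    proof (rule integral_le)
      fix z assume z: "z \<in> {-Z..Z}"
      hence "\<bar>z\<bar>\<^sup>2 \<le> Z\<^sup>2" by (intro power_mono) auto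
      hence "z\<^sup>2 / L\<^sup>2 \<le> 1/4" using Z by (simp add: L_def field_simps power_mult_distrib)
      thus "(3/4) * (norm (v z))\<^sup>2 \<le> w z * (norm (v z))\<^sup>2" by (intro mult_right_mono) (auto simp: w_def)
    qed (intro integrable_continuous_real continuous_intros cw cv)+
    also have "\<dots> \<le> integral {-L..L} (\<lambda>z. w z * (norm (v z))\<^sup>2)"
    proof (rule integral_subset_le)
      show "\<forall>z\<in>{-L..L}. 0 \<le> w z * (norm (v z))\<^sup>2"
      proof
        fix z assume z: "z \<in> {-L..L}"
        hence "\<bar>z\<bar>\<^sup>2 \<le> L\<^sup>2" by (intro power_mono) auto
        hence "z\<^sup>2 / L\<^sup>2 \<le> 1" using L by simp
        thus "0 \<le> w z * (norm (v z))\<^sup>2" by (auto simp: w_def)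
      qed
    next
      show "(\<lambda>z. w z * (norm (v z))\<^sup>2) integrable_on {-Z..Z}"
        by (intro integrable_continuous_real continuous_intros cw cv)
    qed (use Z in \<open>auto simp: L_def intro: int[unfolded L_def]\<close>)
    finally show ?thesis .
  qed
  ultimately have "integral {-Z..Z} (\<lambda>z. (3/4) * (norm (v z))\<^sup>2) \<le> 20 * pi * N * M\<^sup>2" by linarith
  hence "(3/4) * integral {-Z..Z} (\<lambda>z. (norm (v z))\<^sup>2) \<le> 20 * pi * N * M\<^sup>2" by (simp only: integral_mult_right)
  moreover have "0 \<le> pi * N * M\<^sup>2" using N by simp
  ultimately have "integral {-Z..Z} (\<lambda>z. (norm (v z))\<^sup>2) \<le> 30 * pi * N * M\<^sup>2" by (simp add: mult.assoc)
  thus ?thesis by (simp add: v_def)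
qed

text \<open>Vanishing of \<open>V\<close> at the ends of [-N, N] makes -i z v the transform of V',
  so the square bound holds for v and for z v. Then 2 |v| <= 1 / (1 + z^2) + (1 + z^2) |v|^2, and
  the integrals of the three pieces, pi and twice 30 pi N M^2, halve to the constant stated. Bounds
  on [-Z, Z] pass to the line by monotone convergence.\<close>

lemma fourier_L1_bound:
  fixes V V' :: "real \<Rightarrow> complex"
  assumes N: "N > 0" and M: "\<And>x. norm (V x) \<le> M" "\<And>x. norm (V' x) \<le> M"
    and V: "\<And>x. (V has_vector_derivative V' x) (at x)" and V': "continuous_on UNIV V'"
    and supp: "\<And>x. x \<notin> {-N<..<N} \<Longrightarrow> V x = 0"
  shows "(\<integral>\<^sup>+z. norm (integral {-N..N} (\<lambda>x. V x * cis (z * x))) \<partial>lborel) \<le> ennreal (pi / 2 + 30 * pi * N * M\<^sup>2)"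
proof -
  have cont: "continuous_on UNIV V"
    using V continuous_on_vector_derivative[of UNIV V V'] by simp
  have cV: "continuous_on A (\<lambda>y. V (f y))" if "continuous_on A f" for A and f :: "'b::topological_space \<Rightarrow> real"
    by (rule continuous_on_compose2[OF cont that]) auto
  define v where "v z = integral {-N..N} (\<lambda>x. V x * cis (z * x))" for z
  have "continuous_on UNIV v"
    unfolding v_def cbox_interval [symmetric]
    by (intro integral_continuous_on_param) (auto simp: case_prod_unfold intro!: continuous_intros cV)
  hence cv: "continuous_on A v" for A by (rule continuous_on_subset) auto
  have parts: "integral {-N..N} (\<lambda>x. V' x * cis (z * x)) = - \<i> * z * v z" for z
  proof -
    have "((\<lambda>x. V x * cis (z * x)) has_vector_derivative (V x * (\<i> * of_real z * cis (z * x)) + V' x * cis (z * x))) (at x within {-N..N})" for x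
    proof -
      have "((\<lambda>x. z * x) has_real_derivative z) (at x within {-N..N})" by (auto intro!: derivative_eq_intros)
      from has_vector_derivative_mult[OF has_vector_derivative_at_within[OF V] has_vector_derivative_cis[OF this]]
      show ?thesis .
    qed
    from fundamental_theorem_of_calculus[OF _ this]
    have "((\<lambda>x. V x * (\<i> * of_real z * cis (z * x)) + V' x * cis (z * x)) has_integral 0) {-N..N}"
      using N supp[of N] supp[of "-N"] by simp
    moreover have "((\<lambda>x. \<i> * of_real z * (V x * cis (z * x))) has_integral (\<i> * of_real z * v z)) {-N..N}"
      unfolding v_def
      by (intro has_integral_mult_right integrable_integral integrable_continuous_real continuous_intros cV)
    ultimately have "((\<lambda>x. (V x * (\<i> * of_real z * cis (z * x)) + V' x * cis (z * x)) - \<i> * of_real z * (V x * cis (z * x))) has_integral (0 - \<i> * of_real z * v z)) {-N..N}"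
      by (rule has_integral_diff)
    also have "(\<lambda>x. (V x * (\<i> * of_real z * cis (z * x)) + V' x * cis (z * x)) - \<i> * of_real z * (V x * cis (z * x))) = (\<lambda>x. V' x * cis (z * x))"
      by (auto simp: algebra_simps)
    finally show ?thesis by (simp add: integral_unique)
  qed
  have int_bound: "integral {-Z..Z} (\<lambda>z. norm (v z)) \<le> pi / 2 + 30 * pi * N * M\<^sup>2" if Z: "Z > 0" for Z
  proof -
    have pos: "1 + z\<^sup>2 > 0" for z :: real by (smt (verit) zero_le_power2)
    have "integral {-Z..Z} (\<lambda>z. norm (v z)) \<le> integral {-Z..Z} (\<lambda>z. (1/2) * (inverse (1 + z\<^sup>2) + ((norm (v z))\<^sup>2 + (norm (- \<i> * z * v z))\<^sup>2)))"
    proof (rule integral_le)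
      fix z :: real
      \<comment> \<open>The arithmetic-geometric mean inequality for 1 / a and a |v|, as an expanded
        square.\<close>
      define a where "a = sqrt (1 + z\<^sup>2)"
      have a: "a > 0" "a\<^sup>2 = 1 + z\<^sup>2" using pos[of z] by (auto simp: a_def)
      have "0 \<le> (1 / a - a * norm (v z))\<^sup>2" by simp
      also have "\<dots> = inverse (1 + z\<^sup>2) + (1 + z\<^sup>2) * (norm (v z))\<^sup>2 - 2 * norm (v z)"
        using a(1) unfolding power2_diff power_mult_distrib power_divide a(2) by (simp add: divide_inverse)
      finally show "norm (v z) \<le> (1/2) * (inverse (1 + z\<^sup>2) + ((norm (v z))\<^sup>2 + (norm (- \<i> * z * v z))\<^sup>2))"
        by (simp add: norm_mult power_mult_distrib algebra_simps)
    next
      show "(\<lambda>z. (1/2) * (inverse (1 + z\<^sup>2) + ((norm (v z))\<^sup>2 + (norm (- \<i> * z * v z))\<^sup>2))) integrable_on {-Z..Z}"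
        using pos by (intro integrable_continuous_real continuous_intros cv) (metis less_irrefl)
    qed (intro integrable_continuous_real continuous_intros cv)
    also have "\<dots> = (1/2) * integral {-Z..Z} (\<lambda>z. inverse (1 + z\<^sup>2) + ((norm (v z))\<^sup>2 + (norm (- \<i> * z * v z))\<^sup>2))"
      by (rule integral_mult_right)
    also have "integral {-Z..Z} (\<lambda>z. inverse (1 + z\<^sup>2) + ((norm (v z))\<^sup>2 + (norm (- \<i> * z * v z))\<^sup>2)) =
        integral {-Z..Z} (\<lambda>z. inverse (1 + z\<^sup>2)) + (integral {-Z..Z} (\<lambda>z. (norm (v z))\<^sup>2) + integral {-Z..Z} (\<lambda>z. (norm (- \<i> * z * v z))\<^sup>2))"
      using pos
      by (intro trans[OF Henstock_Kurzweil_Integration.integral_add] arg_cong2[where f = "(+)"] refl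
          Henstock_Kurzweil_Integration.integral_add integrable_continuous_real continuous_intros cv) (metis less_irrefl)
    also have "integral {-Z..Z} (\<lambda>z. inverse (1 + z\<^sup>2)) \<le> pi"
    proof -
      have "((\<lambda>x. inverse (1 + x\<^sup>2)) has_integral (arctan Z - arctan (-Z))) {-Z..Z}"
        by (rule fundamental_theorem_of_calculus)
          (use Z in \<open>auto intro!: derivative_eq_intros simp flip: has_real_derivative_iff_has_vector_derivative\<close>)
      thus ?thesis using arctan_ubound[of Z] by (simp add: integral_unique arctan_minus)
    qed
    also have "integral {-Z..Z} (\<lambda>z. (norm (v z))\<^sup>2) \<le> 30 * pi * N * M\<^sup>2"
      unfolding v_def by (rule fourier_square_bound[OF N cont M(1) Z])
    also have "integral {-Z..Z} (\<lambda>z. (norm (- \<i> * z * v z))\<^sup>2) \<le> 30 * pi * N * M\<^sup>2"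
      unfolding parts [symmetric] by (rule fourier_square_bound[OF N V' M(2) Z])
    finally show ?thesis by (simp add: algebra_simps)
  qed
  have nn: "(\<integral>\<^sup>+z. ennreal (norm (v z)) * indicator {-real n..real n} z \<partial>lborel) \<le> ennreal (pi / 2 + 30 * pi * N * M\<^sup>2)" for n
  proof (cases "n = 0")
    case False
    have "((\<lambda>z. norm (v z)) has_integral integral {-real n..real n} (\<lambda>z. norm (v z))) {-real n..real n}"
      by (intro integrable_integral integrable_continuous_real continuous_intros cv)
    from nn_integral_has_integral_lebesgue[OF _ this]
    have "(\<integral>\<^sup>+z. ennreal (indicator {-real n..real n} z * norm (v z)) \<partial>lborel) = ennreal (integral {-real n..real n} (\<lambda>z. norm (v z)))"
      by simp
    also have "(\<lambda>z. ennreal (indicator {-real n..real n} z * norm (v z))) = (\<lambda>z. ennreal (norm (v z)) * indicator {-real n..real n} z)"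
      by (auto split: split_indicator)
    finally have "(\<integral>\<^sup>+z. ennreal (norm (v z)) * indicator {-real n..real n} z \<partial>lborel) = ennreal (integral {-real n..real n} (\<lambda>z. norm (v z)))" .
    thus ?thesis using int_bound[of "real n"] False by (simp add: ennreal_leI)
  next
    case True
    have "(\<integral>\<^sup>+z. ennreal (norm (v z)) * indicator {0} z \<partial>lborel) = 0"
    proof -
      have "(\<integral>\<^sup>+z. ennreal (norm (v z)) * indicator {0} z \<partial>lborel) = integral\<^sup>N lborel (\<lambda>z::real. 0)"
        by (rule nn_integral_cong_AE) (use AE_lborel_singleton[of 0] in \<open>eventually_elim; auto\<close>)
      thus ?thesis by simp
    qed
    thus ?thesis using True by simp
  qed
  have "(\<integral>\<^sup>+z. ennreal (norm (v z)) \<partial>lborel) = (\<integral>\<^sup>+z. (SUP n. ennreal (norm (v z)) * indicator {-real n..real n} z) \<partial>lborel)"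
  proof (rule nn_integral_cong)
    fix z :: real
    obtain n where n: "\<bar>z\<bar> \<le> real n" using real_arch_simple by blast
    show "ennreal (norm (v z)) = (SUP n. ennreal (norm (v z)) * indicator {-real n..real n} z)"
    proof (rule antisym)
      show "ennreal (norm (v z)) \<le> (SUP n. ennreal (norm (v z)) * indicator {-real n..real n} z)"
        by (rule SUP_upper2[of n]) (use n in \<open>auto simp: abs_le_iff indicator_def\<close>)
      show "(SUP n. ennreal (norm (v z)) * indicator {-real n..real n} z) \<le> ennreal (norm (v z))"
        by (rule SUP_least) (auto split: split_indicator)
    qed
  qed
  also have "\<dots> = (SUP n. (\<integral>\<^sup>+z. ennreal (norm (v z)) * indicator {-real n..real n} z \<partial>lborel))"
  proof (rule nn_integral_monotone_convergence_SUP)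
    show "incseq (\<lambda>n z. ennreal (norm (v z)) * indicator {-real n..real n} z)"
      by (auto simp: incseq_def le_fun_def split: split_indicator)
    show "(\<lambda>z. ennreal (norm (v z)) * indicator {-real n..real n} z) \<in> borel_measurable lborel" for n
    proof -
      have [measurable]: "v \<in> borel_measurable borel" by (rule borel_measurable_continuous_onI[OF cv])
      show ?thesis by measurable
    qed
  qed
  also have "\<dots> \<le> ennreal (pi / 2 + 30 * pi * N * M\<^sup>2)" by (rule SUP_least) (rule nn)
  finally show ?thesis by (simp add: v_def)
qed

text \<open>Dini's argument: swapping the integrals produces the Dirichlet kernel sin(R x) / x
  centred at \<open>k\<close>. Writing V(k + x) = V(k) + x g(x), the quotient g is continuous
  because V is differentiable at k, so its part is an oscillatory integral tending to 0; the
  constant V(k) meets 2 Si(R P), which tends to pi. No integrability of the transform enters, so the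
  lemma also serves dimension one.\<close>

lemma fourier_inversion_pointwise:
  fixes V :: "real \<Rightarrow> complex"
  assumes N: "N > 0" and cont: "continuous_on UNIV V" and supp: "\<And>x. x \<notin> {-N..N} \<Longrightarrow> V x = 0"
    and V': "(V has_vector_derivative V') (at k)"
  shows "((\<lambda>R. integral {-R..R} (\<lambda>z. integral {-N..N} (\<lambda>x. V x * cis (z * x)) * cis (- (z * k)))) \<longlongrightarrow> 2 * pi * V k) at_top"
proof -
  \<comment> \<open>Makes an interval symmetric about \<open>k\<close> that contains the support of
    \<open>V\<close>; symmetry lets the kernel integrate to twice the sine integral.\<close>
  define P where "P = \<bar>k\<bar> + N"
  have P: "P > 0" "{-N..N} \<subseteq> {k - P..k + P}" using N by (auto simp: P_def)
  have contS: "continuous_on S V" for S using cont continuous_on_subset by blast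
  define S where "S R x = (if x = 0 then R else sin (R * x) / x)" for R x :: real
  have S_sinc: "S R x = R * sinc (R * x)" if "R > 0" for R x using that by (auto simp: S_def)
  have contS': "continuous_on A (S R)" if "R > 0" for R A
    using continuous_on_mult_left[OF continuous_on_sinc[OF continuous_on_mult_left[OF continuous_on_id]], of A R R] S_sinc[OF that] by (simp add: ext)
  \<comment> \<open>The difference quotient at \<open>k\<close>, continued by the derivative
    \<open>V'\<close> at 0. The value at 0 is what makes it continuous on the whole
    interval.\<close>
  define g where "g x = (if x = 0 then V' else (V (k + x) - V k) / of_real x)" for x
  have g: "continuous_on A g" for A
  proof (rule continuous_at_imp_continuous_on, rule ballI)
    fix x
    show "isCont g x"
    proof (cases "x = 0")
      case True
      have "((\<lambda>h. norm (V (k + h) - V k - h *\<^sub>R V') / norm h) \<longlongrightarrow> 0) (at 0)"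
        using V' by (simp add: has_vector_derivative_def has_derivative_at)
      hence "((\<lambda>h. norm (g h - V')) \<longlongrightarrow> 0) (at 0)"
      proof (rule Lim_transform_eventually)
        have "norm (V (k + h) - V k - h *\<^sub>R V') / norm h = norm (g h - V')" if "h \<noteq> 0" for h
        proof -
          have "g h - V' = (V (k + h) - V k - h *\<^sub>R V') / of_real h"
            using that by (simp add: g_def scaleR_conv_of_real diff_divide_distrib)
          thus ?thesis by (simp add: norm_divide)
        qed
        thus "\<forall>\<^sub>F h in at 0. norm (V (k + h) - V k - h *\<^sub>R V') / norm h = norm (g h - V')"
          by (auto simp: eventually_at_filter)
      qed
      hence "((\<lambda>h. g h - V') \<longlongrightarrow> 0) (at 0)" by (rule tendsto_norm_zero_cancel)
      hence "(g \<longlongrightarrow> V') (at 0)" by (rule LIM_zero_cancel)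
      thus ?thesis using True by (simp add: isCont_def g_def)
    next
      case False
      have V0: "isCont V y" for y using cont by (simp add: continuous_on_eq_continuous_at)
      have "isCont (\<lambda>x. V (k + x)) x" by (rule isCont_o2[OF _ V0]) (intro continuous_intros)
      hence "isCont (\<lambda>x. (V (k + x) - V k) / of_real x) x" using False by (intro continuous_intros) auto
      moreover have "\<forall>\<^sub>F y in nhds x. (V (k + y) - V k) / of_real y = g y"
        by (rule eventually_mono[OF eventually_nhds_in_open[of "- {0}" x]]) (use False in \<open>auto simp: g_def\<close>)
      ultimately show ?thesis by (simp add: isCont_cong)
    qed
  qed
  have dirichlet: "integral {-R..R} (\<lambda>z. cis (z * x)) = 2 * S R x" if R: "R > 0" for R x
  proof (cases "x = 0")
    case True
    thus ?thesis using R by (simp add: S_def scaleR_conv_of_real)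
  next
    case False
    have "((\<lambda>z. cis (z * x)) has_integral (cis (R * x) / (\<i> * x) - cis (- R * x) / (\<i> * x))) {-R..R}"
    proof (rule fundamental_theorem_of_calculus)
      fix z assume "z \<in> {-R..R}"
      have "((\<lambda>z. z * x) has_real_derivative x) (at z within {-R..R})" by (auto intro!: derivative_eq_intros)
      from has_vector_derivative_mult_left[OF has_vector_derivative_cis[OF this], of "1 / (\<i> * x)"]
      show "((\<lambda>z. cis (z * x) / (\<i> * x)) has_vector_derivative cis (z * x)) (at z within {-R..R})"
        using False by simp
    qed (use R in auto)
    moreover have "cis (R * x) / (\<i> * x) - cis (- R * x) / (\<i> * x) = 2 * S R x"
      using False by (simp add: S_def complex_eq_iff Re_divide Im_divide power2_eq_square)
    ultimately show ?thesis by (simp add: integral_unique)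
  qed
  have eq: "integral {-R..R} (\<lambda>z. integral {-N..N} (\<lambda>x. V x * cis (z * x)) * cis (- (z * k)))
     = 2 * (integral {-P..P} (\<lambda>x. g x * sin (R * x)) + V k * of_real (2 * Si (R * P)))" if R: "R > 0" for R
  proof -
    have "integral {-R..R} (\<lambda>z. integral {-N..N} (\<lambda>x. V x * cis (z * x)) * cis (- (z * k)))
       = integral {-R..R} (\<lambda>z. integral {-N..N} (\<lambda>x. V x * cis (z * (x - k))))"
      by (simp flip: integral_mult_left add: mult.assoc cis_mult right_diff_distrib)
    also have "\<dots> = integral {-N..N} (\<lambda>x. integral {-R..R} (\<lambda>z. V x * cis (z * (x - k))))"
    proof -
      have "continuous_on (cbox (-R, -N) (R, N)) (\<lambda>(z, x). V x * cis (z * (x - k)))"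
        unfolding case_prod_unfold by (intro continuous_intros continuous_on_compose2[OF cont]) auto
      from integral_swap_continuous[OF this] show ?thesis by simp
    qed
    also have "\<dots> = integral {-N..N} (\<lambda>x. V x * (2 * S R (x - k)))"
      by (simp add: dirichlet[OF R])
    also have "\<dots> = integral {k - P..k + P} (\<lambda>x. V x * (2 * S R (x - k)))"
      by (rule integral_spike_set; rule empty_imp_negligible) (use P supp in auto)
    also have "\<dots> = integral {-P..P} ((\<lambda>x. V x * (2 * S R (x - k))) \<circ> (+) k)"
      using integral_shift_Icc_real[of "-P" P "\<lambda>x. V x * (2 * S R (x - k))" k] by (simp add: add.commute)
    also have "\<dots> = integral {-P..P} (\<lambda>x. 2 * (g x * sin (R * x) + V k * of_real (S R x)))"
    proof (rule arg_cong[where f = "integral _"], rule ext)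
      fix x
      show "((\<lambda>x. V x * (2 * S R (x - k))) \<circ> (+) k) x = 2 * (g x * sin (R * x) + V k * of_real (S R x))"
        by (simp add: g_def S_def field_simps)
    qed
    also have "\<dots> = 2 * integral {-P..P} (\<lambda>x. g x * sin (R * x) + V k * of_real (S R x))"
      by (rule integral_mult_right)
    also have "integral {-P..P} (\<lambda>x. g x * sin (R * x) + V k * of_real (S R x)) =
        integral {-P..P} (\<lambda>x. g x * sin (R * x)) + integral {-P..P} (\<lambda>x. V k * of_real (S R x))"
      by (intro Henstock_Kurzweil_Integration.integral_add integrable_continuous_real continuous_intros g contS'[OF R])
    also have "integral {-P..P} (\<lambda>x. V k * of_real (S R x)) = V k * of_real (2 * Si (R * P))"
    proof -
      have "(S R has_integral (Si (R * P) - Si (R * - P))) {-P..P}"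
      proof (rule fundamental_theorem_of_calculus)
        fix x
        show "((\<lambda>x. Si (R * x)) has_vector_derivative S R x) (at x within {-P..P})"
          unfolding has_real_derivative_iff_has_vector_derivative[symmetric] S_sinc[OF R]
          by (rule DERIV_chain2[OF DERIV_Si, THEN DERIV_subset, where s = UNIV, simplified mult.commute])
            (auto intro!: derivative_eq_intros)
      qed (use P in auto)
      also have "Si (R * P) - Si (R * - P) = 2 * Si (R * P)"
        using Si_neg[of "R * P"] R P by simp
      finally have "(S R has_integral 2 * Si (R * P)) {-P..P}" .
      from has_integral_mult_right[OF has_integral_linear[OF this bounded_linear_of_real], of "V k"]
      show ?thesis unfolding o_def by (rule integral_unique)
    qed
    finally show ?thesis .
  qed
  have lim_cis: "((\<lambda>R. integral {-P..P} (\<lambda>x. g x / (2 * \<i>) * cis (R * (s * x)))) \<longlongrightarrow> 0) at_top" if "s \<noteq> 0" for s :: real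
    by (rule oscillatory_integral_tendsto_0[where \<phi>' = "\<lambda>_. s" and \<phi>'' = "\<lambda>_. 0"])
      (use P that in \<open>auto intro!: derivative_eq_intros continuous_intros g\<close>)
  have "((\<lambda>R. integral {-P..P} (\<lambda>x. g x / (2 * \<i>) * cis (R * (1 * x))) - integral {-P..P} (\<lambda>x. g x / (2 * \<i>) * cis (R * (-1 * x)))) \<longlongrightarrow> 0 - 0) at_top"
    by (intro tendsto_diff lim_cis) auto
  also have "(\<lambda>R. integral {-P..P} (\<lambda>x. g x / (2 * \<i>) * cis (R * (1 * x))) - integral {-P..P} (\<lambda>x. g x / (2 * \<i>) * cis (R * (-1 * x))))
      = (\<lambda>R. integral {-P..P} (\<lambda>x. g x * sin (R * x)))"
  proof
    fix R
    have "integral {-P..P} (\<lambda>x. g x / (2 * \<i>) * cis (R * (1 * x))) - integral {-P..P} (\<lambda>x. g x / (2 * \<i>) * cis (R * (-1 * x)))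
       = integral {-P..P} (\<lambda>x. g x / (2 * \<i>) * cis (R * (1 * x)) - g x / (2 * \<i>) * cis (R * (-1 * x)))"
      by (intro Henstock_Kurzweil_Integration.integral_diff[symmetric] integrable_continuous_real continuous_intros g) auto
    also have "\<dots> = integral {-P..P} (\<lambda>x. g x * sin (R * x))"
    proof (rule arg_cong[where f = "integral _"], rule ext)
      fix x
      have h: "cis (R * (1 * x)) - cis (R * (-1 * x)) = 2 * \<i> * sin (R * x)" by (simp add: complex_eq_iff)
      have "a / b * (b * y) = a * y" if "b \<noteq> 0" for a b y :: complex using that by simp
      from this[of "2 * \<i>"] have "a / (2 * \<i>) * (2 * \<i> * y) = a * y" for a y by auto
      thus "g x / (2 * \<i>) * cis (R * (1 * x)) - g x / (2 * \<i>) * cis (R * (-1 * x)) = g x * sin (R * x)"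
        by (simp only: right_diff_distrib [symmetric] h)
    qed
    finally show "integral {-P..P} (\<lambda>x. g x / (2 * \<i>) * cis (R * (1 * x))) - integral {-P..P} (\<lambda>x. g x / (2 * \<i>) * cis (R * (-1 * x)))
       = integral {-P..P} (\<lambda>x. g x * sin (R * x))" .
  qed
  finally have l1: "((\<lambda>R. integral {-P..P} (\<lambda>x. g x * sin (R * x))) \<longlongrightarrow> 0) at_top" by simp
  have l2: "((\<lambda>R. Si (R * P)) \<longlongrightarrow> pi / 2) at_top"
    by (rule filterlim_compose[OF Si_at_top filterlim_at_top_mult_tendsto_pos[OF tendsto_const P(1) filterlim_ident]])
  have "((\<lambda>R. 2 * (integral {-P..P} (\<lambda>x. g x * sin (R * x)) + V k * of_real (2 * Si (R * P)))) \<longlongrightarrow> 2 * (0 + V k * of_real (2 * (pi / 2)))) at_top"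
    by (intro tendsto_intros l1 l2)
  hence "((\<lambda>R. 2 * (integral {-P..P} (\<lambda>x. g x * sin (R * x)) + V k * of_real (2 * Si (R * P)))) \<longlongrightarrow> 2 * pi * V k) at_top"
    by (simp add: mult_ac)
  thus ?thesis
    by (rule Lim_transform_eventually[OF _ eventually_mono[OF eventually_gt_at_top[of 0]]]) (simp add: eq)
qed

section \<open>Polar coordinates about an axis\<close>

text \<open>Both measures are translation invariant, hence proportional by uniqueness of Haar measure
  (the double integral of \<open>indicator A x * indicator B (y - x)\<close>); the unit ball \<open>B\<close> gives the constant 1.\<close>

lemma distr_lborel_linear_isometry:
  fixes f :: "'a::euclidean_space \<Rightarrow> 'b::euclidean_space"
  assumes lin: "linear f" and iso: "\<And>x. norm (f x) = norm x" and dim: "DIM('a) = DIM('b)"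
  shows "distr lborel borel f = lborel"
proof -
  define \<mu> where "\<mu> = distr lborel borel f"
  have [measurable]: "f \<in> borel_measurable borel"
    by (intro borel_measurable_continuous_onI linear_continuous_on linear_conv_bounded_linear[THEN iffD1] lin)
  have sets: "sets \<mu> = sets borel" and space: "space \<mu> = UNIV" by (simp_all add: \<mu>_def)
  have inj: "inj f"
    by (rule linear_injective_0[OF lin, THEN iffD2]) (metis iso norm_eq_zero)
  have surj: "surj f"
  proof -
    have "dim (range f) = dim (UNIV :: 'a set)"
      using inj by (intro dim_image_eq lin) (simp add: inj_on_def)
    hence "span (range f) = UNIV" using dim by (simp add: dim_eq_full)
    moreover have "subspace (range f)" using linear_subspace_image[OF lin subspace_UNIV] .
    ultimately show ?thesis by (metis span_eq_iff)
  qed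
  have ball: "emeasure \<mu> (ball 0 r) = emeasure lborel (ball (0::'b) r)" if "r \<ge> 0" for r
  proof -
    have "f -` ball 0 r = ball 0 r" by (auto simp: iso)
    thus ?thesis using that by (simp add: \<mu>_def emeasure_distr emeasure_ball dim)
  qed
  interpret \<mu>: sigma_finite_measure \<mu>
  proof
    have "(\<Union>n. ball (0::'b) (real n)) = UNIV"
      by (auto simp: reals_Archimedean2)
    moreover have "emeasure \<mu> (ball 0 (real n)) \<noteq> \<infinity>" for n
      by (simp add: ball emeasure_ball)
    ultimately show "\<exists>A. countable A \<and> A \<subseteq> sets \<mu> \<and> \<Union> A = space \<mu> \<and> (\<forall>a\<in>A. emeasure \<mu> a \<noteq> \<infinity>)"
      by (intro exI[of _ "range (\<lambda>n. ball 0 (real n))"]) (auto simp: sets space)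
  qed
  interpret P: pair_sigma_finite lborel \<mu> ..
  have shift: "(\<integral>\<^sup>+y. g (y - x) \<partial>\<mu>) = (\<integral>\<^sup>+y. g y \<partial>\<mu>)" if [measurable]: "g \<in> borel_measurable borel" for g :: "'b \<Rightarrow> ennreal" and x
  proof -
    \<comment> \<open>Surjectivity turns a translation of the target into the image of a translation
      of the source, under which \<open>lborel\<close> is invariant.\<close>
    obtain a where a: "f a = - x" using surj by (metis surjD)
    have "(\<integral>\<^sup>+y. g (y - x) \<partial>\<mu>) = (\<integral>\<^sup>+t. g (f t - x) \<partial>lborel)"
      unfolding \<mu>_def by (subst nn_integral_distr) auto
    also have "\<dots> = (\<integral>\<^sup>+t. g (f (a + t)) \<partial>lborel)"
      using linear_add[OF lin] a by (simp add: add.commute)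
    also have "\<dots> = (\<integral>\<^sup>+t. g (f t) \<partial>distr lborel borel ((+) a))"
      by (subst nn_integral_distr) auto
    also have "\<dots> = (\<integral>\<^sup>+y. g y \<partial>\<mu>)"
      unfolding lborel_distr_plus \<mu>_def by (subst nn_integral_distr) auto
    finally show ?thesis .
  qed
  have flip: "(\<integral>\<^sup>+x. g x \<partial>lborel) = (\<integral>\<^sup>+x. g (y - x) \<partial>lborel)" if [measurable]: "g \<in> borel_measurable borel" for g :: "'b \<Rightarrow> ennreal" and y
    by (subst lborel_affine[of "-1" y]) (auto simp: nn_integral_density nn_integral_distr)
  have "\<mu> = lborel"
  proof (rule measure_eqI)
    fix A assume "A \<in> sets \<mu>"
    hence [measurable]: "A \<in> sets borel" by (simp add: sets)
    define B where "B = ball (0::'b) 1"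
    have [measurable]: "B \<in> sets borel" by (simp add: B_def)
    have [measurable_cong]: "sets \<mu> = sets borel" by (rule sets)
    have "emeasure lborel A * emeasure \<mu> B = (\<integral>\<^sup>+x. indicator A x * emeasure \<mu> B \<partial>lborel)"
      by (simp add: nn_integral_multc)
    also have "\<dots> = (\<integral>\<^sup>+x. (\<integral>\<^sup>+y. indicator A x * indicator B (y - x) \<partial>\<mu>) \<partial>lborel)"
      by (simp add: nn_integral_cmult shift[of "indicator B"])
    also have "\<dots> = (\<integral>\<^sup>+y. (\<integral>\<^sup>+x. indicator A x * indicator B (y - x) \<partial>lborel) \<partial>\<mu>)"
      by (rule P.Fubini'[symmetric]) measurable
    also have "\<dots> = (\<integral>\<^sup>+y. (\<integral>\<^sup>+x. indicator A (y - x) * indicator B x \<partial>lborel) \<partial>\<mu>)"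
    proof (rule nn_integral_cong)
      fix y
      show "(\<integral>\<^sup>+x. indicator A x * indicator B (y - x) \<partial>lborel) = (\<integral>\<^sup>+x. indicator A (y - x) * indicator B x \<partial>lborel)"
        by (subst flip[of _ y]) auto
    qed
    also have "\<dots> = (\<integral>\<^sup>+x. (\<integral>\<^sup>+y. indicator A (y - x) * indicator B x \<partial>\<mu>) \<partial>lborel)"
      by (rule P.Fubini') measurable
    also have "\<dots> = (\<integral>\<^sup>+x. emeasure \<mu> A * indicator B x \<partial>lborel)"
      by (simp add: nn_integral_multc shift[of "indicator A"])
    also have "\<dots> = emeasure \<mu> A * emeasure lborel B"
      by (simp add: nn_integral_cmult)
    finally have "emeasure lborel A * emeasure lborel B = emeasure \<mu> A * emeasure lborel B"
      by (simp add: B_def ball)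
    moreover have "emeasure lborel B \<noteq> 0" "emeasure lborel B \<noteq> \<infinity>"
    proof -
      have "unit_ball_vol (real DIM('b)) > 0" by simp
      hence "unit_ball_vol (real DIM('b)) \<noteq> 0" by (rule less_imp_neq[symmetric])
      thus "emeasure lborel B \<noteq> 0" "emeasure lborel B \<noteq> \<infinity>"
        by (simp_all add: B_def emeasure_ball)
    qed
    ultimately show "emeasure \<mu> A = emeasure lborel A"
      by (auto simp: mult.commute[of _ "emeasure lborel B"] ennreal_mult_cancel_left)
  qed (simp add: sets)
  thus ?thesis by (simp add: \<mu>_def)
qed

text \<open>Stated as an equality of measures: \<open>lborel\<close> is the image under
  \<open>tan\<close> of the density 1 / cos^2 on (-pi/2, pi/2). On an interval this is the
  fundamental theorem of calculus between two values of \<open>arctan\<close>, and intervals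
  determine \<open>lborel\<close>. Arbitrary measurable nonnegative \<open>g\<close> are then
  covered at once.\<close>

lemma nn_integral_tan_substitution:
  fixes g :: "real \<Rightarrow> ennreal"
  assumes [measurable]: "g \<in> borel_measurable borel"
  shows "(\<integral>\<^sup>+s. g s \<partial>lborel) = (\<integral>\<^sup>+t. indicator {-pi/2<..<pi/2} t * (ennreal (1 / (cos t)\<^sup>2) * g (tan t)) \<partial>lborel)"
proof -
  define M where "M = distr (density lborel (\<lambda>t. indicator {-pi/2<..<pi/2} t * ennreal (1 / (cos t)\<^sup>2))) borel tan"
  have [measurable]: "tan \<in> borel_measurable (borel :: real measure)"
    unfolding tan_def[abs_def] by measurable
  have "lborel = M"
  proof (rule lborel_eqI)
    fix l u :: real assume lu: "\<And>b. b \<in> Basis \<Longrightarrow> l \<bullet> b \<le> u \<bullet> b"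
    hence lu: "l \<le> u" by simp
    have range: "- pi / 2 < arctan x" "arctan x < pi / 2" for x using arctan_bounded[of x] by auto
    have pre: "{-pi/2<..<pi/2} \<inter> tan -` {l<..<u} = {arctan l<..<arctan u}"
    proof (rule set_eqI, rule iffI)
      fix t assume "t \<in> {-pi/2<..<pi/2} \<inter> tan -` {l<..<u}"
      hence t: "t \<in> {-pi/2<..<pi/2}" "tan t \<in> {l<..<u}" by auto
      hence "arctan l < arctan (tan t)" "arctan (tan t) < arctan u" by (auto simp: arctan_less_iff)
      moreover have "arctan (tan t) = t" using t by (intro arctan_tan) auto
      ultimately show "t \<in> {arctan l<..<arctan u}" by simp
    next
      fix t assume t: "t \<in> {arctan l<..<arctan u}"
      with range[of l] range[of u] have t2: "t \<in> {-pi/2<..<pi/2}" by auto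
      have "arctan (tan t) = t" using t2 by (intro arctan_tan) auto
      hence "tan t \<in> {l<..<u}" using t by (metis arctan_less_iff greaterThanLessThan_iff)
      with t2 show "t \<in> {-pi/2<..<pi/2} \<inter> tan -` {l<..<u}" by simp
    qed
    have "emeasure M (box l u) = (\<integral>\<^sup>+t. ennreal (1 / (cos t)\<^sup>2) * indicator ({-pi/2<..<pi/2} \<inter> tan -` {l<..<u}) t \<partial>lborel)"
    proof -
      have [measurable]: "tan -` {l<..<u} \<in> sets borel"
        using measurable_sets[of tan borel borel "{l<..<u}"] by simp
      show ?thesis
        unfolding M_def by (subst emeasure_distr)
          (auto simp: emeasure_density box_real mult_ac intro!: nn_integral_cong split: split_indicator)
    qed
    also have "\<dots> = (\<integral>\<^sup>+t. ennreal (1 / (cos t)\<^sup>2) * indicator {arctan l..arctan u} t \<partial>lborel)"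
      unfolding pre by (rule nn_integral_cong_AE)
        (use AE_lborel_singleton[of "arctan l"] AE_lborel_singleton[of "arctan u"] in \<open>eventually_elim; auto split: split_indicator\<close>)
    also have "\<dots> = ennreal (tan (arctan u) - tan (arctan l))"
    proof (rule nn_integral_FTC_Icc)
      fix t assume "t \<in> {arctan l..arctan u}"
      hence t: "arctan l \<le> t" "t \<le> arctan u" by auto
      have "cos t > 0" using t range[of l] range[of u] by (intro cos_gt_zero_pi) auto
      thus "(tan has_real_derivative 1 / (cos t)\<^sup>2) (at t)"
        using DERIV_tan[of t] by (simp add: divide_inverse)
    qed (use lu in \<open>auto simp: arctan_le_iff\<close>)
    finally show "emeasure M (box l u) = ennreal (\<Prod>b\<in>Basis. (u - l) \<bullet> b)"
      by (simp add: tan_arctan)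
  qed (simp add: M_def)
  hence "(\<integral>\<^sup>+s. g s \<partial>lborel) = (\<integral>\<^sup>+s. g s \<partial>M)" by simp
  also have "\<dots> = (\<integral>\<^sup>+t. indicator {-pi/2<..<pi/2} t * (ennreal (1 / (cos t)\<^sup>2) * g (tan t)) \<partial>lborel)"
    unfolding M_def by (subst nn_integral_distr; (subst nn_integral_density)?) (auto simp: mult.assoc)
  finally show ?thesis .
qed

text \<open>The substitution \<open>a = b s\<close>, \<open>s = tan t\<close>, \<open>t = \<pi>/2 - \<theta>\<close>, \<open>b = r sin \<theta>\<close> avoids a two-dimensional change of variables.\<close>

lemma nn_integral_half_plane_polar:
  fixes f :: "real \<Rightarrow> real \<Rightarrow> ennreal"
  assumes f [measurable]: "(\<lambda>(a, b). f a b) \<in> borel_measurable (borel \<Otimes>\<^sub>M borel)"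
  shows "(\<integral>\<^sup>+a. (\<integral>\<^sup>+b. indicator {0<..} b * f a b \<partial>lborel) \<partial>lborel) =
    (\<integral>\<^sup>+\<theta>. indicator {0<..<pi} \<theta> * (\<integral>\<^sup>+r. indicator {0<..} r * (ennreal r * f (r * cos \<theta>) (r * sin \<theta>)) \<partial>lborel) \<partial>lborel)"
proof -
  have m [measurable]: "(\<lambda>x. f (g x) (h x)) \<in> borel_measurable M" if [measurable]: "g \<in> borel_measurable M" "h \<in> borel_measurable M"
    for g h :: "'c \<Rightarrow> real" and M :: "'c measure"
    using measurable_compose[OF _ f, of "\<lambda>x. (g x, h x)" M] by simp
  have [measurable]: "tan \<in> borel_measurable (borel :: real measure)"
    unfolding tan_def[abs_def] by measurable
  have "(\<integral>\<^sup>+a. (\<integral>\<^sup>+b. indicator {0<..} b * f a b \<partial>lborel) \<partial>lborel) =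
      (\<integral>\<^sup>+b. (\<integral>\<^sup>+a. indicator {0<..} b * f a b \<partial>lborel) \<partial>lborel)"
    by (rule lborel_pair.Fubini') measurable
  also have "\<dots> = (\<integral>\<^sup>+b. (\<integral>\<^sup>+s. indicator {0<..} b * (ennreal b * f (b * s) b) \<partial>lborel) \<partial>lborel)"
  proof (rule nn_integral_cong)
    fix b :: real
    show "(\<integral>\<^sup>+a. indicator {0<..} b * f a b \<partial>lborel) = (\<integral>\<^sup>+s. indicator {0<..} b * (ennreal b * f (b * s) b) \<partial>lborel)"
    proof (cases "b > 0")
      case True
      have "(\<integral>\<^sup>+a. f a b \<partial>lborel) = ennreal \<bar>b\<bar> * (\<integral>\<^sup>+s. f (0 + b * s) b \<partial>lborel)"
        using True by (intro nn_integral_real_affine) auto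
      thus ?thesis using True by (simp add: nn_integral_cmult)
    qed simp
  qed
  also have "\<dots> = (\<integral>\<^sup>+s. (\<integral>\<^sup>+b. indicator {0<..} b * (ennreal b * f (b * s) b) \<partial>lborel) \<partial>lborel)"
    by (rule lborel_pair.Fubini') measurable
  also have "\<dots> = (\<integral>\<^sup>+t. indicator {-pi/2<..<pi/2} t * (ennreal (1 / (cos t)\<^sup>2) * (\<integral>\<^sup>+b. indicator {0<..} b * (ennreal b * f (b * tan t) b) \<partial>lborel)) \<partial>lborel)"
    by (rule nn_integral_tan_substitution) measurable
  also have "\<dots> = (\<integral>\<^sup>+t. indicator {-pi/2<..<pi/2} t * (\<integral>\<^sup>+r. indicator {0<..} r * (ennreal r * f (r * sin t) (r * cos t)) \<partial>lborel) \<partial>lborel)"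
  proof (rule nn_integral_cong)
    fix t :: real
    show "indicator {-pi/2<..<pi/2} t * (ennreal (1 / (cos t)\<^sup>2) * (\<integral>\<^sup>+b. indicator {0<..} b * (ennreal b * f (b * tan t) b) \<partial>lborel)) =
       indicator {-pi/2<..<pi/2} t * (\<integral>\<^sup>+r. indicator {0<..} r * (ennreal r * f (r * sin t) (r * cos t)) \<partial>lborel)"
    proof (cases "t \<in> {-pi/2<..<pi/2}")
      case True
      hence c: "cos t > 0" by (intro cos_gt_zero_pi) auto
      have "(\<integral>\<^sup>+b. indicator {0<..} b * (ennreal b * f (b * tan t) b) \<partial>lborel) =
         ennreal \<bar>cos t\<bar> * (\<integral>\<^sup>+r. indicator {0<..} (0 + cos t * r) * (ennreal (0 + cos t * r) * f ((0 + cos t * r) * tan t) (0 + cos t * r)) \<partial>lborel)"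
        using c by (intro nn_integral_real_affine) auto
      also have "(\<integral>\<^sup>+r. indicator {0<..} (0 + cos t * r) * (ennreal (0 + cos t * r) * f ((0 + cos t * r) * tan t) (0 + cos t * r)) \<partial>lborel)
         = (\<integral>\<^sup>+r. ennreal (cos t) * (indicator {0<..} r * (ennreal r * f (r * sin t) (r * cos t))) \<partial>lborel)"
        using c by (intro nn_integral_cong) (auto simp: tan_def zero_less_mult_iff ennreal_mult mult_ac split: split_indicator)
      also have "\<dots> = ennreal (cos t) * (\<integral>\<^sup>+r. indicator {0<..} r * (ennreal r * f (r * sin t) (r * cos t)) \<partial>lborel)"
        by (rule nn_integral_cmult) measurable
      finally have "ennreal (1 / (cos t)\<^sup>2) * (\<integral>\<^sup>+b. indicator {0<..} b * (ennreal b * f (b * tan t) b) \<partial>lborel) =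
         (ennreal (1 / (cos t)\<^sup>2) * ennreal (cos t) * ennreal (cos t)) * (\<integral>\<^sup>+r. indicator {0<..} r * (ennreal r * f (r * sin t) (r * cos t)) \<partial>lborel)"
        using c by (simp add: mult.assoc)
      \<comment> \<open>The Jacobians cancel: s = tan t brings 1 / cos^2 t, while b = r cos t brings
        one cosine from the differential and one from the factor b.\<close>
      also have "ennreal (1 / (cos t)\<^sup>2) * ennreal (cos t) * ennreal (cos t) = 1"
        using c by (simp add: power2_eq_square flip: ennreal_mult)
      finally show ?thesis by simp
    qed simp
  qed
  also have "\<dots> = ennreal \<bar>-1\<bar> * (\<integral>\<^sup>+\<theta>. indicator {-pi/2<..<pi/2} (pi/2 + (-1) * \<theta>) * (\<integral>\<^sup>+r. indicator {0<..} r * (ennreal r * f (r * sin (pi/2 + (-1) * \<theta>)) (r * cos (pi/2 + (-1) * \<theta>))) \<partial>lborel) \<partial>lborel)"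
    by (rule nn_integral_real_affine[where t = "pi/2" and c = "-1"]) simp_all
  also have "\<dots> = (\<integral>\<^sup>+\<theta>. indicator {0<..<pi} \<theta> * (\<integral>\<^sup>+r. indicator {0<..} r * (ennreal r * f (r * cos \<theta>) (r * sin \<theta>)) \<partial>lborel) \<partial>lborel)"
  proof -
    have "indicator {-pi/2<..<pi/2} (pi/2 + (-1) * \<theta>) = (indicator {0<..<pi} \<theta> :: ennreal)" for \<theta>
      by (auto split: split_indicator)
    moreover have "sin (pi/2 + (-1) * \<theta>) = cos \<theta>" "cos (pi/2 + (-1) * \<theta>) = sin \<theta>" for \<theta>
      using sin_cos_eq[of "\<theta>"] cos_sin_eq[of \<theta>] by (simp_all add: minus_diff_commute)
    ultimately show ?thesis by simp
  qed
  finally show ?thesis .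
qed

text \<open>The line b = 0 is a null set and b -> -b preserves the measure. The splitting gives the
  full circle of azimuths for dimension three, and by itself the two half planes of dimension
  two.\<close>

lemma nn_integral_plane_halves:
  fixes f :: "real \<Rightarrow> real \<Rightarrow> ennreal"
  assumes f [measurable]: "(\<lambda>(a, b). f a b) \<in> borel_measurable (borel \<Otimes>\<^sub>M borel)"
  shows "(\<integral>\<^sup>+a. (\<integral>\<^sup>+b. f a b \<partial>lborel) \<partial>lborel) =
    (\<integral>\<^sup>+a. (\<integral>\<^sup>+b. indicator {0<..} b * f a b \<partial>lborel) \<partial>lborel) +
    (\<integral>\<^sup>+a. (\<integral>\<^sup>+b. indicator {0<..} b * f a (- b) \<partial>lborel) \<partial>lborel)"
proof -
  have m [measurable]: "(\<lambda>x. f (g x) (h x)) \<in> borel_measurable M" if [measurable]: "g \<in> borel_measurable M" "h \<in> borel_measurable M"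
    for g h :: "'c \<Rightarrow> real" and M :: "'c measure"
    using measurable_compose[OF _ f, of "\<lambda>x. (g x, h x)" M] by simp
  have "(\<integral>\<^sup>+b. f a b \<partial>lborel) = (\<integral>\<^sup>+b. indicator {0<..} b * f a b \<partial>lborel) + (\<integral>\<^sup>+b. indicator {0<..} b * f a (- b) \<partial>lborel)" for a
  proof -
    have "(\<integral>\<^sup>+b. f a b \<partial>lborel) = (\<integral>\<^sup>+b. (indicator {0<..} b * f a b + indicator {0<..} (- b) * f a b) \<partial>lborel)"
      by (rule nn_integral_cong_AE)
        (use AE_lborel_singleton[of "0::real"] in \<open>eventually_elim; auto split: split_indicator\<close>)
    also have "\<dots> = (\<integral>\<^sup>+b. indicator {0<..} b * f a b \<partial>lborel) + (\<integral>\<^sup>+b. indicator {0<..} (- b) * f a b \<partial>lborel)"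
      by (rule nn_integral_add) measurable
    also have "(\<integral>\<^sup>+b. indicator {0<..} (- b) * f a b \<partial>lborel) = ennreal \<bar>-1\<bar> * (\<integral>\<^sup>+b. indicator {0<..} (- (0 + (-1) * b)) * f a (0 + (-1) * b) \<partial>lborel)"
      by (rule nn_integral_real_affine[where t = 0 and c = "-1"]) simp_all
    finally show ?thesis by simp
  qed
  thus ?thesis by (simp add: nn_integral_add)
qed

lemma nn_integral_plane_polar:
  fixes f :: "real \<Rightarrow> real \<Rightarrow> ennreal"
  assumes f [measurable]: "(\<lambda>(a, b). f a b) \<in> borel_measurable (borel \<Otimes>\<^sub>M borel)"
  shows "(\<integral>\<^sup>+a. (\<integral>\<^sup>+b. f a b \<partial>lborel) \<partial>lborel) =
    (\<integral>\<^sup>+\<phi>. indicator {-pi<..<pi} \<phi> * (\<integral>\<^sup>+r. indicator {0<..} r * (ennreal r * f (r * cos \<phi>) (r * sin \<phi>)) \<partial>lborel) \<partial>lborel)"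
proof -
  have m [measurable]: "(\<lambda>x. f (g x) (h x)) \<in> borel_measurable M" if [measurable]: "g \<in> borel_measurable M" "h \<in> borel_measurable M"
    for g h :: "'c \<Rightarrow> real" and M :: "'c measure"
    using measurable_compose[OF _ f, of "\<lambda>x. (g x, h x)" M] by simp
  let ?I = "\<lambda>\<phi>. \<integral>\<^sup>+r. indicator {0<..} r * (ennreal r * f (r * cos \<phi>) (r * sin \<phi>)) \<partial>lborel"
  have "(\<integral>\<^sup>+a. (\<integral>\<^sup>+b. indicator {0<..} b * f a (- b) \<partial>lborel) \<partial>lborel) =
     (\<integral>\<^sup>+\<theta>. indicator {0<..<pi} \<theta> * ?I (- \<theta>) \<partial>lborel)"
    by (subst nn_integral_half_plane_polar[of "\<lambda>a b. f a (- b)"]) (simp_all add: case_prod_unfold)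
  also have "\<dots> = ennreal \<bar>-1\<bar> * (\<integral>\<^sup>+\<theta>. indicator {0<..<pi} (0 + (-1) * \<theta>) * ?I (- (0 + (-1) * \<theta>)) \<partial>lborel)"
    by (rule nn_integral_real_affine[where t = 0 and c = "-1"]) simp_all
  finally have "(\<integral>\<^sup>+a. (\<integral>\<^sup>+b. indicator {0<..} b * f a (- b) \<partial>lborel) \<partial>lborel) = (\<integral>\<^sup>+\<theta>. indicator {0<..<pi} (- \<theta>) * ?I \<theta> \<partial>lborel)"
    by simp
  hence "(\<integral>\<^sup>+a. (\<integral>\<^sup>+b. f a b \<partial>lborel) \<partial>lborel) = (\<integral>\<^sup>+\<theta>. indicator {0<..<pi} \<theta> * ?I \<theta> \<partial>lborel) + (\<integral>\<^sup>+\<theta>. indicator {0<..<pi} (- \<theta>) * ?I \<theta> \<partial>lborel)"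
    unfolding nn_integral_plane_halves[OF f] nn_integral_half_plane_polar[OF f] by simp
  also have "\<dots> = (\<integral>\<^sup>+\<theta>. indicator {0<..<pi} \<theta> * ?I \<theta> + indicator {0<..<pi} (- \<theta>) * ?I \<theta> \<partial>lborel)"
    by (rule nn_integral_add[symmetric]) measurable
  also have "\<dots> = (\<integral>\<^sup>+\<theta>. indicator {-pi<..<pi} \<theta> * ?I \<theta> \<partial>lborel)"
    by (rule nn_integral_cong_AE)
      (use AE_lborel_singleton[of "0::real"] in \<open>eventually_elim; auto split: split_indicator\<close>)
  finally show ?thesis .
qed

text \<open>Polar coordinates about the axis \<open>h\<close>: \<open>r\<close> is the radius, \<open>\<theta>\<close> the colatitude, and \<open>w\<close>,
  distributed by \<open>\<mu>\<close>, parametrizes the unit vectors \<open>e w\<close> orthogonal to \<open>h\<close>; \<open>p = d - 2\<close>.\<close>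

definition axial_polar :: "nat \<Rightarrow> 'w measure \<Rightarrow> ('w \<Rightarrow> 'a::euclidean_space) \<Rightarrow> 'a \<Rightarrow> bool" where
  "axial_polar p \<mu> e h \<longleftrightarrow> finite_measure \<mu> \<and> e \<in> borel_measurable \<mu> \<and> (\<forall>w. norm (e w) = 1 \<and> h \<bullet> e w = 0) \<and>
    (\<forall>f \<in> borel_measurable borel. (\<integral>\<^sup>+x. f x \<partial>lborel) =
      (\<integral>\<^sup>+w. (\<integral>\<^sup>+\<theta>. (\<integral>\<^sup>+r. ennreal (indicator {0<..<pi} \<theta> * indicator {0<..} r * (r ^ (p + 1) * sin \<theta> ^ p)) *
         f (r *\<^sub>R (cos \<theta> *\<^sub>R h + sin \<theta> *\<^sub>R e w)) \<partial>lborel) \<partial>lborel) \<partial>\<mu>))"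

section \<open>Orthonormal frames; the azimuth in dimensions two and three\<close>

lemma obtain_orthonormal_complement:
  fixes h :: "'a::euclidean_space"
  assumes "norm h = 1" "DIM('a) = n + 1"
  obtains B where "finite B" "card B = n" "pairwise orthogonal B" "\<And>b. b \<in> B \<Longrightarrow> norm b = 1 \<and> h \<bullet> b = 0"
proof -
  obtain S where S: "h \<in> S" "pairwise orthogonal S" "\<And>x. x \<in> S \<Longrightarrow> norm x = 1"
    "independent S" "card S = DIM('a)" "span S = UNIV"
    using vector_in_orthonormal_basis[OF assms(1)] by metis
  have "finite S" using S(4) by (rule independent_imp_finite)
  show ?thesis
  proof (rule that[of "S - {h}"])
    show "card (S - {h}) = n" using S assms \<open>finite S\<close> by simp
    show "pairwise orthogonal (S - {h})" using S(2) by (rule pairwise_subset) auto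
    show "norm b = 1 \<and> h \<bullet> b = 0" if "b \<in> S - {h}" for b
      using that S(1,3) pairwiseD[OF S(2), of h b] by (auto simp: orthogonal_def)
  qed (use \<open>finite S\<close> in auto)
qed

text \<open>In the plane exactly two unit vectors are orthogonal to \<open>h\<close>, so the azimuth
  is a Boolean under counting measure, of mass 2, and each value describes one of the half planes
  bounded by the axis.\<close>

lemma axial_polar_2:
  fixes h e :: "'a::euclidean_space"
  assumes dim: "DIM('a) = 2" and h: "norm h = 1" and e: "norm e = 1" "h \<bullet> e = 0"
  shows "axial_polar 0 (count_space UNIV) (\<lambda>w. if w then e else - e) h"
proof -
  define T where "T = (\<lambda>(a, b). a *\<^sub>R h + b *\<^sub>R e)"
  have T: "distr lborel borel T = (lborel :: 'a measure)"
  proof (rule distr_lborel_linear_isometry)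
    show "linear T" by (auto simp: T_def intro!: linearI simp: algebra_simps)
    fix x :: "real \<times> real"
    have "(norm (T x))\<^sup>2 = (norm x)\<^sup>2"
      using h e by (cases x) (simp add: T_def power2_norm_eq_inner inner_add inner_commute norm_eq_1)
    thus "norm (T x) = norm x" by simp
  qed (simp add: dim)
  have mT [measurable]: "T \<in> borel_measurable (borel \<Otimes>\<^sub>M borel)" unfolding T_def by measurable
  have "(\<integral>\<^sup>+x. f x \<partial>lborel) =
      (\<integral>\<^sup>+w. (\<integral>\<^sup>+\<theta>. (\<integral>\<^sup>+r. ennreal (indicator {0<..<pi} \<theta> * indicator {0<..} r * (r ^ (0 + 1) * sin \<theta> ^ 0)) *
         f (r *\<^sub>R (cos \<theta> *\<^sub>R h + sin \<theta> *\<^sub>R (if w then e else - e))) \<partial>lborel) \<partial>lborel) \<partial>count_space UNIV)"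
    if f [measurable]: "f \<in> borel_measurable borel" for f :: "'a \<Rightarrow> ennreal"
  proof -
    let ?f = "\<lambda>a b. f (a *\<^sub>R h + b *\<^sub>R e)"
    have fm: "(\<lambda>(a, b). ?f a b) \<in> borel_measurable (borel \<Otimes>\<^sub>M borel)" "(\<lambda>(a, b). ?f a (- b)) \<in> borel_measurable (borel \<Otimes>\<^sub>M borel)"
      by measurable
    have "(\<integral>\<^sup>+x. f x \<partial>lborel) = (\<integral>\<^sup>+x. f (T x) \<partial>lborel)"
      unfolding T[symmetric] by (rule nn_integral_distr) (auto simp flip: borel_prod)
    also have "\<dots> = (\<integral>\<^sup>+a. (\<integral>\<^sup>+b. ?f a b \<partial>lborel) \<partial>lborel)"
      unfolding lborel_prod[symmetric] by (subst lborel.nn_integral_fst[symmetric]) (auto simp: T_def)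
    also have "\<dots> = (\<integral>\<^sup>+a. (\<integral>\<^sup>+b. indicator {0<..} b * ?f a b \<partial>lborel) \<partial>lborel) +
      (\<integral>\<^sup>+a. (\<integral>\<^sup>+b. indicator {0<..} b * ?f a (- b) \<partial>lborel) \<partial>lborel)"
      by (rule nn_integral_plane_halves[OF fm(1)])
    also have "\<dots> = (\<integral>\<^sup>+\<theta>. indicator {0<..<pi} \<theta> * (\<integral>\<^sup>+r. indicator {0<..} r * (ennreal r * ?f (r * cos \<theta>) (r * sin \<theta>)) \<partial>lborel) \<partial>lborel)
       + (\<integral>\<^sup>+\<theta>. indicator {0<..<pi} \<theta> * (\<integral>\<^sup>+r. indicator {0<..} r * (ennreal r * ?f (r * cos \<theta>) (- (r * sin \<theta>))) \<partial>lborel) \<partial>lborel)"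
      unfolding nn_integral_half_plane_polar[OF fm(1)] nn_integral_half_plane_polar[OF fm(2)] ..
    also have "\<dots> = (\<integral>\<^sup>+w. (\<integral>\<^sup>+\<theta>. (\<integral>\<^sup>+r. ennreal (indicator {0<..<pi} \<theta> * indicator {0<..} r * (r ^ (0 + 1) * sin \<theta> ^ 0)) *
         f (r *\<^sub>R (cos \<theta> *\<^sub>R h + sin \<theta> *\<^sub>R (if w then e else - e))) \<partial>lborel) \<partial>lborel) \<partial>count_space UNIV)"
      unfolding nn_integral_count_space_finite[OF finite] UNIV_bool
      by (simp add: add.commute)
        (intro arg_cong2[where f = "(+)"] nn_integral_cong; auto simp: scaleR_add_right scaleR_diff_right nn_integral_cmult[symmetric] split: split_indicator intro!: nn_integral_cong)
    finally show ?thesis .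
  qed
  thus ?thesis using e by (auto simp: axial_polar_def intro!: finite_measure_count_space)
qed

text \<open>Polar coordinates are used twice: in the plane of \<open>e\<close> and
  \<open>e'\<close>, where the distance s from the axis gives the Jacobian s, then in the half plane
  of the axial coordinate and s, with Jacobian r. With s = r sin \<theta> the product is r^2 sin
  \<theta>. The azimuth carries Lebesgue measure of mass 2 pi.\<close>

lemma axial_polar_3:
  fixes h e e' :: "'a::euclidean_space"
  assumes dim: "DIM('a) = 3" and h: "norm h = 1" and e: "norm e = 1" "h \<bullet> e = 0" and e': "norm e' = 1" "h \<bullet> e' = 0" "e \<bullet> e' = 0"
  shows "axial_polar 1 (density lborel (indicator {-pi<..<pi})) (\<lambda>w. cos w *\<^sub>R e + sin w *\<^sub>R e') h"
proof -
  define T where "T = (\<lambda>(a, b, c). a *\<^sub>R h + b *\<^sub>R e + c *\<^sub>R e')"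
  have T: "distr lborel borel T = (lborel :: 'a measure)"
  proof (rule distr_lborel_linear_isometry)
    show "linear T" by (auto simp: T_def intro!: linearI simp: algebra_simps)
    fix x :: "real \<times> real \<times> real"
    have "(norm (T x))\<^sup>2 = (norm x)\<^sup>2"
      using h e e' by (cases x) (simp add: T_def power2_norm_eq_inner inner_add inner_commute norm_eq_1)
    thus "norm (T x) = norm x" by simp
  qed (simp add: dim)
  have mT [measurable]: "T \<in> borel_measurable (borel \<Otimes>\<^sub>M (borel \<Otimes>\<^sub>M borel))" unfolding T_def by measurable
  have P: "(\<integral>\<^sup>+x. f x \<partial>lborel) =
      (\<integral>\<^sup>+w. (\<integral>\<^sup>+\<theta>. (\<integral>\<^sup>+r. ennreal (indicator {0<..<pi} \<theta> * indicator {0<..} r * (r ^ (1 + 1) * sin \<theta> ^ 1)) *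
         f (r *\<^sub>R (cos \<theta> *\<^sub>R h + sin \<theta> *\<^sub>R (cos w *\<^sub>R e + sin w *\<^sub>R e'))) \<partial>lborel) \<partial>lborel) \<partial>density lborel (indicator {-pi<..<pi}))"
    if f [measurable]: "f \<in> borel_measurable borel" for f :: "'a \<Rightarrow> ennreal"
  proof -
    let ?f = "\<lambda>a b c. f (a *\<^sub>R h + b *\<^sub>R e + c *\<^sub>R e')"
    let ?g = "\<lambda>w a s. ennreal s * ?f a (s * cos w) (s * sin w)"
    have "(\<integral>\<^sup>+x. f x \<partial>lborel) = (\<integral>\<^sup>+x. f (T x) \<partial>lborel)"
      unfolding T[symmetric] by (rule nn_integral_distr) (auto simp flip: borel_prod)
    also have "\<dots> = (\<integral>\<^sup>+a. (\<integral>\<^sup>+y. f (T (a, y)) \<partial>lborel) \<partial>lborel)"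
    proof -
      have "T \<in> borel_measurable borel" using mT by (simp add: borel_prod)
      hence "(\<lambda>x. f (T x)) \<in> borel_measurable (lborel \<Otimes>\<^sub>M lborel)" by (simp add: lborel_prod)
      from lborel.nn_integral_fst[OF this] show ?thesis by (simp add: lborel_prod)
    qed
    also have "\<dots> = (\<integral>\<^sup>+a. (\<integral>\<^sup>+b. (\<integral>\<^sup>+c. ?f a b c \<partial>lborel) \<partial>lborel) \<partial>lborel)"
      unfolding lborel_prod[symmetric] by (subst lborel.nn_integral_fst[symmetric]) (auto simp: T_def)
    also have "\<dots> = (\<integral>\<^sup>+a. (\<integral>\<^sup>+w. indicator {-pi<..<pi} w * (\<integral>\<^sup>+s. indicator {0<..} s * ?g w a s \<partial>lborel) \<partial>lborel) \<partial>lborel)"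
      by (intro nn_integral_cong nn_integral_plane_polar) measurable
    also have "\<dots> = (\<integral>\<^sup>+w. (\<integral>\<^sup>+a. indicator {-pi<..<pi} w * (\<integral>\<^sup>+s. indicator {0<..} s * ?g w a s \<partial>lborel) \<partial>lborel) \<partial>lborel)"
      by (rule lborel_pair.Fubini') measurable
    also have "\<dots> = (\<integral>\<^sup>+w. indicator {-pi<..<pi} w * (\<integral>\<^sup>+a. (\<integral>\<^sup>+s. indicator {0<..} s * ?g w a s \<partial>lborel) \<partial>lborel) \<partial>lborel)"
      by (simp add: nn_integral_cmult)
    also have "\<dots> = (\<integral>\<^sup>+w. indicator {-pi<..<pi} w * (\<integral>\<^sup>+\<theta>. indicator {0<..<pi} \<theta> *
        (\<integral>\<^sup>+r. indicator {0<..} r * (ennreal r * ?g w (r * cos \<theta>) (r * sin \<theta>)) \<partial>lborel) \<partial>lborel) \<partial>lborel)"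
      by (subst nn_integral_half_plane_polar) simp_all
    also have "\<dots> = (\<integral>\<^sup>+w. indicator {-pi<..<pi} w * (\<integral>\<^sup>+\<theta>. (\<integral>\<^sup>+r. ennreal (indicator {0<..<pi} \<theta> * indicator {0<..} r * (r ^ (1 + 1) * sin \<theta> ^ 1)) *
         f (r *\<^sub>R (cos \<theta> *\<^sub>R h + sin \<theta> *\<^sub>R (cos w *\<^sub>R e + sin w *\<^sub>R e'))) \<partial>lborel) \<partial>lborel) \<partial>lborel)"
    proof (intro nn_integral_cong arg_cong2[where f = "(*)"] refl)
      fix w \<theta> :: real
      have "indicator {0<..<pi} \<theta> * (indicator {0<..} r * (ennreal r * ?g w (r * cos \<theta>) (r * sin \<theta>))) =
        ennreal (indicator {0<..<pi} \<theta> * indicator {0<..} r * (r ^ (1 + 1) * sin \<theta> ^ 1)) *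
         f (r *\<^sub>R (cos \<theta> *\<^sub>R h + sin \<theta> *\<^sub>R (cos w *\<^sub>R e + sin w *\<^sub>R e')))" for r
      proof (cases "\<theta> \<in> {0<..<pi} \<and> r > 0")
        case True
        hence "sin \<theta> > 0" by (intro sin_gt_zero) auto
        hence "ennreal r * ennreal (r * sin \<theta>) = ennreal (r ^ (1 + 1) * sin \<theta> ^ 1)"
          using True by (simp add: power2_eq_square mult_ac flip: ennreal_mult)
        moreover have "(r * cos \<theta>) *\<^sub>R h + (r * sin \<theta> * cos w) *\<^sub>R e + (r * sin \<theta> * sin w) *\<^sub>R e' =
           r *\<^sub>R (cos \<theta> *\<^sub>R h + sin \<theta> *\<^sub>R (cos w *\<^sub>R e + sin w *\<^sub>R e'))"
          by (simp add: scaleR_add_right mult.assoc)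
        ultimately show ?thesis using True by (simp flip: mult.assoc)
      qed (auto split: split_indicator)
      thus "indicator {0<..<pi} \<theta> * (\<integral>\<^sup>+r. indicator {0<..} r * (ennreal r * ?g w (r * cos \<theta>) (r * sin \<theta>)) \<partial>lborel) =
        (\<integral>\<^sup>+r. ennreal (indicator {0<..<pi} \<theta> * indicator {0<..} r * (r ^ (1 + 1) * sin \<theta> ^ 1)) *
         f (r *\<^sub>R (cos \<theta> *\<^sub>R h + sin \<theta> *\<^sub>R (cos w *\<^sub>R e + sin w *\<^sub>R e'))) \<partial>lborel)"
        by (subst nn_integral_cmult[symmetric]) simp_all
    qed
    also have "\<dots> = (\<integral>\<^sup>+w. (\<integral>\<^sup>+\<theta>. (\<integral>\<^sup>+r. ennreal (indicator {0<..<pi} \<theta> * indicator {0<..} r * (r ^ (1 + 1) * sin \<theta> ^ 1)) *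
         f (r *\<^sub>R (cos \<theta> *\<^sub>R h + sin \<theta> *\<^sub>R (cos w *\<^sub>R e + sin w *\<^sub>R e'))) \<partial>lborel) \<partial>lborel) \<partial>density lborel (indicator {-pi<..<pi}))"
      by (rule nn_integral_density[symmetric]) measurable
    finally show ?thesis .
  qed
  have "finite_measure (density lborel (indicator {-pi<..<pi::real}))"
    by (intro finite_measureI) (simp add: emeasure_density)
  moreover have "norm (cos w *\<^sub>R e + sin w *\<^sub>R e') = 1 \<and> h \<bullet> (cos w *\<^sub>R e + sin w *\<^sub>R e') = 0" for w
  proof -
    have "(norm (cos w *\<^sub>R e + sin w *\<^sub>R e'))\<^sup>2 = 1"
      using e e' by (simp add: power2_norm_eq_inner inner_add inner_commute norm_eq_1 flip: power2_eq_square)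
    hence "norm (cos w *\<^sub>R e + sin w *\<^sub>R e') = 1" by (simp add: power2_eq_1_iff) (smt (verit) norm_ge_zero)
    thus ?thesis using e e' by (simp add: inner_add)
  qed
  ultimately show ?thesis using P by (auto simp: axial_polar_def)
qed

section \<open>Profiles along half great circles\<close>

lemma borel_measurable_cis [measurable]: "cis \<in> borel_measurable borel"
  by (intro borel_measurable_continuous_onI continuous_on_cis continuous_on_id)

text \<open>The weight (r / R)^m with r = R + z is what remains of R^(-m) r^(2m) once the caps have
  taken a factor r^m. It is at most 2^m on [-R, R] and tends to 1, so for integrable v it does not
  affect the limit. The value of the limit is read off at exponent 0, where the integral is the
  partial Fourier integral of the pointwise inversion lemma.\<close>

lemma fourier_inversion_weighted:
  fixes V V' :: "real \<Rightarrow> complex" and m :: real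
  assumes N: "N > 0" and M: "\<And>x. norm (V x) \<le> M" "\<And>x. norm (V' x) \<le> M"
    and V: "\<And>x. (V has_vector_derivative V' x) (at x)" and V': "continuous_on UNIV V'"
    and supp: "\<And>x. x \<notin> {-N<..<N} \<Longrightarrow> V x = 0" and m: "m \<ge> 0"
  shows "((\<lambda>R. LINT z|lborel. of_real (indicator {-R..R} z * ((R + z) / R) powr m) *
      (integral {-N..N} (\<lambda>x. V x * cis (z * x)) * cis (- (z * k)))) \<longlongrightarrow> 2 * pi * V k) at_top"
proof -
  have cont: "continuous_on UNIV V"
    using V continuous_on_vector_derivative[of UNIV V V'] by simp
  define v where "v z = integral {-N..N} (\<lambda>x. V x * cis (z * x))" for z
  define g where "g z = v z * cis (- (z * k))" for z
  have "continuous_on UNIV v"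
    unfolding v_def cbox_interval [symmetric]
    by (intro integral_continuous_on_param)
      (auto simp: case_prod_unfold intro!: continuous_intros continuous_on_compose2[OF cont])
  hence cv: "continuous_on A v" for A by (rule continuous_on_subset) auto
  have cg: "continuous_on A g" for A unfolding g_def by (intro continuous_intros cv)
  have mg [measurable]: "g \<in> borel_measurable borel" by (rule borel_measurable_continuous_onI[OF cg])
  have "(\<integral>\<^sup>+z. ennreal (norm (g z)) \<partial>lborel) = (\<integral>\<^sup>+z. norm (v z) \<partial>lborel)"
    by (simp add: g_def norm_mult)
  also have "\<dots> < \<infinity>"
    using fourier_L1_bound[OF N M V V' supp] unfolding v_def by (auto simp: le_less_trans)
  finally have ig: "integrable lborel g" by (intro integrableI_bounded) auto
  have lim: "((\<lambda>R. LINT z|lborel. of_real (indicator {-R..R} z * ((R + z) / R) powr s) * g z) \<longlongrightarrow> (LINT z|lborel. g z)) at_top"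
    if s: "s \<ge> 0" for s
  proof (rule integral_dominated_convergence_at_top[where w = "\<lambda>z. 2 powr s * norm (g z)"])
    show "integrable lborel (\<lambda>z. 2 powr s * norm (g z))" using ig by simp
    show "\<forall>\<^sub>F R in at_top. AE z in lborel. norm (of_real (indicator {-R..R} z * ((R + z) / R) powr s) * g z) \<le> 2 powr s * norm (g z)"
      using eventually_gt_at_top[of 0]
    proof eventually_elim
      case (elim R)
      have "((R + z) / R) powr s \<le> 2 powr s" if "z \<in> {-R..R}" for z
        using that elim s by (intro powr_mono2) (auto simp: field_simps)
      thus ?case by (intro always_eventually allI) (auto simp: norm_mult abs_mult intro!: mult_right_mono split: split_indicator)
    qed
    show "AE z in lborel. ((\<lambda>R. of_real (indicator {-R..R} z * ((R + z) / R) powr s) * g z) \<longlongrightarrow> g z) at_top"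
    proof (intro always_eventually allI)
      fix z :: real
      have "((\<lambda>R. 1 + z / R) \<longlongrightarrow> 1 + 0) at_top"
        by (intro tendsto_add tendsto_const real_tendsto_divide_at_top[OF tendsto_const filterlim_ident])
      hence "((\<lambda>R. (1 + z / R) powr s) \<longlongrightarrow> 1 powr s) at_top" by (intro tendsto_powr) auto
      hence "((\<lambda>R. (1 + z / R) powr s) \<longlongrightarrow> 1) at_top" by simp
      moreover have "\<forall>\<^sub>F R in at_top. (1 + z / R) powr s = indicator {-R..R} z * ((R + z) / R) powr s"
        using eventually_gt_at_top[of "\<bar>z\<bar>"] by eventually_elim (auto simp: add_divide_distrib indicator_def)
      ultimately have "((\<lambda>R. indicator {-R..R} z * ((R + z) / R) powr s) \<longlongrightarrow> 1) at_top"
        by (rule Lim_transform_eventually)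
      from tendsto_mult[OF tendsto_of_real[OF this] tendsto_const]
      show "((\<lambda>R. of_real (indicator {-R..R} z * ((R + z) / R) powr s) * g z) \<longlongrightarrow> g z) at_top" by simp
    qed
  qed measurable
  have "((\<lambda>R. integral {-R..R} g) \<longlongrightarrow> 2 * pi * V k) at_top"
    unfolding g_def v_def
    by (rule fourier_inversion_pointwise[OF N cont _ V]) (use supp in auto)
  moreover have "\<forall>\<^sub>F R in at_top. integral {-R..R} g = (LINT z|lborel. of_real (indicator {-R..R} z * ((R + z) / R) powr 0) * g z)"
    using eventually_gt_at_top[of 0]
  proof eventually_elim
    case (elim R)
    have "integral {-R..R} g = (LINT z:{-R..R}|lborel. g z)"
      by (rule set_borel_integral_eq_integral(2)[symmetric]) (intro borel_integrable_atLeastAtMost' cg)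
    also have "\<dots> = (LINT z|lborel. of_real (indicator {-R..R} z * ((R + z) / R) powr 0) * g z)"
      unfolding set_lebesgue_integral_def
    proof (rule integral_cong_AE)
      \<comment> \<open>The point z = -R has to be excluded as a null set, because
        \<open>0 powr 0\<close> is 0.\<close>
      show "AE z in lborel. indicator {-R..R} z *\<^sub>R g z = of_real (indicator {-R..R} z * ((R + z) / R) powr 0) * g z"
        using AE_lborel_singleton[of "-R"] by eventually_elim (use elim in \<open>auto split: split_indicator\<close>)
    qed measurable
    finally show ?case .
  qed
  ultimately have "((\<lambda>R. LINT z|lborel. of_real (indicator {-R..R} z * ((R + z) / R) powr 0) * g z) \<longlongrightarrow> 2 * pi * V k) at_top"
    by (rule Lim_transform_eventually)
  hence "(LINT z|lborel. g z) = 2 * pi * V k"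
    using tendsto_unique[OF _ lim[of 0]] by auto
  with lim[OF m] show ?thesis by (simp add: g_def v_def)
qed

text \<open>\<open>V \<xi> \<theta>\<close> is the profile along a half great circle of colatitude \<open>\<theta>\<close>, and \<open>p = d - 2\<close>.\<close>

locale half_circle_profile =
  fixes V Vx Vt Vtx :: "real \<Rightarrow> real \<Rightarrow> complex" and N M C :: real and p :: nat and \<kappa> :: real
  assumes N: "N > 0" and p: "p \<in> {0, 1}" and \<kappa>: "\<kappa> > 0"
    and C: "\<And>l \<theta>. l > 0 \<Longrightarrow> \<theta> \<in> {0..pi} \<Longrightarrow> norm (of_real (l powr ((real p + 1) / 2)) * cap_wave p l \<theta>) \<le> C"
    and bounds: "\<And>x t. norm (V x t) \<le> M" "\<And>x t. norm (Vx x t) \<le> M" "\<And>x t. norm (Vt x t) \<le> M" "\<And>x t. norm (Vtx x t) \<le> M"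
    and cont: "continuous_on UNIV (\<lambda>(x, t). V x t)" "continuous_on UNIV (\<lambda>(x, t). Vt x t)"
      "\<And>t. continuous_on UNIV (\<lambda>x. Vx x t)" "\<And>t. continuous_on UNIV (\<lambda>x. Vtx x t)"
    and deriv: "\<And>x t. ((\<lambda>x. V x t) has_vector_derivative Vx x t) (at x)"
      "\<And>x t. ((\<lambda>x. Vt x t) has_vector_derivative Vtx x t) (at x)"
      "\<And>x t. ((\<lambda>t. V x t) has_vector_derivative Vt x t) (at t)"
    and supp: "\<And>x t. x \<notin> {-N<..<N} \<Longrightarrow> V x t = 0" "\<And>x t. x \<notin> {-N<..<N} \<Longrightarrow> Vt x t = 0"
begin

definition m :: real where "m = (real p + 1) / 2"

text \<open>The factor 1 / (2 pi) of the inverse transform is left out here; it returns when the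
  shell is identified with these integrals.\<close>

definition v :: "real \<Rightarrow> real \<Rightarrow> complex" where
  "v z t = integral {-N..N} (\<lambda>x. V x t * cis (z * x))"

definition vt :: "real \<Rightarrow> real \<Rightarrow> complex" where
  "vt z t = integral {-N..N} (\<lambda>x. Vt x t * cis (z * x))"

definition L1 :: real where "L1 = pi / 2 + 30 * pi * N * M\<^sup>2"

definition circle_wave :: "real \<Rightarrow> real \<Rightarrow> complex" where
  "circle_wave r z = integral {0..pi} (\<lambda>t. of_real (sin t ^ p) * v z t * cis (- (r * \<kappa> * cos t)))"

text \<open>The share of one azimuth in the Fourier integral of the shell of radius
  \<open>R\<close>, up to 1 / (2 pi). The exponent p + 1 equals 2 m: it is the radial part of the
  volume element, and the angular part sits in \<open>circle_wave\<close>.\<close>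

definition shell_wave :: "real \<Rightarrow> complex" where
  "shell_wave R = of_real (R powr (- m)) * integral {0..2 * R} (\<lambda>r. of_real (r ^ (p + 1)) * circle_wave r (r - R))"

section \<open>Continuity, angular derivative and integration by parts in the colatitude\<close>

lemma m: "m > 0" using p by (auto simp: m_def)

lemma cont_V: "continuous_on A (\<lambda>y. V (f y) (g y))" if "continuous_on A f" "continuous_on A g"
  using continuous_on_compose2[OF cont(1) continuous_on_Pair[OF that]] by simp

lemma cont_Vt: "continuous_on A (\<lambda>y. Vt (f y) (g y))" if "continuous_on A f" "continuous_on A g"
  using continuous_on_compose2[OF cont(2) continuous_on_Pair[OF that]] by simp

lemma cont_v: "continuous_on A (\<lambda>y. v (f y) (g y))" if "continuous_on A f" "continuous_on A g"
proof -
  have "continuous_on UNIV (\<lambda>x :: real \<times> real. integral (cbox (-N) N) (\<lambda>\<xi>. V \<xi> (snd x) * cis (fst x * \<xi>)))"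
    by (intro integral_continuous_on_param) (auto simp: case_prod_unfold intro!: continuous_intros cont_V)
  from continuous_on_compose2[OF this continuous_on_Pair[OF that]] show ?thesis by (simp add: v_def)
qed

lemma cont_vt: "continuous_on A (\<lambda>y. vt (f y) (g y))" if "continuous_on A f" "continuous_on A g"
proof -
  have "continuous_on UNIV (\<lambda>x :: real \<times> real. integral (cbox (-N) N) (\<lambda>\<xi>. Vt \<xi> (snd x) * cis (fst x * \<xi>)))"
    by (intro integral_continuous_on_param) (auto simp: case_prod_unfold intro!: continuous_intros cont_Vt)
  from continuous_on_compose2[OF this continuous_on_Pair[OF that]] show ?thesis by (simp add: vt_def)
qed

lemma deriv_v: "(v z has_vector_derivative vt z t) (at t within {0..pi})" if t: "t \<in> {0..pi}"
proof -
  have "((\<lambda>t. integral (cbox (-N) N) (\<lambda>x. V x t * cis (z * x))) has_vector_derivative integral (cbox (-N) N) (\<lambda>x. Vt x t * cis (z * x))) (at t within {0..pi})"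
  proof (rule leibniz_rule_vector_derivative[where fx = "\<lambda>t x. Vt x t * cis (z * x)"])
    show "((\<lambda>t. V x t * cis (z * x)) has_vector_derivative Vt x t * cis (z * x)) (at t within {0..pi})" for x t
      by (intro has_vector_derivative_mult_left has_vector_derivative_at_within[OF deriv(3)])
    show "(\<lambda>x. V x t * cis (z * x)) integrable_on cbox (- N) N" for t
      by (intro integrable_continuous continuous_intros cont_V)
    show "continuous_on ({0..pi} \<times> cbox (- N) N) (\<lambda>(t, x). Vt x t * cis (z * x))"
      unfolding case_prod_unfold by (intro continuous_intros cont_Vt)
  qed (use t in auto)
  thus ?thesis unfolding v_def[abs_def] vt_def by simp
qed

text \<open>The cap wave is minus an antiderivative of the plane wave in the colatitude. Since it
  vanishes at \<open>pi\<close>, the only boundary term is at the pole 0, where the cap is the whole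
  half circle.\<close>

lemma circle_wave_eq:
  "circle_wave r z = cap_wave p (r * \<kappa>) 0 * v z 0 + integral {0..pi} (\<lambda>t. vt z t * cap_wave p (r * \<kappa>) t)"
proof -
  have cc: "continuous_on {0..pi} (cap_wave p (r * \<kappa>))" by (rule continuous_on_cap_wave)
  have "((\<lambda>t. cap_wave p (r * \<kappa>) t * vt z t + - (of_real (sin t ^ p) * cis (- (r * \<kappa> * cos t))) * v z t) has_integral
     (cap_wave p (r * \<kappa>) pi * v z pi - cap_wave p (r * \<kappa>) 0 * v z 0)) {0..pi}"
    by (rule fundamental_theorem_of_calculus[OF pi_ge_zero]) (intro has_vector_derivative_mult has_vector_derivative_cap_wave deriv_v)
  moreover have "((\<lambda>t. vt z t * cap_wave p (r * \<kappa>) t) has_integral integral {0..pi} (\<lambda>t. vt z t * cap_wave p (r * \<kappa>) t)) {0..pi}"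
    by (intro integrable_integral integrable_continuous_real continuous_intros cont_vt cc)
  ultimately have "((\<lambda>t. vt z t * cap_wave p (r * \<kappa>) t - (cap_wave p (r * \<kappa>) t * vt z t + - (of_real (sin t ^ p) * cis (- (r * \<kappa> * cos t))) * v z t)) has_integral
     (integral {0..pi} (\<lambda>t. vt z t * cap_wave p (r * \<kappa>) t) - (cap_wave p (r * \<kappa>) pi * v z pi - cap_wave p (r * \<kappa>) 0 * v z 0))) {0..pi}"
    by (intro has_integral_diff)
  also have "(\<lambda>t. vt z t * cap_wave p (r * \<kappa>) t - (cap_wave p (r * \<kappa>) t * vt z t + - (of_real (sin t ^ p) * cis (- (r * \<kappa> * cos t))) * v z t))
     = (\<lambda>t. of_real (sin t ^ p) * v z t * cis (- (r * \<kappa> * cos t)))"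
    by (simp add: fun_eq_iff mult_ac)
  finally show ?thesis
    unfolding circle_wave_def by (simp add: integral_unique)
qed

section \<open>Integrability in the distance z from the shell\<close>

lemma nn_integral_v: "(\<integral>\<^sup>+z. norm (v z t) \<partial>lborel) \<le> ennreal L1"
  unfolding v_def L1_def by (rule fourier_L1_bound[OF N bounds(1,2) deriv(1) cont(3) supp(1)])

lemma nn_integral_vt: "(\<integral>\<^sup>+z. norm (vt z t) \<partial>lborel) \<le> ennreal L1"
  unfolding vt_def L1_def by (rule fourier_L1_bound[OF N bounds(3,4) deriv(2) cont(4) supp(2)])

lemma L1: "L1 \<ge> 0" using N by (simp add: L1_def)

text \<open>Serves as the part of the dominating function that belongs to the angular integral; it
  is integrable in z by Tonelli, as the L^1 bound for \<open>vt\<close> is uniform in t.\<close>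

definition vt_norm :: "real \<Rightarrow> real" where "vt_norm z = integral {0..pi} (\<lambda>t. norm (vt z t))"

lemma cont_vt_norm: "continuous_on UNIV vt_norm"
proof -
  have "continuous_on UNIV (\<lambda>z. integral (cbox 0 pi) (\<lambda>t. norm (vt z t)))"
    by (intro integral_continuous_on_param) (auto simp: case_prod_unfold intro!: continuous_intros cont_vt)
  thus ?thesis by (simp add: vt_norm_def[abs_def])
qed

lemma vt_norm_nonneg: "vt_norm z \<ge> 0"
  unfolding vt_norm_def by (intro integral_nonneg integrable_continuous_real continuous_intros cont_vt) auto

lemma measurable_vt_norm [measurable]: "vt_norm \<in> borel_measurable borel"
  using cont_vt_norm by (rule borel_measurable_continuous_onI)

lemma measurable_v [measurable]: "(\<lambda>z. v z t) \<in> borel_measurable borel"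
  by (intro borel_measurable_continuous_onI cont_v continuous_intros)

lemma nn_integral_vt_norm: "(\<integral>\<^sup>+z. vt_norm z \<partial>lborel) \<le> ennreal (pi * L1)"
proof -
  have m2 [measurable]: "(\<lambda>(z, t). vt z t) \<in> borel_measurable (borel \<Otimes>\<^sub>M borel)"
    unfolding borel_prod case_prod_unfold by (intro borel_measurable_continuous_onI cont_vt continuous_intros)
  have "(\<integral>\<^sup>+z. vt_norm z \<partial>lborel) = (\<integral>\<^sup>+z. (\<integral>\<^sup>+t. indicator {0..pi} t * ennreal (norm (vt z t)) \<partial>lborel) \<partial>lborel)"
  proof (rule nn_integral_cong)
    fix z
    have "((\<lambda>t. norm (vt z t)) has_integral vt_norm z) {0..pi}"
      unfolding vt_norm_def by (intro integrable_integral integrable_continuous_real continuous_intros cont_vt)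
    from nn_integral_has_integral_lebesgue[OF _ this]
    have "(\<integral>\<^sup>+t. ennreal (indicator {0..pi} t * norm (vt z t)) \<partial>lborel) = ennreal (vt_norm z)" by simp
    also have "(\<lambda>t. ennreal (indicator {0..pi} t * norm (vt z t))) = (\<lambda>t. indicator {0..pi} t * ennreal (norm (vt z t)))"
      by (auto split: split_indicator)
    finally show "ennreal (vt_norm z) = (\<integral>\<^sup>+t. indicator {0..pi} t * ennreal (norm (vt z t)) \<partial>lborel)" by simp
  qed
  also have "\<dots> = (\<integral>\<^sup>+t. (\<integral>\<^sup>+z. indicator {0..pi} t * ennreal (norm (vt z t)) \<partial>lborel) \<partial>lborel)"
    by (rule lborel_pair.Fubini') measurable
  also have "\<dots> \<le> (\<integral>\<^sup>+t. indicator {0..pi} t * ennreal L1 \<partial>lborel)"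
  proof (rule nn_integral_mono)
    fix t :: real
    have [measurable]: "(\<lambda>z. vt z t) \<in> borel_measurable borel"
      by (intro borel_measurable_continuous_onI cont_vt continuous_intros)
    have "(\<integral>\<^sup>+z. indicator {0..pi} t * ennreal (norm (vt z t)) \<partial>lborel) = indicator {0..pi} t * (\<integral>\<^sup>+z. ennreal (norm (vt z t)) \<partial>lborel)"
      by (rule nn_integral_cmult) measurable
    also have "\<dots> \<le> indicator {0..pi} t * ennreal L1" by (intro mult_left_mono nn_integral_vt) auto
    finally show "(\<integral>\<^sup>+z. indicator {0..pi} t * ennreal (norm (vt z t)) \<partial>lborel) \<le> indicator {0..pi} t * ennreal L1" .
  qed
  also have "\<dots> = ennreal (pi * L1)"
    using L1 by (simp add: nn_integral_multc ennreal_mult)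
  finally show ?thesis .
qed

lemma integrable_v: "integrable lborel (\<lambda>z. v z t)"
  using nn_integral_v[of t] by (intro integrableI_bounded) (auto simp: le_less_trans)

lemma integrable_vt_norm: "integrable lborel vt_norm"
  using nn_integral_vt_norm by (intro integrableI_bounded) (auto simp: le_less_trans vt_norm_nonneg)

lemma integral_v_le: "(LINT z|lborel. norm (v z t)) \<le> L1"
  using nn_integral_v[of t] nn_integral_eq_integral[OF integrable_norm[OF integrable_v[of t]]] L1
  by (auto simp: ennreal_le_iff)

lemma integral_vt_norm_le: "(LINT z|lborel. vt_norm z) \<le> pi * L1"
  using nn_integral_vt_norm nn_integral_eq_integral[OF integrable_vt_norm] vt_norm_nonneg L1
  by (auto simp: ennreal_le_iff)

definition scaled_cap :: "real \<Rightarrow> real \<Rightarrow> complex" where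
  "scaled_cap r t = of_real ((r * \<kappa>) powr m) * cap_wave p (r * \<kappa>) t"

text \<open>The integrand of \<open>shell_wave\<close> in z = r - R after integration by parts, with
  its powers distributed so that every factor stays bounded: R^(-m) r^(2m) \<kappa>^m = (r / R)^m (r
  \<kappa>)^m, the second power compensating the decay of the caps.\<close>

definition shell_integrand :: "real \<Rightarrow> real \<Rightarrow> complex" where
  "shell_integrand R z = of_real (indicator {-R..R} z * ((R + z) / R) powr m) * (scaled_cap (R + z) 0 * v z 0 + integral {0..pi} (\<lambda>t. vt z t * scaled_cap (R + z) t))"

lemma scaled_cap_bound: "r > 0 \<Longrightarrow> t \<in> {0..pi} \<Longrightarrow> norm (scaled_cap r t) \<le> C"
  unfolding scaled_cap_def m_def using C \<kappa> by simp

lemma C_nonneg: "C \<ge> 0"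
  using order_trans[OF norm_ge_zero C[of 1 0]] by simp

lemma weight_le: "indicator {-R..R} z * ((R + z) / R) powr m \<le> 2 powr m" if "R > 0"
  using that m by (auto split: split_indicator intro!: powr_mono2 simp: field_simps)

lemma weight_norm: "norm (complex_of_real (indicator {-R..R} z * ((R + z) / R) powr m)) \<le> 2 powr m" if "R > 0"
proof -
  have "0 \<le> indicator {-R..R} z * ((R + z) / R) powr m" by simp
  thus ?thesis by (simp only: norm_of_real abs_of_nonneg weight_le[OF that])
qed

lemma shell_integrand_eq:
  assumes R: "R > 0"
  shows "shell_integrand R z = indicator {-R..R} z *\<^sub>R (of_real (\<kappa> powr m * R powr (- m)) * (of_real ((R + z) ^ (p + 1)) * circle_wave (R + z) z))"
proof (cases "z \<in> {-R<..R}")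
  case True
  hence r: "R + z > 0" by simp
  have pow: "(R + z) ^ (p + 1) = (R + z) powr m * (R + z) powr m"
  proof -
    have "(R + z) ^ (p + 1) = (R + z) powr real (p + 1)" using r by (simp only: powr_realpow)
    also have "real (p + 1) = m + m" by (simp add: m_def)
    finally show ?thesis by (simp only: powr_add)
  qed
  have "((R + z) / R) powr m * ((R + z) * \<kappa>) powr m = \<kappa> powr m * R powr (- m) * (R + z) ^ (p + 1)"
  proof -
    have "((R + z) / R) powr m = (R + z) powr m / R powr m" by (rule powr_divide)
    hence 1: "((R + z) / R) powr m = (R + z) powr m * R powr (- m)" by (simp add: powr_minus divide_inverse)
    have 2: "((R + z) * \<kappa>) powr m = (R + z) powr m * \<kappa> powr m" by (rule powr_mult)
    show ?thesis unfolding pow 1 2 by (simp only: mult_ac)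
  qed
  hence eq: "complex_of_real (\<kappa> powr m * R powr (- m)) * of_real ((R + z) ^ (p + 1)) = of_real (((R + z) / R) powr m) * of_real (((R + z) * \<kappa>) powr m)"
    by (simp only: of_real_mult [symmetric])
  have "scaled_cap (R + z) 0 * v z 0 + integral {0..pi} (\<lambda>t. vt z t * scaled_cap (R + z) t) = of_real (((R + z) * \<kappa>) powr m) * circle_wave (R + z) z"
  proof -
    have "integral {0..pi} (\<lambda>t. vt z t * scaled_cap (R + z) t) = of_real (((R + z) * \<kappa>) powr m) * integral {0..pi} (\<lambda>t. vt z t * cap_wave p ((R + z) * \<kappa>) t)"
    proof -
      have "vt z t * scaled_cap (R + z) t = of_real (((R + z) * \<kappa>) powr m) * (vt z t * cap_wave p ((R + z) * \<kappa>) t)" for t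
        by (simp add: scaled_cap_def)
      thus ?thesis by (simp only: integral_mult_right)
    qed
    thus ?thesis by (simp add: circle_wave_eq scaled_cap_def distrib_left)
  qed
  hence "shell_integrand R z = of_real (((R + z) / R) powr m) * of_real (((R + z) * \<kappa>) powr m) * circle_wave (R + z) z"
    using True by (simp add: shell_integrand_def)
  also have "\<dots> = of_real (\<kappa> powr m * R powr (- m)) * (of_real ((R + z) ^ (p + 1)) * circle_wave (R + z) z)"
    by (simp only: eq [symmetric] mult.assoc)
  finally show ?thesis using True by simp
next
  case False
  \<comment> \<open>At z = -R the indicator is 1, but both sides vanish through their powers of R +
    z = 0.\<close>
  thus ?thesis by (cases "z = - R") (auto simp: shell_integrand_def)
qed

lemma cont_circle_wave: "continuous_on A (\<lambda>z. circle_wave (R + z) z)"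
proof -
  have "continuous_on UNIV (\<lambda>z. integral (cbox 0 pi) (\<lambda>t. of_real (sin t ^ p) * v z t * cis (- ((R + z) * \<kappa> * cos t))))"
    by (intro integral_continuous_on_param) (auto simp: case_prod_unfold intro!: continuous_intros cont_v)
  hence "continuous_on UNIV (\<lambda>z. circle_wave (R + z) z)" by (simp add: circle_wave_def)
  thus ?thesis by (rule continuous_on_subset) auto
qed

lemma measurable_shell_integrand:
  assumes R: "R > 0"
  shows "shell_integrand R \<in> borel_measurable borel"
proof -
  have "(\<lambda>z. indicator {-R..R} z *\<^sub>R (of_real (\<kappa> powr m * R powr (- m)) * (of_real ((R + z) ^ (p + 1)) * circle_wave (R + z) z))) \<in> borel_measurable borel"
    by (intro borel_measurable_continuous_on_indicator continuous_intros cont_circle_wave) auto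
  thus ?thesis by (simp only: shell_integrand_eq[OF R, symmetric])
qed

lemma shell_integrand_bound:
  assumes R: "R > 0"
  shows "norm (shell_integrand R z) \<le> 2 powr m * C * (norm (v z 0) + vt_norm z)"
proof (cases "z \<in> {-R<..R}")
  case True
  hence r: "R + z > 0" by simp
  have "norm (integral {0..pi} (\<lambda>t. vt z t * scaled_cap (R + z) t)) \<le> integral {0..pi} (\<lambda>t. norm (vt z t) * C)"
  proof (rule integral_norm_bound_integral)
    show "(\<lambda>t. vt z t * scaled_cap (R + z) t) integrable_on {0..pi}"
      unfolding scaled_cap_def by (intro integrable_continuous_real continuous_intros cont_vt continuous_on_cap_wave)
    show "(\<lambda>t. norm (vt z t) * C) integrable_on {0..pi}"
      by (intro integrable_continuous_real continuous_intros cont_vt)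
    show "norm (vt z t * scaled_cap (R + z) t) \<le> norm (vt z t) * C" if "t \<in> {0..pi}" for t
      unfolding norm_mult using scaled_cap_bound[OF r that] by (intro mult_left_mono) auto
  qed
  also have "\<dots> = vt_norm z * C" by (simp add: vt_norm_def)
  finally have 1: "norm (integral {0..pi} (\<lambda>t. vt z t * scaled_cap (R + z) t)) \<le> vt_norm z * C" .
  have 2: "norm (scaled_cap (R + z) 0 * v z 0) \<le> C * norm (v z 0)"
    unfolding norm_mult using scaled_cap_bound[OF r, of 0] by (intro mult_right_mono) auto
  have "norm (scaled_cap (R + z) 0 * v z 0 + integral {0..pi} (\<lambda>t. vt z t * scaled_cap (R + z) t)) \<le> C * (norm (v z 0) + vt_norm z)"
    using norm_triangle_mono[OF 2 1] by (simp add: algebra_simps)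
  hence "norm (shell_integrand R z) \<le> 2 powr m * (C * (norm (v z 0) + vt_norm z))"
    unfolding shell_integrand_def norm_mult by (intro mult_mono weight_norm[OF R]) auto
  thus ?thesis by (simp add: mult.assoc)
next
  case False
  hence "shell_integrand R z = 0" by (cases "z = - R") (auto simp: shell_integrand_def)
  thus ?thesis using C_nonneg vt_norm_nonneg by simp
qed

lemma integrable_shell_integrand: "R > 0 \<Longrightarrow> integrable lborel (shell_integrand R)"
  by (rule Bochner_Integration.integrable_bound[where f = "\<lambda>z. 2 powr m * C * (norm (v z 0) + vt_norm z)"])
    (use shell_integrand_bound measurable_shell_integrand C_nonneg vt_norm_nonneg integrable_v integrable_vt_norm in \<open>auto simp: order_trans[OF shell_integrand_bound]\<close>)

lemma shell_wave_eq:
  assumes R: "R > 0"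
  shows "shell_wave R = of_real (\<kappa> powr (- m)) * (LINT z|lborel. shell_integrand R z)"
proof -
  let ?h = "\<lambda>r. of_real (r ^ (p + 1)) * circle_wave r (r - R)"
  let ?g = "\<lambda>z. of_real ((R + z) ^ (p + 1)) * circle_wave (R + z) z"
  have "integral {0..2 * R} ?h = integral {-R..R} (?h \<circ> (+) R)"
    using integral_shift_Icc_real[of "-R" R ?h R] by simp
  also have "?h \<circ> (+) R = ?g" by (simp add: o_def)
  also have "integral {-R..R} ?g = (LINT z:{-R..R}|lborel. ?g z)"
    by (intro set_borel_integral_eq_integral(2)[symmetric] borel_integrable_atLeastAtMost' continuous_intros cont_circle_wave)
  finally have 1: "integral {0..2 * R} ?h = (LINT z|lborel. indicator {-R..R} z *\<^sub>R ?g z)"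
    by (simp add: set_lebesgue_integral_def)
  have "(LINT z|lborel. shell_integrand R z) = (LINT z|lborel. of_real (\<kappa> powr m * R powr (- m)) * (indicator {-R..R} z *\<^sub>R ?g z))"
    unfolding shell_integrand_eq[OF R] by simp
  also have "\<dots> = of_real (\<kappa> powr m * R powr (- m)) * (LINT z|lborel. indicator {-R..R} z *\<^sub>R ?g z)"
    by (rule integral_mult_right_zero)
  finally have 2: "(LINT z|lborel. shell_integrand R z) = of_real (\<kappa> powr m * R powr (- m)) * (LINT z|lborel. indicator {-R..R} z *\<^sub>R ?g z)" .
  have "complex_of_real (\<kappa> powr (- m)) * of_real (\<kappa> powr m * R powr (- m)) = of_real (R powr (- m))"
  proof -
    have "\<kappa> powr (- m) * (\<kappa> powr m * R powr (- m)) = R powr (- m)" using \<kappa> by (simp add: powr_minus)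
    thus ?thesis by (simp only: of_real_mult [symmetric])
  qed
  thus ?thesis unfolding shell_wave_def 1 2 by (simp only: mult.assoc [symmetric])
qed

text \<open>The bound involves the profile only through \<open>N\<close>, \<open>M\<close>,
  \<open>C\<close>, \<open>p\<close> and \<open>\<kappa>\<close>. These are common to all azimuths,
  so it serves as the dominating constant for the integral over them.\<close>

lemma shell_wave_bound:
  assumes R: "R > 0"
  shows "norm (shell_wave R) \<le> \<kappa> powr (- m) * (2 powr m * C * (L1 + pi * L1))"
proof -
  have "norm (LINT z|lborel. shell_integrand R z) \<le> (LINT z|lborel. 2 powr m * C * (norm (v z 0) + vt_norm z))"
    by (rule order_trans[OF integral_norm_bound Bochner_Integration.integral_mono])
      (use integrable_shell_integrand[OF R] shell_integrand_bound[OF R] integrable_v integrable_vt_norm in auto)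
  also have "\<dots> = 2 powr m * C * ((LINT z|lborel. norm (v z 0)) + (LINT z|lborel. vt_norm z))"
    using integrable_v integrable_vt_norm by simp
  also have "\<dots> \<le> 2 powr m * C * (L1 + pi * L1)"
    using C_nonneg integral_v_le[of 0] integral_vt_norm_le by (intro mult_left_mono add_mono) auto
  finally show ?thesis
    unfolding shell_wave_eq[OF R] norm_mult by (intro mult_mono) auto
qed

text \<open>The shell integrand with each cap wave replaced by its poles. The wave of the opposite
  pole multiplies v(z, 0) as well as the integral of the angular derivative, and the two add up to
  v(z, pi).\<close>

definition polar_part :: "real \<Rightarrow> real \<Rightarrow> complex" where
  "polar_part R z = of_real (indicator {-R..R} z * ((R + z) / R) powr m) *
     (cap_coeff p * cis (- ((R + z) * \<kappa>)) * v z 0 + cnj (cap_coeff p) * cis ((R + z) * \<kappa>) * v z pi)"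

text \<open>Expanding v(z, pi) as v(z, 0) plus the integral of \<open>vt\<close> sorts the
  difference into exactly the two expressions for which the cap waves have limits: the pole value at
  colatitude 0 and the integral against a continuous function of the colatitude.\<close>

lemma shell_integrand_minus_polar_part:
  "shell_integrand R z - polar_part R z = of_real (indicator {-R..R} z * ((R + z) / R) powr m) *
     ((scaled_cap (R + z) 0 - (cap_coeff p * cis (- ((R + z) * \<kappa>)) + cnj (cap_coeff p) * cis ((R + z) * \<kappa>))) * v z 0 +
      integral {0..pi} (\<lambda>t. vt z t * (scaled_cap (R + z) t - cnj (cap_coeff p) * cis ((R + z) * \<kappa>))))"
proof -
  have "(vt z has_integral (v z pi - v z 0)) {0..pi}"
    by (rule fundamental_theorem_of_calculus[OF pi_ge_zero deriv_v])
  hence v: "v z pi = v z 0 + integral {0..pi} (vt z)" by (simp add: integral_unique)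
  have "integral {0..pi} (\<lambda>t. vt z t * (scaled_cap (R + z) t - cnj (cap_coeff p) * cis ((R + z) * \<kappa>))) =
      integral {0..pi} (\<lambda>t. vt z t * scaled_cap (R + z) t) - integral {0..pi} (\<lambda>t. vt z t * (cnj (cap_coeff p) * cis ((R + z) * \<kappa>)))"
    unfolding right_diff_distrib scaled_cap_def
    by (intro Henstock_Kurzweil_Integration.integral_diff integrable_continuous_real continuous_intros cont_vt continuous_on_cap_wave)
  also have "integral {0..pi} (\<lambda>t. vt z t * (cnj (cap_coeff p) * cis ((R + z) * \<kappa>))) = integral {0..pi} (vt z) * (cnj (cap_coeff p) * cis ((R + z) * \<kappa>))"
    by (rule integral_mult_left)
  finally have i: "integral {0..pi} (\<lambda>t. vt z t * (scaled_cap (R + z) t - cnj (cap_coeff p) * cis ((R + z) * \<kappa>))) =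
      integral {0..pi} (\<lambda>t. vt z t * scaled_cap (R + z) t) - integral {0..pi} (vt z) * (cnj (cap_coeff p) * cis ((R + z) * \<kappa>))" .
  have "w * (e * v0 + I) - w * (a * v0 + b * (v0 + J)) = w * ((e - (a + b)) * v0 + (I - J * b))" for w e v0 I a b J :: complex
    by (simp add: algebra_simps)
  thus ?thesis unfolding shell_integrand_def polar_part_def v i .
qed

text \<open>For fixed z the argument (R + z) \<kappa> tends to infinity, so both limits for cap
  waves apply, and the weight is handled by its bound 2^m. The guard \<open>R > 0\<close> supplies
  the measurability that the dominated convergence rule demands for every R.\<close>

lemma tendsto_integral_shell_integrand_minus_polar_part:
  "((\<lambda>R. LINT z|lborel. (if R > 0 then shell_integrand R z - polar_part R z else 0)) \<longlongrightarrow> integral\<^sup>L lborel (\<lambda>z::real. 0 :: complex)) at_top"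
proof (rule integral_dominated_convergence_at_top[where w = "\<lambda>z. 2 powr m * C * (norm (v z 0) + vt_norm z) + 2 powr m * norm (cap_coeff p) * (norm (v z 0) + norm (v z pi))"])
  show "(\<lambda>z. if R > 0 then shell_integrand R z - polar_part R z else 0) \<in> borel_measurable lborel" for R
  proof (cases "R > 0")
    case True
    note [measurable] = measurable_shell_integrand[OF True]
    show ?thesis using True unfolding polar_part_def if_P[OF True] by measurable
  qed simp
  show "integrable lborel (\<lambda>z. 2 powr m * C * (norm (v z 0) + vt_norm z) + 2 powr m * norm (cap_coeff p) * (norm (v z 0) + norm (v z pi)))"
    using integrable_v integrable_vt_norm by simp
  have b: "norm (shell_integrand R z - polar_part R z) \<le> 2 powr m * C * (norm (v z 0) + vt_norm z) + 2 powr m * norm (cap_coeff p) * (norm (v z 0) + norm (v z pi))" if R: "R > 0" for R z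
  proof -
    have "norm (polar_part R z) \<le> 2 powr m * (norm (cap_coeff p) * (norm (v z 0) + norm (v z pi)))"
      unfolding polar_part_def norm_mult
    proof (rule mult_mono)
      show "norm (cap_coeff p * cis (- ((R + z) * \<kappa>)) * v z 0 + cnj (cap_coeff p) * cis ((R + z) * \<kappa>) * v z pi) \<le> norm (cap_coeff p) * (norm (v z 0) + norm (v z pi))"
        by (rule norm_triangle_le) (simp add: norm_mult distrib_left)
    qed (use weight_norm[OF R] in auto)
    thus ?thesis using shell_integrand_bound[OF R, of z] norm_triangle_ineq4[of "shell_integrand R z" "polar_part R z"] by (simp add: mult.assoc)
  qed
  show "\<forall>\<^sub>F R in at_top. AE z in lborel. norm (if R > 0 then shell_integrand R z - polar_part R z else 0) \<le> 2 powr m * C * (norm (v z 0) + vt_norm z) + 2 powr m * norm (cap_coeff p) * (norm (v z 0) + norm (v z pi))"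
    using eventually_gt_at_top[of 0] by eventually_elim (simp add: b)
  show "AE z in lborel. ((\<lambda>R. if R > 0 then shell_integrand R z - polar_part R z else 0) \<longlongrightarrow> 0) at_top"
  proof (intro always_eventually allI)
    fix z :: real
    define f where "f l = (of_real (l powr m) * cap_wave p l 0 - (cap_coeff p * cis (- l) + cnj (cap_coeff p) * cis l)) * v z 0
       + integral {0..pi} (\<lambda>t. vt z t * (of_real (l powr m) * cap_wave p l t - cnj (cap_coeff p) * cis l))" for l
    have "(f \<longlongrightarrow> 0 * v z 0 + 0) at_top"
      unfolding f_def m_def
      by (intro tendsto_intros tendsto_cap_wave_pole[OF p] tendsto_integral_cap_wave[OF p] cont_vt continuous_intros)
    hence f: "(f \<longlongrightarrow> 0) at_top" by simp
    have "filterlim (\<lambda>R. (R + z) * \<kappa>) at_top at_top"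
      using filterlim_at_top_mult_tendsto_pos[OF tendsto_const \<kappa> filterlim_tendsto_add_at_top[OF tendsto_const filterlim_ident, of z]]
      by (simp only: add.commute)
    hence "((\<lambda>R. f ((R + z) * \<kappa>)) \<longlongrightarrow> 0) at_top" by (rule filterlim_compose[OF f])
    hence "((\<lambda>R. 2 powr m * norm (f ((R + z) * \<kappa>))) \<longlongrightarrow> 2 powr m * 0) at_top"
      by (intro tendsto_mult tendsto_const tendsto_norm_zero)
    hence lim: "((\<lambda>R. 2 powr m * norm (f ((R + z) * \<kappa>))) \<longlongrightarrow> 0) at_top" by simp
    show "((\<lambda>R. if R > 0 then shell_integrand R z - polar_part R z else 0) \<longlongrightarrow> 0) at_top"
    proof (rule Lim_null_comparison[OF _ lim])
      show "\<forall>\<^sub>F R in at_top. norm (if R > 0 then shell_integrand R z - polar_part R z else 0) \<le> 2 powr m * norm (f ((R + z) * \<kappa>))"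
        using eventually_gt_at_top[of 0]
      proof eventually_elim
        case (elim R)
        have "norm (shell_integrand R z - polar_part R z) \<le> 2 powr m * norm (f ((R + z) * \<kappa>))"
          unfolding shell_integrand_minus_polar_part norm_mult
          by (intro mult_mono weight_norm[OF elim]) (auto simp: f_def scaled_cap_def)
        thus ?case using elim by simp
      qed
    qed
  qed
qed auto

text \<open>The phase at radius R + z factors into e^(-i R \<kappa>) e^(-i z \<kappa>) for the near
  pole and into the conjugate for the far one. The z-integrals are then weighted Fourier inversions,
  at \<kappa> along colatitude 0 and at -\<kappa> along colatitude \<open>pi\<close>.\<close>

lemma tendsto_shell_wave:
  "((\<lambda>R. shell_wave R - of_real (\<kappa> powr (- m)) * (2 * pi *
      (cap_coeff p * cis (- (R * \<kappa>)) * V \<kappa> 0 + cnj (cap_coeff p) * cis (R * \<kappa>) * V (- \<kappa>) pi))) \<longlongrightarrow> 0) at_top"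
proof -
  define X where "X t k R = (LINT z|lborel. of_real (indicator {-R..R} z * ((R + z) / R) powr m) * (v z t * cis (- (z * k))))" for t k R
  have X: "(X t k \<longlongrightarrow> 2 * pi * V k t) at_top" for t k
    unfolding X_def v_def
    by (rule fourier_inversion_weighted[OF N bounds(1,2) deriv(1) cont(3) supp(1) less_imp_le[OF m]])
  have iX: "integrable lborel (\<lambda>z. of_real (indicator {-R..R} z * ((R + z) / R) powr m) * (v z t * cis (- (z * k))))" if R: "R > 0" for R t k
  proof (rule Bochner_Integration.integrable_bound[where f = "\<lambda>z. 2 powr m * norm (v z t)"])
    show "integrable lborel (\<lambda>z. 2 powr m * norm (v z t))" using integrable_v by simp
    show "AE z in lborel. norm (of_real (indicator {-R..R} z * ((R + z) / R) powr m) * (v z t * cis (- (z * k)))) \<le> norm (2 powr m * norm (v z t))"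
      unfolding norm_mult by (intro always_eventually allI) (use weight_norm[OF R] in \<open>auto intro!: mult_mono\<close>)
    show "(\<lambda>z. of_real (indicator {-R..R} z * ((R + z) / R) powr m) * (v z t * cis (- (z * k)))) \<in> borel_measurable lborel"
      by measurable
  qed
  have polar_part: "(LINT z|lborel. polar_part R z) = cap_coeff p * cis (- (R * \<kappa>)) * X 0 \<kappa> R + cnj (cap_coeff p) * cis (R * \<kappa>) * X pi (- \<kappa>) R"
    and ipolar_part: "integrable lborel (polar_part R)" if R: "R > 0" for R
  proof -
    have eq: "polar_part R z = cap_coeff p * cis (- (R * \<kappa>)) * (of_real (indicator {-R..R} z * ((R + z) / R) powr m) * (v z 0 * cis (- (z * \<kappa>))))
       + cnj (cap_coeff p) * cis (R * \<kappa>) * (of_real (indicator {-R..R} z * ((R + z) / R) powr m) * (v z pi * cis (- (z * - \<kappa>))))" for z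
    proof -
      have "cis (- ((R + z) * \<kappa>)) = cis (- (R * \<kappa>)) * cis (- (z * \<kappa>))" "cis ((R + z) * \<kappa>) = cis (R * \<kappa>) * cis (- (z * - \<kappa>))"
        by (simp_all add: cis_mult algebra_simps)
      thus ?thesis unfolding polar_part_def by (simp only: algebra_simps)
    qed
    show "integrable lborel (polar_part R)" unfolding eq[abs_def] using iX[OF R] by (intro Bochner_Integration.integrable_add integrable_mult_right)
    show "(LINT z|lborel. polar_part R z) = cap_coeff p * cis (- (R * \<kappa>)) * X 0 \<kappa> R + cnj (cap_coeff p) * cis (R * \<kappa>) * X pi (- \<kappa>) R"
      unfolding eq X_def using iX[OF R]
      by (subst Bochner_Integration.integral_add) (auto simp only: integral_mult_right_zero intro!: integrable_mult_right)
  qed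
  define Z where "Z R = (LINT z|lborel. (if R > 0 then shell_integrand R z - polar_part R z else 0))" for R
  have Z: "(Z \<longlongrightarrow> 0) at_top" using tendsto_integral_shell_integrand_minus_polar_part by (simp add: Z_def[abs_def])
  \<comment> \<open>The phases in R have no limit, but they are unimodular: it is enough that each
    inversion integral approaches its value.\<close>
  have d: "((\<lambda>R. cis (f R) * (X t k R - 2 * pi * V k t)) \<longlongrightarrow> 0) at_top" for f t k
    by (rule tendsto_cis_mult_zero[OF LIM_zero[OF X]])
  have "((\<lambda>R. of_real (\<kappa> powr (- m)) * (Z R + (cap_coeff p * (cis (- (R * \<kappa>)) * (X 0 \<kappa> R - 2 * pi * V \<kappa> 0))
      + cnj (cap_coeff p) * (cis (R * \<kappa>) * (X pi (- \<kappa>) R - 2 * pi * V (- \<kappa>) pi))))) \<longlongrightarrow> of_real (\<kappa> powr (- m)) * (0 + (cap_coeff p * 0 + cnj (cap_coeff p) * 0))) at_top"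
    by (intro tendsto_mult tendsto_add tendsto_const Z d)
  hence "((\<lambda>R. of_real (\<kappa> powr (- m)) * (Z R + (cap_coeff p * (cis (- (R * \<kappa>)) * (X 0 \<kappa> R - 2 * pi * V \<kappa> 0))
      + cnj (cap_coeff p) * (cis (R * \<kappa>) * (X pi (- \<kappa>) R - 2 * pi * V (- \<kappa>) pi))))) \<longlongrightarrow> 0) at_top"
    by simp
  thus ?thesis
  proof (rule Lim_transform_eventually[OF _ eventually_mono[OF eventually_gt_at_top[of 0]]])
    fix R :: real assume R: "R > 0"
    have "Z R = (LINT z|lborel. shell_integrand R z) - (LINT z|lborel. polar_part R z)"
      unfolding Z_def using R integrable_shell_integrand[OF R] ipolar_part[OF R] by simp
    hence "(LINT z|lborel. shell_integrand R z) = Z R + (cap_coeff p * cis (- (R * \<kappa>)) * X 0 \<kappa> R + cnj (cap_coeff p) * cis (R * \<kappa>) * X pi (- \<kappa>) R)"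
      using polar_part[OF R] by simp
    thus "of_real (\<kappa> powr (- m)) * (Z R + (cap_coeff p * (cis (- (R * \<kappa>)) * (X 0 \<kappa> R - 2 * pi * V \<kappa> 0))
      + cnj (cap_coeff p) * (cis (R * \<kappa>) * (X pi (- \<kappa>) R - 2 * pi * V (- \<kappa>) pi)))) =
      shell_wave R - of_real (\<kappa> powr (- m)) * (2 * pi *
      (cap_coeff p * cis (- (R * \<kappa>)) * V \<kappa> 0 + cnj (cap_coeff p) * cis (R * \<kappa>) * V (- \<kappa>) pi))"
      unfolding shell_wave_eq[OF R] by (simp only: algebra_simps)
  qed
qed

end

section \<open>Smooth data with compact support\<close>

lemma smooth_imp_C2:
  assumes "smooth u"
  shows "\<And>x. u differentiable (at x)" "\<And>x. (\<lambda>x. frechet_derivative u (at x) b) differentiable (at x)"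
    "continuous_on UNIV (\<lambda>x. frechet_derivative (\<lambda>x. frechet_derivative u (at x) b) (at x) a)"
proof -
  have "Ck (Suc (Suc 0)) u" using assms by (simp only: smooth_def)
  thus "\<And>x. u differentiable (at x)" "\<And>x. (\<lambda>x. frechet_derivative u (at x) b) differentiable (at x)"
    "continuous_on UNIV (\<lambda>x. frechet_derivative (\<lambda>x. frechet_derivative u (at x) b) (at x) a)"
    by simp_all
qed

lemma differentiable_imp_continuous_on_UNIV:
  assumes "\<And>x. f differentiable (at x)"
  shows "continuous_on UNIV f"
  by (rule continuous_at_imp_continuous_on) (use assms differentiable_imp_continuous_within in blast)

lemma frechet_derivative_zero_outside:
  fixes f :: "'a::real_normed_vector \<Rightarrow> 'b::real_normed_vector"
  assumes "\<And>x. norm x > r \<Longrightarrow> f x = 0" "norm x > r"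
  shows "frechet_derivative f (at x) = (\<lambda>_. 0)"
proof -
  have "((\<lambda>_. 0) has_derivative (\<lambda>_. 0)) (at x)" by (rule has_derivative_const)
  moreover have "open {y :: 'a. norm y > r}" by (intro open_Collect_less continuous_intros)
  ultimately have "(f has_derivative (\<lambda>_. 0)) (at x)"
    by (rule has_derivative_transform_within_open) (use assms in auto)
  from frechet_derivative_at[OF this] show ?thesis by simp
qed

lemma bounded_support_bound:
  fixes f :: "'a::euclidean_space \<Rightarrow> 'b::real_normed_vector"
  assumes "continuous_on UNIV f" "\<And>x. norm x > r \<Longrightarrow> f x = 0"
  obtains K where "K \<ge> 0" "\<And>x. norm (f x) \<le> K"
proof -
  have "compact (f ` cball 0 r)"
    using assms(1) by (intro compact_continuous_image) (auto intro: continuous_on_subset)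
  then obtain K where K: "\<And>x. x \<in> cball 0 r \<Longrightarrow> norm (f x) \<le> K"
    by (metis bounded_iff compact_imp_bounded imageI)
  have "norm (f x) \<le> max K 0" for x
    using K[of x] assms(2)[of x] by (cases "norm x > r") (auto simp: le_max_iff_disj)
  thus ?thesis using that[of "max K 0"] by simp
qed

text \<open>Continuity of the derivatives is known for each fixed direction, while a bound for all
  unit directions is wanted. Expanding the directions in the basis reduces it to finitely many
  continuous functions of compact support; \<open>A\<close> and \<open>B\<close> add up their
  bounds.\<close>

lemma smooth_compact_bounds:
  fixes u :: "'a::euclidean_space \<Rightarrow> complex"
  assumes u: "smooth u" and supp: "\<And>x. norm x > r \<Longrightarrow> u x = 0"
  obtains K where "K \<ge> 0" "\<And>x. norm (u x) \<le> K"
    "\<And>x b. norm b \<le> 1 \<Longrightarrow> norm (frechet_derivative u (at x) b) \<le> K"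
    "\<And>x a b. norm a \<le> 1 \<Longrightarrow> norm b \<le> 1 \<Longrightarrow> norm (frechet_derivative (\<lambda>x. frechet_derivative u (at x) b) (at x) a) \<le> K"
proof -
  note C2 = smooth_imp_C2[OF u]
  define D where "D b x = frechet_derivative u (at x) b" for b x
  define D2 where "D2 b a x = frechet_derivative (D b) (at x) a" for a b x
  have D2_eq: "D2 b a x = frechet_derivative (\<lambda>x. frechet_derivative u (at x) b) (at x) a" for a b x
    by (simp add: D2_def D_def[abs_def])
  have diffD: "D b differentiable (at x)" for b x using C2(2) by (simp add: D_def[abs_def])
  have D0: "D b x = 0" if "norm x > r" for b x
    unfolding D_def by (simp add: frechet_derivative_zero_outside[of _ u, OF supp that])
  have D20: "D2 b a x = 0" if "norm x > r" for b a x
    unfolding D2_def by (simp add: frechet_derivative_zero_outside[of _ "D b", OF D0 that])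
  have linD: "linear (\<lambda>b. D b x)" for x
    unfolding D_def by (rule linear_frechet_derivative[OF C2(1)])
  have linD2: "linear (\<lambda>a. D2 b a x)" for b x
    unfolding D2_def by (rule linear_frechet_derivative[OF diffD])
  have D_sum: "D b x = (\<Sum>i\<in>Basis. (b \<bullet> i) *\<^sub>R D i x)" for b x
  proof -
    have "D b x = D (\<Sum>i\<in>Basis. (b \<bullet> i) *\<^sub>R i) x" by (simp only: euclidean_representation)
    thus ?thesis by (simp only: linear_sum[OF linD] linear_scale[OF linD])
  qed
  have D2_sum2: "D2 b a x = (\<Sum>j\<in>Basis. (a \<bullet> j) *\<^sub>R D2 b j x)" for b a x
  proof -
    have "D2 b a x = D2 b (\<Sum>j\<in>Basis. (a \<bullet> j) *\<^sub>R j) x" by (simp only: euclidean_representation)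
    thus ?thesis by (simp only: linear_sum[OF linD2] linear_scale[OF linD2])
  qed
  \<comment> \<open>The direction b of the inner derivative is not the argument of a derivative at a
    point, so its linearity comes from differentiating the expansion of \<open>D b\<close> and
    uniqueness of the derivative.\<close>
  have D2_sum1: "D2 b a x = (\<Sum>i\<in>Basis. (b \<bullet> i) *\<^sub>R D2 i a x)" for b a x
  proof -
    have "(D b has_derivative (\<lambda>a. \<Sum>i\<in>Basis. (b \<bullet> i) *\<^sub>R D2 i a x)) (at x)"
      unfolding D_sum[of b, abs_def] D2_def
      by (intro has_derivative_sum has_derivative_scaleR_right) (rule frechet_derivative_works[THEN iffD1, OF diffD])
    from frechet_derivative_at[OF this] show ?thesis unfolding D2_def by (metis)
  qed
  obtain K0 where K0: "K0 \<ge> 0" "\<And>x. norm (u x) \<le> K0"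
    using bounded_support_bound[OF differentiable_imp_continuous_on_UNIV[OF C2(1)] supp] by metis
  have "\<exists>K. K \<ge> 0 \<and> (\<forall>x. norm (D b x) \<le> K)" for b
    using bounded_support_bound[OF differentiable_imp_continuous_on_UNIV[OF diffD] D0] by metis
  then obtain K1 where K1: "\<And>b. K1 b \<ge> 0" "\<And>b x. norm (D b x) \<le> K1 b" by metis
  have "\<exists>K. K \<ge> 0 \<and> (\<forall>x. norm (D2 b a x) \<le> K)" for b a
  proof -
    have "continuous_on UNIV (D2 b a)" using C2(3)[of b a] by (simp add: D2_eq[abs_def])
    then obtain K where "K \<ge> 0" "\<And>x. norm (D2 b a x) \<le> K"
      using bounded_support_bound[of "D2 b a" r] D20 by blast
    thus ?thesis by blast
  qed
  then obtain K2 where K2: "\<And>b a. K2 b a \<ge> 0" "\<And>b a x. norm (D2 b a x) \<le> K2 b a" by metis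
  have ab: "\<bar>b \<bullet> i\<bar> \<le> 1" if "norm b \<le> 1" "i \<in> Basis" for b i :: 'a
    using that Basis_le_norm[of i b] by linarith
  define A where "A = (\<Sum>i\<in>Basis. K1 i)"
  define B where "B = (\<Sum>i\<in>Basis. \<Sum>j\<in>Basis. K2 i j)"
  have A: "norm (D b x) \<le> A" if b: "norm b \<le> 1" for b x
  proof -
    have "norm (D b x) \<le> (\<Sum>i\<in>Basis. norm ((b \<bullet> i) *\<^sub>R D i x))" by (subst D_sum) (rule norm_sum)
    also have "\<dots> \<le> A" unfolding A_def
    proof (rule sum_mono)
      fix i :: 'a assume "i \<in> Basis"
      thus "norm ((b \<bullet> i) *\<^sub>R D i x) \<le> K1 i"
        using mult_mono[OF ab[OF b] K1(2)[of i x]] by simp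
    qed
    finally show ?thesis .
  qed
  have B: "norm (D2 b a x) \<le> B" if b: "norm b \<le> 1" and a: "norm a \<le> 1" for b a x
  proof -
    have "norm (D2 b a x) \<le> (\<Sum>i\<in>Basis. norm ((b \<bullet> i) *\<^sub>R D2 i a x))" by (subst D2_sum1) (rule norm_sum)
    also have "\<dots> \<le> B" unfolding B_def
    proof (rule sum_mono)
      fix i :: 'a assume i: "i \<in> Basis"
      have "norm (D2 i a x) \<le> (\<Sum>j\<in>Basis. norm ((a \<bullet> j) *\<^sub>R D2 i j x))" by (subst D2_sum2) (rule norm_sum)
      also have "\<dots> \<le> (\<Sum>j\<in>Basis. K2 i j)"
      proof (rule sum_mono)
        fix j :: 'a assume "j \<in> Basis"
        thus "norm ((a \<bullet> j) *\<^sub>R D2 i j x) \<le> K2 i j"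
          using mult_mono[OF ab[OF a] K2(2)[of i j x]] by simp
      qed
      finally show "norm ((b \<bullet> i) *\<^sub>R D2 i a x) \<le> (\<Sum>j\<in>Basis. K2 i j)"
        using mult_mono[OF ab[OF b i], of "norm (D2 i a x)"] by simp
    qed
    finally show ?thesis .
  qed
  have AB: "A \<ge> 0" "B \<ge> 0" unfolding A_def B_def using K1 K2 by (auto intro!: sum_nonneg)
  show ?thesis
  proof (rule that[of "K0 + A + B"])
    show "norm (u x) \<le> K0 + A + B" for x using K0(2)[of x] AB by linarith
    show "norm (frechet_derivative u (at x) b) \<le> K0 + A + B" if "norm b \<le> 1" for x b
      using A[OF that, of x] AB K0(1) unfolding D_def by linarith
    show "norm (frechet_derivative (\<lambda>x. frechet_derivative u (at x) b) (at x) a) \<le> K0 + A + B" if "norm a \<le> 1" "norm b \<le> 1" for x a b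
      using B[OF that(2,1), of x] AB K0(1) unfolding D2_eq by linarith
  qed (use K0 AB in auto)
qed

lemma compactly_supported_bound:
  assumes "compactly_supported u"
  obtains N where "N > 0" "\<And>x. norm x \<ge> N \<Longrightarrow> u x = 0"
proof -
  have "bounded {x. u x \<noteq> 0}"
    using assms unfolding compactly_supported_def by (meson bounded_subset closure_subset compact_imp_bounded)
  then obtain r where r: "\<And>x. u x \<noteq> 0 \<Longrightarrow> norm x \<le> r" unfolding bounded_iff by auto
  show ?thesis
  proof (rule that[of "\<bar>r\<bar> + 1"])
    show "u x = 0" if "norm x \<ge> \<bar>r\<bar> + 1" for x using r[of x] that by fastforce
  qed simp
qed

lemma has_vector_derivative_compose_curve:
  assumes "(g has_vector_derivative g') (at t)" "(f has_derivative F) (at (g t))"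
  shows "((\<lambda>t. f (g t)) has_vector_derivative F g') (at t)"
  using vector_derivative_diff_chain_within[OF assms(1) has_derivative_at_withinI[OF assms(2)]] by (simp add: o_def)

text \<open>\<open>N\<close>, \<open>M\<close> and \<open>C\<close> are chosen before
  \<open>e\<close>, because the bounds have to be uniform in the azimuth. As \<open>w\<close> is of
  class C^1, the second derivative is taken as one in t, which falls on \<open>u\<close> alone, and
  one in x.\<close>

lemma half_circle_profile_exists:
  fixes u :: "'a::euclidean_space \<Rightarrow> complex" and h :: 'a and c0 :: complex
  assumes u: "smooth u" "compactly_supported u" and w: "Ck 1 w" and h: "norm h = 1" and p: "p \<in> {0, 1}" and \<kappa>: "\<kappa> > 0"
  obtains N M C where "N > 0" "\<And>x. norm x \<ge> N \<Longrightarrow> u x = 0"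
    "\<And>e. norm e = 1 \<Longrightarrow> h \<bullet> e = 0 \<Longrightarrow> \<exists>Vx Vt Vtx.
       half_circle_profile (\<lambda>x t. c0 * of_real (w x) * u (x *\<^sub>R (cos t *\<^sub>R h + sin t *\<^sub>R e))) Vx Vt Vtx N M C p \<kappa>"
proof -
  note C2 = smooth_imp_C2[OF u(1)]
  obtain r where r: "\<And>x. norm x \<ge> r \<Longrightarrow> u x = 0"
    by (rule compactly_supported_bound[OF u(2)]) (rule that)
  \<comment> \<open>The margin 1 makes every point of norm at least \<open>N\<close> satisfy norm >
    |r|; on that open set \<open>u\<close> and all its derivatives vanish.\<close>
  define N where "N = \<bar>r\<bar> + 1"
  have N: "N > 0" "N \<ge> 1" "\<And>x :: 'a. norm x \<ge> N \<Longrightarrow> norm x > \<bar>r\<bar>" by (auto simp: N_def)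
  have supp: "u x = 0" if "norm x > \<bar>r\<bar>" for x using that by (intro r) linarith
  define D where "D b x = frechet_derivative u (at x) b" for b x
  define D2 where "D2 b a x = frechet_derivative (D b) (at x) a" for a b x
  have D2_eq: "D2 b a x = frechet_derivative (\<lambda>x. frechet_derivative u (at x) b) (at x) a" for a b x
    by (simp add: D2_def D_def[abs_def])
  have diffD: "D b differentiable (at x)" for b x using C2(2) by (simp add: D_def[abs_def])
  have D0: "D b x = 0" if "norm x > \<bar>r\<bar>" for b x
    unfolding D_def by (simp add: frechet_derivative_zero_outside[of _ u, OF supp that])
  have D20: "D2 b a x = 0" if "norm x > \<bar>r\<bar>" for b a x
    unfolding D2_def by (simp add: frechet_derivative_zero_outside[of _ "D b", OF D0 that])
  have linD: "linear (\<lambda>b. D b x)" for x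
    unfolding D_def by (rule linear_frechet_derivative[OF C2(1)])
  have linD2: "linear (\<lambda>a. D2 b a x)" for b x
    unfolding D2_def by (rule linear_frechet_derivative[OF diffD])
  have du: "(u has_derivative (\<lambda>b. D b x)) (at x)" for x
    unfolding D_def using frechet_derivative_works[THEN iffD1, OF C2(1)] by simp
  have dD: "(D b has_derivative (\<lambda>a. D2 b a x)) (at x)" for b x
    unfolding D2_def using frechet_derivative_works[THEN iffD1, OF diffD] by simp
  have cu: "continuous_on A (\<lambda>y. u (f y))" if "continuous_on A f" for A and f :: "'b::topological_space \<Rightarrow> 'a"
    by (rule continuous_on_compose2[OF differentiable_imp_continuous_on_UNIV[OF C2(1)] that]) auto
  have cD: "continuous_on A (\<lambda>y. D b (f y))" if "continuous_on A f" for A b and f :: "'b::topological_space \<Rightarrow> 'a"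
    by (rule continuous_on_compose2[OF differentiable_imp_continuous_on_UNIV[OF diffD] that]) auto
  have cD2: "continuous_on A (\<lambda>y. D2 b a (f y))" if "continuous_on A f" for A b a and f :: "'b::topological_space \<Rightarrow> 'a"
    by (rule continuous_on_compose2[OF _ that]) (use C2(3)[of b a] in \<open>auto simp: D2_eq\<close>)
  obtain K where K: "K \<ge> 0" "\<And>x. norm (u x) \<le> K" "\<And>x b. norm b \<le> 1 \<Longrightarrow> norm (D b x) \<le> K"
    "\<And>x a b. norm a \<le> 1 \<Longrightarrow> norm b \<le> 1 \<Longrightarrow> norm (D2 b a x) \<le> K"
    using smooth_compact_bounds[OF u(1), of "\<bar>r\<bar>"] supp unfolding D2_eq D_def by blast
  define w' where "w' x = frechet_derivative w (at x) 1" for x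
  have Ckw: "\<And>x. w differentiable (at x)" "continuous_on UNIV w'" using w by (simp_all add: w'_def[abs_def])
  have dw: "(w has_real_derivative w' x) (at x)" for x
  proof -
    have "w differentiable (at x)" by (rule Ckw(1))
    from frechet_derivative_works[THEN iffD1, OF this] linear_frechet_derivative[OF this]
    have "(w has_derivative (\<lambda>y. w' x * y)) (at x)"
      unfolding w'_def by (metis (no_types, lifting) ext linear_scale mult.commute mult.right_neutral real_scaleR_def)
    thus ?thesis by (simp add: has_field_derivative_def)
  qed
  have cw: "continuous_on A (\<lambda>y. w (f y))" "continuous_on A (\<lambda>y. w' (f y))" if "continuous_on A f" for A and f :: "'b::topological_space \<Rightarrow> real"
    using continuous_on_compose2[OF differentiable_imp_continuous_on_UNIV[OF Ckw(1)] that]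
      continuous_on_compose2[OF Ckw(2) that] by auto
  \<comment> \<open>The function \<open>w\<close> may grow at infinity, so it is bounded on [-N, N],
    and outside that interval all profiles vanish with \<open>u\<close>.\<close>
  obtain Kw where Kw: "Kw \<ge> 0" "\<And>x. x \<in> {-N..N} \<Longrightarrow> \<bar>w x\<bar> \<le> Kw" "\<And>x. x \<in> {-N..N} \<Longrightarrow> \<bar>w' x\<bar> \<le> Kw"
  proof -
    have "bounded (w ` {-N..N})" "bounded (w' ` {-N..N})"
      by (intro compact_imp_bounded compact_continuous_image compact_Icc cw continuous_intros)+
    then obtain a b where "\<And>x. x \<in> {-N..N} \<Longrightarrow> \<bar>w x\<bar> \<le> a" "\<And>x. x \<in> {-N..N} \<Longrightarrow> \<bar>w' x\<bar> \<le> b"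
      unfolding bounded_iff by (metis imageI real_norm_def)
    thus ?thesis using that[of "max 0 (max a b)"] by (simp add: le_max_iff_disj)
  qed
  obtain C where C: "\<And>l \<theta>. l > 0 \<Longrightarrow> \<theta> \<in> {0..pi} \<Longrightarrow> norm (of_real (l powr ((real p + 1) / 2)) * cap_wave p l \<theta>) \<le> C"
    using cap_wave_bounded[OF p] by blast
  \<comment> \<open>One bound for all four functions. The largest estimate, that for
    \<open>Vtx\<close>, is (3 N + 1) Kw K without the factor |c0|; 4 N + 4 is a convenient excess
    that covers the others too.\<close>
  define M where "M = norm c0 * (Kw * (4 * N + 4) * K)"
  show ?thesis
  proof (rule that[of N M C])
    show "N > 0" by (rule N)
    show "u x = 0" if "norm x \<ge> N" for x using supp N(3)[OF that] .
    fix e :: 'a assume e: "norm e = 1" "h \<bullet> e = 0"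
    define q where "q t = cos t *\<^sub>R h + sin t *\<^sub>R e" for t
    define q' where "q' t = (- sin t) *\<^sub>R h + cos t *\<^sub>R e" for t
    have hh: "h \<bullet> h = 1" "e \<bullet> e = 1" "e \<bullet> h = 0" using h e by (simp_all add: norm_eq_1 inner_commute)
    have nq: "norm (q t) = 1" "norm (q' t) = 1" for t
      unfolding norm_eq_1 q_def q'_def by (simp_all add: inner_add inner_diff hh e(2) flip: power2_eq_square)
    have Dq: "D (q t) x = of_real (cos t) * D h x + of_real (sin t) * D e x" "D (q' t) x = of_real (- sin t) * D h x + of_real (cos t) * D e x" for t x
      unfolding q_def q'_def linear_add[OF linD] linear_scale[OF linD] by (simp_all only: scaleR_conv_of_real)
    have D2q: "D2 b (q t) x = of_real (cos t) * D2 b h x + of_real (sin t) * D2 b e x" for b t x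
      unfolding q_def linear_add[OF linD2] linear_scale[OF linD2] by (simp only: scaleR_conv_of_real)
    have cq: "continuous_on A (\<lambda>y. q (f y))" if "continuous_on A f" for A and f :: "'b::t2_space \<Rightarrow> real"
      unfolding q_def using that by (intro continuous_intros)
    define V where "V x t = c0 * of_real (w x) * u (x *\<^sub>R q t)" for x t
    define Vx where "Vx x t = c0 * (of_real (w x) * D (q t) (x *\<^sub>R q t) + of_real (w' x) * u (x *\<^sub>R q t))" for x t
    define Vt where "Vt x t = c0 * (of_real (w x * x) * D (q' t) (x *\<^sub>R q t))" for x t
    \<comment> \<open>Along the ray \<open>q' t\<close> is constant, and linearity splits D (q' t)
      into multiples of D h and D e, which are then differentiated in the direction
      \<open>q t\<close>. The factor \<open>w' x * x + w x\<close> is the derivative of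
      \<open>w x * x\<close>, whose \<open>x\<close> comes from the chain rule in t.\<close>
    define Vtx where "Vtx x t = c0 * (of_real (w x * x) * (of_real (- sin t) * D2 h (q t) (x *\<^sub>R q t) + of_real (cos t) * D2 e (q t) (x *\<^sub>R q t))
       + of_real (w' x * x + w x) * D (q' t) (x *\<^sub>R q t))" for x t
    have zero: "u (x *\<^sub>R q t) = 0" "D b (x *\<^sub>R q t) = 0" "D2 b a (x *\<^sub>R q t) = 0" if "x \<notin> {-N<..<N}" for x t a b
    proof -
      have "norm (x *\<^sub>R q t) > \<bar>r\<bar>" using that nq by (intro N(3)) auto
      thus "u (x *\<^sub>R q t) = 0" "D b (x *\<^sub>R q t) = 0" "D2 b a (x *\<^sub>R q t) = 0" by (auto simp: supp D0 D20)
    qed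
    have scal: "((\<lambda>x. x *\<^sub>R q t) has_vector_derivative q t) (at x)" for x t
      by (auto intro!: derivative_eq_intros simp: has_vector_derivative_def)
    have bound: "norm (V x t) \<le> M \<and> norm (Vx x t) \<le> M \<and> norm (Vt x t) \<le> M \<and> norm (Vtx x t) \<le> M" for x t
    proof (cases "x \<in> {-N<..<N}")
      case False
      thus ?thesis using N Kw K by (simp add: V_def Vx_def Vt_def Vtx_def zero M_def)
    next
      case True
      hence x: "x \<in> {-N..N}" "\<bar>x\<bar> \<le> N" by auto
      let ?y = "x *\<^sub>R q t"
      have ww: "\<bar>w x\<bar> \<le> Kw" "\<bar>w' x\<bar> \<le> Kw" using Kw x by auto
      have wx: "\<bar>w x * x\<bar> \<le> Kw * N" "\<bar>w' x * x\<bar> \<le> Kw * N"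
        unfolding abs_mult using ww x Kw(1) by (auto intro!: mult_mono)
      have s: "\<bar>w' x * x + w x\<bar> \<le> Kw * N + Kw" using wx ww by linarith
      have prod: "norm (of_real a * z :: complex) \<le> A * B" if "\<bar>a\<bar> \<le> A" "norm z \<le> B" for a A B z
        unfolding norm_mult norm_of_real using that order_trans[OF abs_ge_zero that(1)] by (intro mult_mono) auto
      have b1: "norm (u ?y) \<le> K" by (rule K)
      have b2: "norm (D (q t) ?y) \<le> K" "norm (D (q' t) ?y) \<le> K" using K(3) nq by auto
      have b3: "norm (of_real (- sin t) * D2 h (q t) ?y + of_real (cos t) * D2 e (q t) ?y) \<le> 1 * K + 1 * K"
        by (intro norm_triangle_mono) (use prod[of "- sin t" 1 "D2 h (q t) ?y" K] prod[of "cos t" 1 "D2 e (q t) ?y" K] K(4) nq h e in auto)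
      have n1: "norm (of_real (w x) * u ?y) \<le> Kw * K" by (rule prod[OF ww(1) b1])
      have n2: "norm (of_real (w x) * D (q t) ?y + of_real (w' x) * u ?y) \<le> Kw * K + Kw * K"
        by (intro norm_triangle_mono prod ww b1 b2)
      have n3: "norm (of_real (w x * x) * D (q' t) ?y) \<le> Kw * N * K" by (rule prod[OF wx(1) b2(2)])
      have n4: "norm (of_real (w x * x) * (of_real (- sin t) * D2 h (q t) ?y + of_real (cos t) * D2 e (q t) ?y) + of_real (w' x * x + w x) * D (q' t) ?y)
          \<le> Kw * N * (1 * K + 1 * K) + (Kw * N + Kw) * K"
        by (intro norm_triangle_mono prod wx b3 b2 s)
      have nn: "0 \<le> Kw * K" "0 \<le> Kw * N * K" using Kw K N by auto
      have "Kw * (4 * N + 4) * K = 4 * (Kw * N * K) + 4 * (Kw * K)" by (simp add: algebra_simps)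
      with nn have le: "Kw * K \<le> Kw * (4 * N + 4) * K" "Kw * K + Kw * K \<le> Kw * (4 * N + 4) * K" "Kw * N * K \<le> Kw * (4 * N + 4) * K"
        "Kw * N * (1 * K + 1 * K) + (Kw * N + Kw) * K \<le> Kw * (4 * N + 4) * K"
        by (auto simp: algebra_simps)
      have c: "norm (c0 * z) \<le> M" if "norm z \<le> Kw * (4 * N + 4) * K" for z
        unfolding norm_mult M_def using that by (intro mult_left_mono) auto
      show ?thesis
        unfolding V_def Vx_def Vt_def Vtx_def mult.assoc[of c0]
        using c[OF order_trans[OF n1 le(1)]] c[OF order_trans[OF n2 le(2)]] c[OF order_trans[OF n3 le(3)]] c[OF order_trans[OF n4 le(4)]] by blast
    qed
    have "half_circle_profile V Vx Vt Vtx N M C p \<kappa>"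
    proof
      show "N > 0" "p \<in> {0, 1}" "\<kappa> > 0" by (fact N p \<kappa>)+
      show "norm (of_real (l powr ((real p + 1) / 2)) * cap_wave p l \<theta>) \<le> C" if "l > 0" "\<theta> \<in> {0..pi}" for l \<theta>
        by (rule C[OF that])
      show "norm (V x t) \<le> M" "norm (Vx x t) \<le> M" "norm (Vt x t) \<le> M" "norm (Vtx x t) \<le> M" for x t
        using bound by auto
      show "continuous_on UNIV (\<lambda>(x, t). V x t)" "continuous_on UNIV (\<lambda>(x, t). Vt x t)"
        unfolding V_def Vt_def Dq case_prod_unfold by (intro continuous_intros cu cD cw cq)+
      show "continuous_on UNIV (\<lambda>x. Vx x t)" "continuous_on UNIV (\<lambda>x. Vtx x t)" for t
        unfolding Vx_def Vtx_def Dq D2q by (intro continuous_intros cu cD cD2 cw cq)+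
      show "V x t = 0" "Vt x t = 0" if "x \<notin> {-N<..<N}" for x t
        using zero[OF that] by (simp_all add: V_def Vt_def)
      have dw': "((\<lambda>x. complex_of_real (w x)) has_vector_derivative of_real (w' x)) (at x)" for x
        by (rule has_vector_derivative_of_real) (simp only: dw has_real_derivative_iff_has_vector_derivative[symmetric])
      have dwx: "((\<lambda>x. complex_of_real (w x * x)) has_vector_derivative of_real (w' x * x + w x)) (at x)" for x
      proof (rule has_vector_derivative_of_real)
        show "((\<lambda>x. w x * x) has_real_derivative w' x * x + w x) (at x)"
          using DERIV_mult[OF dw DERIV_ident] by simp
      qed
      show "((\<lambda>x. V x t) has_vector_derivative Vx x t) (at x)" for x t
        unfolding V_def Vx_def mult.assoc
        by (intro has_vector_derivative_mult_right has_vector_derivative_mult dw' has_vector_derivative_compose_curve[OF scal du])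
      show "((\<lambda>x. Vt x t) has_vector_derivative Vtx x t) (at x)" for x t
      proof -
        have "((\<lambda>x. D (q' t) (x *\<^sub>R q t)) has_vector_derivative of_real (- sin t) * D2 h (q t) (x *\<^sub>R q t) + of_real (cos t) * D2 e (q t) (x *\<^sub>R q t)) (at x)"
          unfolding Dq
          by (intro has_vector_derivative_add has_vector_derivative_mult_right has_vector_derivative_compose_curve[OF scal dD])
        from has_vector_derivative_mult_right[OF has_vector_derivative_mult[OF dwx this], of c0]
        show ?thesis unfolding Vt_def Vtx_def .
      qed
      show "((\<lambda>t. V x t) has_vector_derivative Vt x t) (at t)" for x t
      proof -
        have "((\<lambda>t. x *\<^sub>R q t) has_vector_derivative x *\<^sub>R q' t) (at t)"
          unfolding q_def q'_def
          by (intro bounded_linear.has_vector_derivative[OF bounded_linear_scaleR_right] has_vector_derivative_add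
              bounded_linear.has_vector_derivative[OF bounded_linear_scaleR_left])
            (simp_all only: DERIV_cos DERIV_sin has_real_derivative_iff_has_vector_derivative[symmetric])
        from has_vector_derivative_mult_right[OF has_vector_derivative_compose_curve[OF this du], of "c0 * of_real (w x)"]
        have "((\<lambda>t. V x t) has_vector_derivative c0 * of_real (w x) * D (x *\<^sub>R q' t) (x *\<^sub>R q t)) (at t)"
          unfolding V_def .
        moreover have "c0 * of_real (w x) * D (x *\<^sub>R q' t) (x *\<^sub>R q t) = Vt x t"
          unfolding linear_scale[OF linD] Vt_def by (simp add: scaleR_conv_of_real)
        ultimately show ?thesis by simp
      qed
    qed
    thus "\<exists>Vx Vt Vtx. half_circle_profile (\<lambda>x t. c0 * of_real (w x) * u (x *\<^sub>R (cos t *\<^sub>R h + sin t *\<^sub>R e))) Vx Vt Vtx N M C p \<kappa>"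
      unfolding V_def[abs_def] q_def by blast
  qed
qed

section \<open>The reconstruction in dimensions two and three\<close>

text \<open>The polar formula is given for nonnegative functions and is carried over to complex ones
  by reading it as an equality of measures. The bound is asked for at x \<noteq> 0, where x / |x| is
  a unit vector. The radius ends up outside the colatitude, as in \<open>shell_wave\<close>;
  measurability in w prepares dominated convergence over the azimuth.\<close>

lemma axial_polar_integral:
  fixes f :: "'a::euclidean_space \<Rightarrow> complex"
  assumes P: "axial_polar p \<mu> e h" and h: "norm h = 1" and f [measurable]: "f \<in> borel_measurable borel"
    and B: "\<And>x. x \<noteq> 0 \<Longrightarrow> norm (f x) \<le> B" and supp: "\<And>x. norm x > \<rho> \<Longrightarrow> f x = 0"
  defines "F w \<theta> r \<equiv> of_real (indicator {0<..<pi} \<theta> * indicator {0<..} r * (r ^ (p + 1) * sin \<theta> ^ p)) * f (r *\<^sub>R (cos \<theta> *\<^sub>R h + sin \<theta> *\<^sub>R e w))"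
  shows "(LINT x|lborel. f x) = (LINT w|\<mu>. LINT r|lborel. LINT \<theta>|lborel. F w \<theta> r)"
    and "(\<lambda>w. LINT r|lborel. LINT \<theta>|lborel. F w \<theta> r) \<in> borel_measurable \<mu>"
proof -
  interpret \<mu>: finite_measure \<mu> using P by (simp add: axial_polar_def)
  have S2: "sigma_finite_measure (lborel \<Otimes>\<^sub>M lborel :: (real \<times> real) measure)"
    unfolding lborel_prod by (rule sigma_finite_lborel)
  interpret PP: pair_sigma_finite \<mu> "lborel \<Otimes>\<^sub>M lborel :: (real \<times> real) measure"
    unfolding lborel_prod ..
  have e [measurable]: "e \<in> borel_measurable \<mu>" and eq: "\<And>w. norm (e w) = 1" "\<And>w. h \<bullet> e w = 0"
    using P by (auto simp: axial_polar_def)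
  define wt where "wt \<theta> r = indicator {0<..<pi} \<theta> * indicator {0<..} r * (r ^ (p + 1) * sin \<theta> ^ p)" for \<theta> r :: real
  define T where "T = (\<lambda>(w, \<theta>, r). r *\<^sub>R (cos \<theta> *\<^sub>R h + sin \<theta> *\<^sub>R e w))"
  define M where "M = \<mu> \<Otimes>\<^sub>M (lborel \<Otimes>\<^sub>M lborel :: (real \<times> real) measure)"
  have wt_nn: "wt \<theta> r \<ge> 0" for \<theta> r
    by (auto simp: wt_def split: split_indicator intro!: mult_nonneg_nonneg zero_le_power sin_ge_zero)
  have [measurable]: "T \<in> borel_measurable M" unfolding T_def M_def by measurable
  have [measurable]: "(\<lambda>(\<theta>, r). wt \<theta> r) \<in> borel_measurable (borel \<Otimes>\<^sub>M borel)" unfolding wt_def by measurable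
  have wtM [measurable]: "(\<lambda>(w, \<theta>, r). wt \<theta> r) \<in> borel_measurable M" unfolding M_def by measurable
  \<comment> \<open>Testing the polar formula on indicator functions shows that
    \<open>lborel\<close> is the image of the weighted product measure.\<close>
  have polar: "(lborel :: 'a measure) = distr (density M (\<lambda>(w, \<theta>, r). ennreal (wt \<theta> r))) borel T"
  proof (rule measure_eqI)
    fix A :: "'a set" assume "A \<in> sets lborel"
    hence [measurable]: "A \<in> sets borel" by simp
    have m1: "(\<lambda>(w, \<theta>, r). ennreal (wt \<theta> r)) \<in> borel_measurable M" unfolding M_def by measurable
    have m2: "(\<lambda>y. indicator A (T y) :: ennreal) \<in> borel_measurable M"
      by (rule measurable_compose[OF \<open>T \<in> borel_measurable M\<close>]) simp
    have "emeasure (distr (density M (\<lambda>(w, \<theta>, r). ennreal (wt \<theta> r))) borel T) A =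
        (\<integral>\<^sup>+x. indicator A x \<partial>distr (density M (\<lambda>(w, \<theta>, r). ennreal (wt \<theta> r))) borel T)"
      by simp
    also have "\<dots> = (\<integral>\<^sup>+y. indicator A (T y) \<partial>density M (\<lambda>(w, \<theta>, r). ennreal (wt \<theta> r)))"
      by (rule nn_integral_distr) simp_all
    also have "\<dots> = (\<integral>\<^sup>+y. (case y of (w, \<theta>, r) \<Rightarrow> ennreal (wt \<theta> r)) * indicator A (T y) \<partial>M)"
      by (rule nn_integral_density[OF m1 m2])
    also have "\<dots> = (\<integral>\<^sup>+w. (\<integral>\<^sup>+z. (case z of (\<theta>, r) \<Rightarrow> ennreal (wt \<theta> r) * indicator A (T (w, \<theta>, r))) \<partial>(lborel \<Otimes>\<^sub>M lborel)) \<partial>\<mu>)"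
      using sigma_finite_measure.nn_integral_fst[OF S2 borel_measurable_times_ennreal[OF m1 m2, unfolded M_def]]
      by (simp add: case_prod_unfold M_def)
    also have "\<dots> = (\<integral>\<^sup>+w. (\<integral>\<^sup>+\<theta>. (\<integral>\<^sup>+r. ennreal (wt \<theta> r) * indicator A (r *\<^sub>R (cos \<theta> *\<^sub>R h + sin \<theta> *\<^sub>R e w)) \<partial>lborel) \<partial>lborel) \<partial>\<mu>)"
    proof (rule nn_integral_cong)
      fix w
      have "(\<lambda>(\<theta>, r). ennreal (wt \<theta> r) * indicator A (r *\<^sub>R (cos \<theta> *\<^sub>R h + sin \<theta> *\<^sub>R e w))) \<in> borel_measurable (lborel \<Otimes>\<^sub>M lborel)"
        by measurable
      from lborel.nn_integral_fst[OF this]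
      show "(\<integral>\<^sup>+z. (case z of (\<theta>, r) \<Rightarrow> ennreal (wt \<theta> r) * indicator A (T (w, \<theta>, r))) \<partial>(lborel \<Otimes>\<^sub>M lborel)) =
        (\<integral>\<^sup>+\<theta>. (\<integral>\<^sup>+r. ennreal (wt \<theta> r) * indicator A (r *\<^sub>R (cos \<theta> *\<^sub>R h + sin \<theta> *\<^sub>R e w)) \<partial>lborel) \<partial>lborel)"
        by (simp add: T_def)
    qed
    also have "\<dots> = (\<integral>\<^sup>+x. indicator A x \<partial>lborel)"
      using P unfolding axial_polar_def wt_def by (auto dest: bspec[of _ _ "indicator A"])
    finally show "emeasure lborel A = emeasure (distr (density M (\<lambda>(w, \<theta>, r). ennreal (wt \<theta> r))) borel T) A" by simp
  qed simp
  define G where "G = (\<lambda>(w, \<theta>, r). F w \<theta> r)"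
  have F_eq: "F w \<theta> r = wt \<theta> r *\<^sub>R f (T (w, \<theta>, r))" for w \<theta> r
    by (simp add: F_def wt_def T_def scaleR_conv_of_real)
  have G_eq: "G = (\<lambda>y. (case y of (w, \<theta>, r) \<Rightarrow> wt \<theta> r) *\<^sub>R f (T y))"
    by (auto simp: fun_eq_iff G_def F_eq)
  have [measurable]: "G \<in> borel_measurable M"
    unfolding G_eq by (intro borel_measurable_scaleR wtM measurable_compose[OF _ f]) simp
  have "(LINT x|lborel. f x) = (LINT y|density M (\<lambda>(w, \<theta>, r). ennreal (wt \<theta> r)). f (T y))"
    by (subst polar, rule integral_distr) simp_all
  also have "\<dots> = (LINT y|M. (case y of (w, \<theta>, r) \<Rightarrow> wt \<theta> r) *\<^sub>R f (T y))"
  proof -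
    have "(LINT y|density M (\<lambda>y. ennreal (case y of (w, \<theta>, r) \<Rightarrow> wt \<theta> r)). f (T y)) = (LINT y|M. (case y of (w, \<theta>, r) \<Rightarrow> wt \<theta> r) *\<^sub>R f (T y))"
    proof (rule integral_density)
      show "(\<lambda>y. f (T y)) \<in> borel_measurable M" by (rule measurable_compose[OF _ f]) simp
      show "AE y in M. 0 \<le> (case y of (w, \<theta>, r) \<Rightarrow> wt \<theta> r)" using wt_nn by (auto simp: case_prod_unfold)
    qed (rule wtM)
    thus ?thesis by (simp add: case_prod_unfold)
  qed
  also have "\<dots> = (LINT y|M. G y)"
    by (simp only: G_eq)
  finally have 1: "(LINT x|lborel. f x) = (LINT y|M. G y)" .
  \<comment> \<open>Bounds weight times function on 0 < r <= |\<rho>|. The absolute value and the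
    maximum keep it nonnegative whatever the signs of \<open>\<rho>\<close> and
    \<open>B\<close>.\<close>
  define B' where "B' = \<bar>\<rho>\<bar> ^ (p + 1) * max B 0"
  have B'0: "B' \<ge> 0" by (simp add: B'_def)
  have nT: "norm (T (w, \<theta>, r)) = \<bar>r\<bar>" for w \<theta> r
  proof -
    have "(norm (cos \<theta> *\<^sub>R h + sin \<theta> *\<^sub>R e w))\<^sup>2 = 1"
      using h eq[of w] by (simp add: power2_norm_eq_inner inner_add inner_commute norm_eq_1 flip: power2_eq_square)
    hence "norm (cos \<theta> *\<^sub>R h + sin \<theta> *\<^sub>R e w) = 1" by (simp add: power2_eq_1_iff) (smt (verit) norm_ge_zero)
    thus ?thesis by (simp add: T_def)
  qed
  have FB: "norm (F w \<theta> r) \<le> B' * indicator ({0<..<pi} \<times> {0..\<bar>\<rho>\<bar>}) (\<theta>, r)" for w \<theta> r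
  proof (cases "\<theta> \<in> {0<..<pi} \<and> 0 < r \<and> r \<le> \<bar>\<rho>\<bar>")
    case True
    have "wt \<theta> r \<le> \<bar>\<rho>\<bar> ^ (p + 1)"
    proof -
      have "r ^ (p + 1) * sin \<theta> ^ p \<le> \<bar>\<rho>\<bar> ^ (p + 1) * 1"
        using True by (intro mult_mono power_mono power_le_one sin_ge_zero zero_le_power) auto
      thus ?thesis using True by (simp add: wt_def)
    qed
    moreover have "norm (f (T (w, \<theta>, r))) \<le> max B 0"
      using B[of "T (w, \<theta>, r)"] nT[of w \<theta> r] True by (cases "T (w, \<theta>, r) = 0") auto
    ultimately have "norm (F w \<theta> r) \<le> B'"
      unfolding F_eq B'_def norm_scaleR using wt_nn[of \<theta> r] by (intro mult_mono) auto
    thus ?thesis using True by simp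
  next
    case False
    moreover have "f (T (w, \<theta>, r)) = 0" if "r > \<bar>\<rho>\<bar>"
      using that nT[of w \<theta> r] by (intro supp) linarith
    ultimately have "F w \<theta> r = 0" by (auto simp: F_eq wt_def split: split_indicator)
    thus ?thesis using B'0 by simp
  qed
  have iS: "integrable (lborel \<Otimes>\<^sub>M lborel) (\<lambda>z. B' * indicator ({0<..<pi} \<times> {0..\<bar>\<rho>\<bar>}) z :: real)"
    by (intro integrable_mult_right integrable_real_indicator) (auto simp: ennreal_mult_less_top lborel.emeasure_pair_measure_Times)
  have "integrable M (\<lambda>x. B' * indicator (space \<mu> \<times> ({0<..<pi} \<times> {0..\<bar>\<rho>\<bar>})) x :: real)"
  proof (intro integrable_mult_right integrable_real_indicator)
    show "space \<mu> \<times> {0<..<pi} \<times> {0..\<bar>\<rho>\<bar>} \<in> sets M" unfolding M_def by measurable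
    have "emeasure M (space \<mu> \<times> {0<..<pi} \<times> {0..\<bar>\<rho>\<bar>}) = emeasure \<mu> (space \<mu>) * (ennreal pi * ennreal \<bar>\<rho>\<bar>)"
      unfolding M_def by (subst sigma_finite_measure.emeasure_pair_measure_Times[OF S2]) (auto simp: lborel.emeasure_pair_measure_Times)
    also have "\<dots> < \<infinity>"
      by (simp add: \<mu>.emeasure_eq_measure flip: ennreal_mult)
    finally show "emeasure M (space \<mu> \<times> {0<..<pi} \<times> {0..\<bar>\<rho>\<bar>}) < \<infinity>" .
  qed
  hence iG: "integrable M G"
  proof (rule Bochner_Integration.integrable_bound)
    show "AE x in M. norm (G x) \<le> norm (B' * indicator (space \<mu> \<times> ({0<..<pi} \<times> {0..\<bar>\<rho>\<bar>})) x :: real)"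
    proof (rule AE_I2)
      fix x assume "x \<in> space M"
      moreover obtain w \<theta> r where x: "x = (w, \<theta>, r)" by (cases x) auto
      ultimately have "w \<in> space \<mu>" by (simp add: M_def space_pair_measure)
      thus "norm (G x) \<le> norm (B' * indicator (space \<mu> \<times> ({0<..<pi} \<times> {0..\<bar>\<rho>\<bar>})) x :: real)"
        using FB[of w \<theta> r] by (simp add: x G_def indicator_times abs_mult B'_def)
    qed
  qed simp
  have inner: "(LINT z|(lborel \<Otimes>\<^sub>M lborel). G (w, z)) = (LINT r|lborel. LINT \<theta>|lborel. F w \<theta> r)" for w
  proof -
    have m: "(\<lambda>(\<theta>, r). F w \<theta> r) \<in> borel_measurable (lborel \<Otimes>\<^sub>M lborel)"
      unfolding F_def by measurable
    have "integrable (lborel \<Otimes>\<^sub>M lborel) (\<lambda>(\<theta>, r). F w \<theta> r)"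
      by (rule Bochner_Integration.integrable_bound[OF iS m])
        (auto intro!: AE_I2 order_trans[OF FB] simp: abs_mult B'0)
    from lborel_pair.integral_snd[OF this] show ?thesis by (simp add: G_def)
  qed
  show "(LINT x|lborel. f x) = (LINT w|\<mu>. LINT r|lborel. LINT \<theta>|lborel. F w \<theta> r)"
    using PP.integral_fst'[OF iG[unfolded M_def]] unfolding 1 inner M_def by simp
  have [measurable]: "G \<in> borel_measurable (\<mu> \<Otimes>\<^sub>M (lborel \<Otimes>\<^sub>M lborel))" using \<open>G \<in> borel_measurable M\<close> by (simp add: M_def)
  have "(\<lambda>w. LINT z|(lborel \<Otimes>\<^sub>M lborel). G (w, z)) \<in> borel_measurable \<mu>"
    by (rule sigma_finite_measure.borel_measurable_lebesgue_integral[OF S2]) (simp add: case_prod_unfold)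
  thus "(\<lambda>w. LINT r|lborel. LINT \<theta>|lborel. F w \<theta> r) \<in> borel_measurable \<mu>" by (simp add: inner)
qed

context half_circle_profile
begin

text \<open>Connects the Lebesgue integrals of the polar formula with the gauge integrals used so
  far; open and closed intervals differ by null sets. The factor 1 / (2 pi) of the inverse transform
  reappears here.\<close>

lemma shell_wave_lborel:
  assumes R: "R > 0"
  shows "(LINT r|lborel. LINT t|lborel. of_real (indicator {0<..<pi} t * indicator {0<..} r * (r ^ (p + 1) * sin t ^ p)) *
      (of_real (R powr (- m)) * indicator {r. r < 2 * R} r * (of_real (1 / (2 * pi)) * v (r - R) t) * cis (- (r * \<kappa> * cos t)))) =
    of_real (1 / (2 * pi)) * shell_wave R" (is "(LINT r|_. ?I r) = _")
proof -
  define g where "g r = of_real (R powr (- m)) * of_real (1 / (2 * pi)) * (of_real (r ^ (p + 1)) * circle_wave r (r - R))" for r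
  have inner: "?I r = indicator {0<..<2 * R} r *\<^sub>R g r" for r
  proof -
    let ?h = "\<lambda>t. of_real (sin t ^ p) * v (r - R) t * cis (- (r * \<kappa> * cos t))"
    have "?I r = (LINT t|lborel. (indicator {0<..<2 * R} r * of_real (R powr (- m)) * of_real (1 / (2 * pi)) * of_real (r ^ (p + 1))) * (indicator {0..pi} t *\<^sub>R ?h t))"
    proof (rule integral_cong_AE)
      have [measurable]: "(\<lambda>t. v (r - R) t) \<in> borel_measurable borel"
        by (intro borel_measurable_continuous_onI cont_v continuous_intros)
      show "(\<lambda>t. of_real (indicator {0<..<pi} t * indicator {0<..} r * (r ^ (p + 1) * sin t ^ p)) *
        (of_real (R powr (- m)) * indicator {r. r < 2 * R} r * (of_real (1 / (2 * pi)) * v (r - R) t) * cis (- (r * \<kappa> * cos t)))) \<in> borel_measurable lborel"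
        by measurable
      show "(\<lambda>t. (indicator {0<..<2 * R} r * of_real (R powr (- m)) * of_real (1 / (2 * pi)) * of_real (r ^ (p + 1))) * (indicator {0..pi} t *\<^sub>R ?h t)) \<in> borel_measurable lborel"
        by measurable
      show "AE t in lborel. of_real (indicator {0<..<pi} t * indicator {0<..} r * (r ^ (p + 1) * sin t ^ p)) *
        (of_real (R powr (- m)) * indicator {r. r < 2 * R} r * (of_real (1 / (2 * pi)) * v (r - R) t) * cis (- (r * \<kappa> * cos t))) =
        (indicator {0<..<2 * R} r * of_real (R powr (- m)) * of_real (1 / (2 * pi)) * of_real (r ^ (p + 1))) * (indicator {0..pi} t *\<^sub>R ?h t)"
        using AE_lborel_singleton[of 0] AE_lborel_singleton[of pi]
        by eventually_elim (auto split: split_indicator)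
    qed
    also have "\<dots> = (indicator {0<..<2 * R} r * of_real (R powr (- m)) * of_real (1 / (2 * pi)) * of_real (r ^ (p + 1))) * (LINT t:{0..pi}|lborel. ?h t)"
      unfolding set_lebesgue_integral_def by (rule integral_mult_right_zero)
    also have "(LINT t:{0..pi}|lborel. ?h t) = circle_wave r (r - R)"
      unfolding circle_wave_def
      by (intro set_borel_integral_eq_integral(2) borel_integrable_atLeastAtMost' continuous_intros cont_v)
    finally show ?thesis by (simp add: g_def split: split_indicator)
  qed
  have cg: "continuous_on A g" for A
  proof -
    have "continuous_on A (\<lambda>r. circle_wave (R + (r - R)) (r - R))"
      by (rule continuous_on_compose2[OF cont_circle_wave[of UNIV R]]) (auto intro!: continuous_intros)
    hence "continuous_on A (\<lambda>r. circle_wave r (r - R))" by simp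
    thus ?thesis unfolding g_def by (intro continuous_intros)
  qed
  have [measurable]: "g \<in> borel_measurable borel" by (rule borel_measurable_continuous_onI[OF cg])
  have "(LINT r|lborel. ?I r) = (LINT r:{0..2 * R}|lborel. g r)"
    unfolding inner set_lebesgue_integral_def
  proof (rule integral_cong_AE)
    show "AE r in lborel. indicator {0<..<2 * R} r *\<^sub>R g r = indicator {0..2 * R} r *\<^sub>R g r"
      using AE_lborel_singleton[of 0] AE_lborel_singleton[of "2 * R"]
      by eventually_elim (auto split: split_indicator)
  qed measurable
  also have "\<dots> = integral {0..2 * R} g"
    by (intro set_borel_integral_eq_integral(2) borel_integrable_atLeastAtMost' cg)
  also have "\<dots> = of_real (1 / (2 * pi)) * shell_wave R"
    unfolding g_def shell_wave_def by (simp only: integral_mult_right) (simp only: mult_ac)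
  finally show ?thesis .
qed

end

section \<open>Regularity of the regularizing function; the shell as an explicit function\<close>

lemma Ck_Suc_imp_Ck: "Ck (Suc n) f \<Longrightarrow> Ck n f"
proof (induction n arbitrary: f)
  case 0
  thus ?case by (auto intro!: differentiable_imp_continuous_on_UNIV)
qed auto

lemma Ck_1_regularizing:
  assumes "regularizing d \<rho> W" "d \<ge> 2" "d \<le> 3"
  shows "Ck 1 W"
proof -
  from assms consider "d - 1 = Suc 0" | "d - 1 = Suc (Suc 0)" by linarith
  thus ?thesis
  proof cases
    case 2
    hence "Ck (Suc (Suc 0)) W" using assms(1) by (simp only: regularizing_def)
    thus ?thesis using Ck_Suc_imp_Ck[of "Suc 0" W] by (simp only: One_nat_def)
  qed (use assms(1) in \<open>simp_all only: regularizing_def One_nat_def\<close>)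
qed

lemma continuous_on_regularizing:
  assumes "regularizing d \<rho> W"
  shows "continuous_on UNIV W"
proof -
  have "Ck n W \<Longrightarrow> continuous_on UNIV W" for n
    by (induction n) (use Ck_Suc_imp_Ck in \<open>auto simp del: Ck.simps(2)\<close>)
  thus ?thesis using assms unfolding regularizing_def by blast
qed

text \<open>The principal value of (2 pi i)^(-m) from the restriction operator. It depends on the
  space only through its dimension, hence the type as argument.\<close>

definition root_factor :: "'a::euclidean_space itself \<Rightarrow> complex" where
  "root_factor _ = (1 / (2 * of_real pi * \<i>)) powr of_real ((real DIM('a) - 1) / 2)"

text \<open>For b = 0 the profile does not depend on the slow time, so c, t and \<epsilon> enter the
  reconstruction only through R = c t.\<close>

definition shell_profile :: "(real \<Rightarrow> real) \<Rightarrow> ('a::euclidean_space \<Rightarrow> complex) \<Rightarrow> real \<Rightarrow> 'a \<Rightarrow> complex" where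
  "shell_profile W u R x = of_real (1 / R powr ((real DIM('a) - 1) / 2)) * indicator {y. norm y < 2 * R} x *
     inv_fourier (\<lambda>\<xi>. restriction W u \<xi> (x /\<^sub>R norm x)) (norm x - R)"

lemma exp_i_eq_cis: "exp (\<i> * complex_of_real x) = cis x" "exp (- (\<i> * complex_of_real x)) = cis (- x)"
  by (simp_all add: cis_conv_exp)

lemma reconstruction_hat_eq:
  "reconstruction_hat c \<epsilon> W (\<lambda>_. 0) u k t = fourier (shell_profile W u (c * t)) k"
  by (simp add: reconstruction_hat_def reconstruction_def shell_def shell_profile_def[abs_def] evolution_def
      inv_fourier_profile_def o_def mult.assoc)

text \<open>Because \<open>W\<close> vanishes on the negative axis, |\<xi>| q may be replaced by
  \<xi> q. This removes the kink of |\<xi>| at 0 and gives the form in which the profile can be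
  differentiated; the support of \<open>u\<close> cuts the line down to [-N, N].\<close>

lemma inv_fourier_restriction:
  fixes u :: "'a::euclidean_space \<Rightarrow> complex"
  assumes W: "continuous_on UNIV W" "\<And>\<xi>. \<xi> \<le> 0 \<Longrightarrow> W \<xi> = 0"
    and u: "continuous_on UNIV u" "\<And>x. norm x \<ge> N \<Longrightarrow> u x = 0" and q: "norm q = 1"
  shows "inv_fourier (\<lambda>\<xi>. restriction W u \<xi> q) z = of_real (1 / (2 * pi)) *
     integral {-N..N} (\<lambda>\<xi>. root_factor TYPE('a) * of_real (W \<xi>) * u (\<xi> *\<^sub>R q) * cis (z * \<xi>))"
proof -
  let ?g = "\<lambda>\<xi>. root_factor TYPE('a) * of_real (W \<xi>) * u (\<xi> *\<^sub>R q) * cis (z * \<xi>)"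
  have restr: "restriction W u \<xi> q = root_factor TYPE('a) * of_real (W \<xi>) * u (\<xi> *\<^sub>R q)" for \<xi>
    using W(2)[of \<xi>] by (cases "\<xi> \<le> 0") (auto simp: restriction_def root_factor_def)
  have ind: "?g \<xi> = indicator {-N..N} \<xi> *\<^sub>R ?g \<xi>" for \<xi>
  proof (cases "\<xi> \<in> {-N..N}")
    case False
    hence "N \<le> \<bar>\<xi>\<bar>" by (cases "\<xi> \<ge> 0") auto
    hence "u (\<xi> *\<^sub>R q) = 0" using q by (intro u(2)) simp
    thus ?thesis by simp
  qed simp
  have "exp (\<i> * of_real (z \<bullet> \<xi>)) * restriction W u \<xi> q = ?g \<xi>" for \<xi>
    unfolding restr inner_real_def exp_i_eq_cis by (rule mult.commute)
  hence "(LINT \<xi>|lborel. exp (\<i> * of_real (z \<bullet> \<xi>)) * restriction W u \<xi> q) = (LINT \<xi>:{-N..N}|lborel. ?g \<xi>)"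
    unfolding set_lebesgue_integral_def by (simp only: flip: ind)
  also have "\<dots> = integral {-N..N} ?g"
    by (intro set_borel_integral_eq_integral(2) borel_integrable_atLeastAtMost' continuous_intros
        continuous_on_compose2[OF W(1)] continuous_on_compose2[OF u(1)]) auto
  finally show ?thesis by (simp add: inv_fourier_def)
qed

lemma borel_measurable_shell_profile:
  fixes u :: "'a::euclidean_space \<Rightarrow> complex"
  assumes "continuous_on UNIV W" "continuous_on UNIV u"
  shows "shell_profile W u R \<in> borel_measurable borel"
proof -
  have [measurable]: "W \<in> borel_measurable borel" "u \<in> borel_measurable borel"
    using assms by (auto intro: borel_measurable_continuous_onI)
  show ?thesis
    unfolding shell_profile_def[abs_def] inv_fourier_def restriction_def by measurable
qed

text \<open>All half great circles share the two poles, so their waves have the same asymptotics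
  \<open>A R\<close>, and integration over the azimuth multiplies it by the total mass of
  \<open>\<mu>\<close>. The last assumption is the normalization that the principal root of 1 / (2
  pi i) is made for.\<close>

lemma tendsto_reconstruction_axial:
  fixes u :: "'a::euclidean_space \<Rightarrow> complex" and k :: 'a
  assumes u: "smooth u" "compactly_supported u" and reg: "regularizing DIM('a) \<rho> W"
    and dim: "DIM('a) = p + 2" and p: "p \<in> {0, 1}" and \<rho>: "\<rho> > 0" and k: "norm k > \<rho>"
    and P: "axial_polar p \<mu> e (k /\<^sub>R norm k)"
    and const: "of_real (measure \<mu> (space \<mu>)) * cap_coeff p * root_factor TYPE('a) = 1"
  shows "((\<lambda>R. fourier (shell_profile W u R) k - cis (- (R * norm k)) * u k) \<longlongrightarrow> 0) at_top"
proof -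
  interpret \<mu>: finite_measure \<mu> using P by (simp add: axial_polar_def)
  define \<kappa> where "\<kappa> = norm k"
  define h where "h = k /\<^sub>R norm k"
  define c0 where "c0 = root_factor TYPE('a)"
  define \<nu> where "\<nu> = (real p + 1) / 2"
  have \<kappa>: "\<kappa> > 0" using k \<rho> unfolding \<kappa>_def by linarith
  have h: "norm h = 1" "\<kappa> *\<^sub>R h = k" using \<kappa> by (simp_all add: h_def \<kappa>_def)
  have hh: "h \<bullet> h = 1" using h(1) by (simp add: norm_eq_1)
  have e: "norm (e w) = 1" "h \<bullet> e w = 0" for w using P by (simp_all add: axial_polar_def h_def)
  have half: "(real DIM('a) - 1) / 2 = \<nu>" by (simp add: dim \<nu>_def)
  have cW: "continuous_on UNIV W" using reg by (rule continuous_on_regularizing)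
  have W0: "W \<xi> = 0" if "\<xi> \<le> 0" for \<xi> using reg that unfolding regularizing_def by blast
  have W\<kappa>: "W \<kappa> = \<kappa> powr \<nu>"
  proof -
    have "\<forall>\<xi>\<ge>\<rho>. W \<xi> = \<bar>\<xi>\<bar> powr ((real DIM('a) - 1) / 2)" using reg unfolding regularizing_def by blast
    hence "W \<kappa> = \<bar>\<kappa>\<bar> powr \<nu>" using k unfolding half \<kappa>_def by simp
    thus ?thesis using \<kappa> by simp
  qed
  have cu: "continuous_on UNIV u" by (rule differentiable_imp_continuous_on_UNIV[OF smooth_imp_C2(1)[OF u(1)]])
  have W1: "Ck 1 W" by (rule Ck_1_regularizing[OF reg]) (use dim p in auto)
  define V where "V w x t = c0 * of_real (W x) * u (x *\<^sub>R (cos t *\<^sub>R h + sin t *\<^sub>R e w))" for w x t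
  obtain N M C where Npos: "N > 0" and uN: "\<And>x. norm x \<ge> N \<Longrightarrow> u x = 0"
    and prof0: "\<And>e. norm e = 1 \<Longrightarrow> h \<bullet> e = 0 \<Longrightarrow> \<exists>Vx Vt Vtx.
       half_circle_profile (\<lambda>x t. c0 * of_real (W x) * u (x *\<^sub>R (cos t *\<^sub>R h + sin t *\<^sub>R e))) Vx Vt Vtx N M C p \<kappa>"
    by (rule half_circle_profile_exists[OF u W1 h(1) p \<kappa>, of c0]) (rule that)
  have prof: "\<exists>Vx Vt Vtx. half_circle_profile (V w) Vx Vt Vtx N M C p \<kappa>" for w
    unfolding V_def[abs_def] by (rule prof0[OF e])
  \<comment> \<open>The wave depends on the profile itself and not on its derivatives, so
    \<open>S\<close> is a function of w although the derivatives are only known to exist for each w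
    separately.\<close>
  define S where "S w R = half_circle_profile.shell_wave (V w) N p \<kappa> R" for w R
  define B where "B = \<kappa> powr (- \<nu>) * (2 powr \<nu> * C * (half_circle_profile.L1 N M + pi * half_circle_profile.L1 N M))"
  \<comment> \<open>The limit of a single wave, free of w: at colatitude 0 the profile is taken at
    \<kappa> h = k, and the opposite pole drops out since W(-\<kappa>) = 0.\<close>
  define A where "A R = of_real (\<kappa> powr (- \<nu>)) * (2 * pi * (cap_coeff p * cis (- (R * \<kappa>)) * (c0 * of_real (W \<kappa>) * u k)))" for R
  have S_bound: "norm (S w R) \<le> B" if R: "R > 0" for w R
  proof -
    obtain Vx Vt Vtx where "half_circle_profile (V w) Vx Vt Vtx N M C p \<kappa>" using prof by blast
    then interpret half_circle_profile "V w" Vx Vt Vtx N M C p \<kappa> .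
    show ?thesis using shell_wave_bound[OF R] by (simp add: S_def B_def m_def \<nu>_def)
  qed
  have S_lim: "((\<lambda>R. S w R - A R) \<longlongrightarrow> 0) at_top" for w
  proof -
    obtain Vx Vt Vtx where "half_circle_profile (V w) Vx Vt Vtx N M C p \<kappa>" using prof by blast
    then interpret half_circle_profile "V w" Vx Vt Vtx N M C p \<kappa> .
    have "V w \<kappa> 0 = c0 * of_real (W \<kappa>) * u k" "V w (- \<kappa>) pi = 0"
      using W0[of "- \<kappa>"] \<kappa> by (simp_all add: V_def h)
    thus ?thesis using tendsto_shell_wave by (simp add: S_def A_def m_def \<nu>_def)
  qed
  define f where "f R x = shell_profile W u R x * exp (- (\<i> * of_real (k \<bullet> x)))" for R x
  define F where "F R w \<theta> r = of_real (indicator {0<..<pi} \<theta> * indicator {0<..} r * (r ^ (p + 1) * sin \<theta> ^ p)) * f R (r *\<^sub>R (cos \<theta> *\<^sub>R h + sin \<theta> *\<^sub>R e w))" for R w \<theta> r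
  have nq: "norm (cos \<theta> *\<^sub>R h + sin \<theta> *\<^sub>R e w) = 1" for \<theta> w
    unfolding norm_eq_1 using h(1) e[of w] by (simp add: inner_add inner_commute norm_eq_1 flip: power2_eq_square)
  have F_eq: "F R w \<theta> r = of_real (indicator {0<..<pi} \<theta> * indicator {0<..} r * (r ^ (p + 1) * sin \<theta> ^ p)) *
      (of_real (R powr (- \<nu>)) * indicator {r. r < 2 * R} r * (of_real (1 / (2 * pi)) * half_circle_profile.v (V w) N (r - R) \<theta>) * cis (- (r * \<kappa> * cos \<theta>)))"
    if R: "R > 0" for R w \<theta> r
  proof (cases "r > 0")
    case True
    let ?q = "cos \<theta> *\<^sub>R h + sin \<theta> *\<^sub>R e w"
    obtain Vx Vt Vtx where "half_circle_profile (V w) Vx Vt Vtx N M C p \<kappa>" using prof by blast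
    then interpret half_circle_profile "V w" Vx Vt Vtx N M C p \<kappa> .
    have n: "norm (r *\<^sub>R ?q) = r" "(r *\<^sub>R ?q) /\<^sub>R r = ?q" using True nq by simp_all
    have ind: "indicator {y. norm y < 2 * R} (r *\<^sub>R ?q) = (indicator {r. r < 2 * R} r :: complex)"
      by (simp only: indicator_def mem_Collect_eq n(1))
    have pw: "complex_of_real (1 / R powr \<nu>) = of_real (R powr (- \<nu>))"
      by (simp only: powr_minus divide_inverse mult_1)
    have i: "inv_fourier (\<lambda>\<xi>. restriction W u \<xi> ?q) (r - R) = of_real (1 / (2 * pi)) * v (r - R) \<theta>"
      unfolding v_def V_def c0_def by (rule inv_fourier_restriction[OF cW W0 cu uN nq])
    have kq: "k \<bullet> (r *\<^sub>R ?q) = r * \<kappa> * cos \<theta>"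
    proof -
      have "h \<bullet> ?q = cos \<theta>" by (simp only: inner_add_right inner_scaleR_right hh e(2) mult_1_right mult_zero_right add_0_right)
      moreover have "k \<bullet> ?q = \<kappa> * (h \<bullet> ?q)" unfolding h(2)[symmetric] by (rule inner_scaleR_left)
      ultimately have "k \<bullet> ?q = \<kappa> * cos \<theta>" by (simp only:)
      thus ?thesis by (simp only: inner_scaleR_right mult_ac)
    qed
    have "f R (r *\<^sub>R ?q) = of_real (R powr (- \<nu>)) * indicator {r. r < 2 * R} r * (of_real (1 / (2 * pi)) * v (r - R) \<theta>) * cis (- (r * \<kappa> * cos \<theta>))"
      unfolding f_def shell_profile_def half ind n i pw kq exp_i_eq_cis ..
    thus ?thesis by (simp only: F_def)
  qed (simp add: F_def)
  have shell_S: "(LINT r|lborel. LINT \<theta>|lborel. F R w \<theta> r) = of_real (1 / (2 * pi)) * S w R" if R: "R > 0" for R w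
  proof -
    obtain Vx Vt Vtx where "half_circle_profile (V w) Vx Vt Vtx N M C p \<kappa>" using prof by blast
    then interpret half_circle_profile "V w" Vx Vt Vtx N M C p \<kappa> .
    show ?thesis unfolding F_eq[OF R] S_def using shell_wave_lborel[OF R] by (simp add: m_def \<nu>_def)
  qed
  have mf: "f R \<in> borel_measurable borel" for R
  proof -
    note [measurable] = borel_measurable_shell_profile[OF cW cu]
    show ?thesis unfolding f_def[abs_def] by measurable
  qed
  \<comment> \<open>A crude bound of the inverse transform over all unit directions, for the
    integrability of the shell at fixed R; the estimate uniform in R is
    \<open>S_bound\<close>.\<close>
  obtain B0 where B0: "\<And>z q. norm q = 1 \<Longrightarrow> norm (inv_fourier (\<lambda>\<xi>. restriction W u \<xi> q) z) \<le> B0"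
  proof -
    obtain K where K: "K \<ge> 0" "\<And>x. norm (u x) \<le> K"
      using bounded_support_bound[OF cu, of N] uN by (metis less_imp_le)
    have "bounded (W ` {-N..N})"
      by (intro compact_imp_bounded compact_continuous_image compact_Icc continuous_on_subset[OF cW]) auto
    then obtain Kw where Kw: "\<And>x. x \<in> {-N..N} \<Longrightarrow> \<bar>W x\<bar> \<le> Kw" unfolding bounded_iff by (metis imageI real_norm_def)
    have "norm (inv_fourier (\<lambda>\<xi>. restriction W u \<xi> q) z) \<le> norm (complex_of_real (1 / (2 * pi))) * (norm c0 * Kw * K * (N - (- N)))" if q: "norm q = 1" for q z
    proof -
      have eq: "inv_fourier (\<lambda>\<xi>. restriction W u \<xi> q) z = of_real (1 / (2 * pi)) *
          integral {-N..N} (\<lambda>\<xi>. root_factor TYPE('a) * of_real (W \<xi>) * u (\<xi> *\<^sub>R q) * cis (z * \<xi>))"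
        by (rule inv_fourier_restriction[OF cW W0 cu uN q])
      show ?thesis unfolding eq norm_mult[of "of_real (1 / (2 * pi))"]
      proof (intro mult_left_mono integral_bound)
        show "continuous_on {-N..N} (\<lambda>\<xi>. root_factor TYPE('a) * of_real (W \<xi>) * u (\<xi> *\<^sub>R q) * cis (z * \<xi>))"
          by (intro continuous_intros continuous_on_compose2[OF cW] continuous_on_compose2[OF cu]) auto
        show "norm (root_factor TYPE('a) * of_real (W \<xi>) * u (\<xi> *\<^sub>R q) * cis (z * \<xi>)) \<le> norm c0 * Kw * K" if "\<xi> \<in> {-N..N}" for \<xi>
          unfolding norm_mult norm_cis mult_1_right norm_of_real c0_def[symmetric]
          using K Kw[OF that] order_trans[OF abs_ge_zero Kw[OF that]] by (intro mult_mono) auto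
      qed (use Npos in auto)
    qed
    thus ?thesis using that by blast
  qed
  have fB: "norm (f R x) \<le> R powr (- \<nu>) * B0" if R: "R > 0" and x: "x \<noteq> 0" for R x
  proof -
    have q: "norm (x /\<^sub>R norm x) = 1" using x by simp
    have B00: "B0 \<ge> 0" using order_trans[OF norm_ge_zero B0[OF q]] .
    have "norm (f R x) = R powr (- \<nu>) * indicator {y. norm y < 2 * R} x * norm (inv_fourier (\<lambda>\<xi>. restriction W u \<xi> (x /\<^sub>R norm x)) (norm x - R))"
      unfolding f_def shell_profile_def half exp_i_eq_cis
      by (simp add: norm_mult norm_divide powr_minus divide_inverse norm_inverse indicator_def)
    also have "\<dots> \<le> R powr (- \<nu>) * 1 * B0"
      using B0[OF q] B00 by (intro mult_mono) (auto simp: indicator_def)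
    finally show ?thesis by simp
  qed
  have fsupp: "f R x = 0" if "norm x > 2 * R" for R x
    using that by (simp add: f_def shell_profile_def)
  have fourier_eq: "fourier (shell_profile W u R) k = (LINT w|\<mu>. of_real (1 / (2 * pi)) * S w R)"
    and mS: "(\<lambda>w. of_real (1 / (2 * pi)) * S w R) \<in> borel_measurable \<mu>" if R: "R > 0" for R
  proof -
    note P' = P[folded h_def]
    have "(LINT x|lborel. f R x) = (LINT w|\<mu>. LINT r|lborel. LINT \<theta>|lborel. F R w \<theta> r)"
      unfolding F_def by (rule axial_polar_integral(1)[OF P' h(1) mf fB[OF R] fsupp])
    thus "fourier (shell_profile W u R) k = (LINT w|\<mu>. of_real (1 / (2 * pi)) * S w R)"
      unfolding shell_S[OF R] by (simp add: fourier_def f_def)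
    have "(\<lambda>w. LINT r|lborel. LINT \<theta>|lborel. F R w \<theta> r) \<in> borel_measurable \<mu>"
      unfolding F_def by (rule axial_polar_integral(2)[OF P' h(1) mf fB[OF R] fsupp])
    thus "(\<lambda>w. of_real (1 / (2 * pi)) * S w R) \<in> borel_measurable \<mu>" unfolding shell_S[OF R] .
  qed
  \<comment> \<open>The condition |k| > \<rho> gives W(\<kappa>) = \<kappa>^\<nu>, which cancels the
    decay \<kappa>^(-\<nu>) of the caps; 2 pi cancels between inversion and inverse transform; the
    remaining constants are the normalization assumed.\<close>
  have main: "of_real (measure \<mu> (space \<mu>)) * (of_real (1 / (2 * pi)) * A R) = cis (- (R * \<kappa>)) * u k" for R
  proof -
    have "of_real (\<kappa> powr (- \<nu>)) * complex_of_real (W \<kappa>) = 1"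
      using \<kappa> by (simp add: W\<kappa> powr_minus flip: of_real_mult)
    moreover have "of_real (1 / (2 * pi)) * complex_of_real (2 * pi) = 1" by (simp flip: of_real_mult)
    moreover have "of_real (measure \<mu> (space \<mu>)) * (of_real (1 / (2 * pi)) * A R) =
       (of_real (measure \<mu> (space \<mu>)) * cap_coeff p * c0) * (of_real (\<kappa> powr (- \<nu>)) * complex_of_real (W \<kappa>)) *
       (of_real (1 / (2 * pi)) * complex_of_real (2 * pi)) * (cis (- (R * \<kappa>)) * u k)"
      unfolding A_def by (simp only: of_real_mult of_real_numeral mult_ac)
    ultimately show ?thesis using const by (simp add: c0_def)
  qed
  have A_bound: "norm (A R) \<le> norm (A 0)" for R by (simp add: A_def norm_mult)
  have "((\<lambda>R. LINT w|\<mu>. (if R > 0 then of_real (1 / (2 * pi)) * S w R - of_real (1 / (2 * pi)) * A R else 0)) \<longlongrightarrow> integral\<^sup>L \<mu> (\<lambda>w. 0 :: complex)) at_top"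
  proof (rule integral_dominated_convergence_at_top[where w = "\<lambda>w. norm (complex_of_real (1 / (2 * pi))) * B + norm (complex_of_real (1 / (2 * pi))) * norm (A 0)"])
    show "(\<lambda>w. if R > 0 then of_real (1 / (2 * pi)) * S w R - of_real (1 / (2 * pi)) * A R else 0) \<in> borel_measurable \<mu>" for R
      using mS[of R] by (cases "R > 0") auto
    show "\<forall>\<^sub>F R in at_top. AE w in \<mu>. norm (if R > 0 then of_real (1 / (2 * pi)) * S w R - of_real (1 / (2 * pi)) * A R else 0)
        \<le> norm (complex_of_real (1 / (2 * pi))) * B + norm (complex_of_real (1 / (2 * pi))) * norm (A 0)"
      using eventually_gt_at_top[of 0]
    proof eventually_elim
      case (elim R)
      have "norm (of_real (1 / (2 * pi)) * S w R - of_real (1 / (2 * pi)) * A R) \<le> norm (complex_of_real (1 / (2 * pi))) * B + norm (complex_of_real (1 / (2 * pi))) * norm (A 0)" for w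
        by (rule norm_triangle_le_diff[OF add_mono]; unfold norm_mult; intro mult_left_mono S_bound[OF elim] A_bound; simp)
      thus ?case using elim by simp
    qed
    show "AE w in \<mu>. ((\<lambda>R. if R > 0 then of_real (1 / (2 * pi)) * S w R - of_real (1 / (2 * pi)) * A R else 0) \<longlongrightarrow> 0) at_top"
    proof (intro always_eventually allI)
      fix w
      have "((\<lambda>R. of_real (1 / (2 * pi)) * (S w R - A R)) \<longlongrightarrow> of_real (1 / (2 * pi)) * 0) at_top"
        by (intro tendsto_mult tendsto_const S_lim)
      hence "((\<lambda>R. of_real (1 / (2 * pi)) * (S w R - A R)) \<longlongrightarrow> 0) at_top" by simp
      thus "((\<lambda>R. if R > 0 then of_real (1 / (2 * pi)) * S w R - of_real (1 / (2 * pi)) * A R else 0) \<longlongrightarrow> 0) at_top"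
        by (rule Lim_transform_eventually[OF _ eventually_mono[OF eventually_gt_at_top[of 0]]]) (simp add: right_diff_distrib)
    qed
  qed auto
  hence "((\<lambda>R. LINT w|\<mu>. (if R > 0 then of_real (1 / (2 * pi)) * S w R - of_real (1 / (2 * pi)) * A R else 0)) \<longlongrightarrow> 0) at_top" by simp
  thus ?thesis
  proof (rule Lim_transform_eventually[OF _ eventually_mono[OF eventually_gt_at_top[of 0]]])
    fix R :: real assume R: "R > 0"
    have iS: "integrable \<mu> (\<lambda>w. of_real (1 / (2 * pi)) * S w R)"
      by (rule \<mu>.integrable_const_bound[where B = "norm (complex_of_real (1 / (2 * pi))) * B"])
        (rule AE_I2, unfold norm_mult, intro mult_left_mono S_bound[OF R] norm_ge_zero, rule mS[OF R, unfolded norm_mult])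
    have "(LINT w|\<mu>. (if R > 0 then of_real (1 / (2 * pi)) * S w R - of_real (1 / (2 * pi)) * A R else 0)) =
      (LINT w|\<mu>. of_real (1 / (2 * pi)) * S w R) - of_real (measure \<mu> (space \<mu>)) * (of_real (1 / (2 * pi)) * A R)"
      using R iS by (simp add: scaleR_conv_of_real)
    thus "(LINT w|\<mu>. (if R > 0 then of_real (1 / (2 * pi)) * S w R - of_real (1 / (2 * pi)) * A R else 0)) =
      fourier (shell_profile W u R) k - cis (- (R * norm k)) * u k"
      unfolding main fourier_eq[OF R] by (simp add: \<kappa>_def)
  qed
qed

section \<open>Dimension one and the main theorem\<close>

text \<open>The sphere is {h, -h} and m = 0, so all powers of R and r are 1 and for every R > 0 the
  transform is an exact combination of two integrals over [-R, R]. They are treated as improper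
  integrals, since a merely continuous \<open>W\<close> yields no L^1 bound for v.\<close>

lemma tendsto_reconstruction_line:
  fixes u :: "'a::euclidean_space \<Rightarrow> complex" and k :: 'a
  assumes u: "smooth u" "compactly_supported u" and reg: "regularizing DIM('a) \<rho> W"
    and dim: "DIM('a) = 1" and \<rho>: "\<rho> > 0" and k: "norm k > \<rho>"
  shows "((\<lambda>R. fourier (shell_profile W u R) k - cis (- (R * norm k)) * u k) \<longlongrightarrow> 0) at_top"
proof -
  define \<kappa> where "\<kappa> = norm k"
  define h where "h = k /\<^sub>R norm k"
  have \<kappa>: "\<kappa> > 0" using k \<rho> unfolding \<kappa>_def by linarith
  have h: "norm h = 1" "\<kappa> *\<^sub>R h = k" using \<kappa> by (simp_all add: h_def \<kappa>_def)
  have hh: "h \<bullet> h = 1" using h(1) by (simp add: norm_eq_1)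
  have kh: "k \<bullet> (a *\<^sub>R h) = a * \<kappa>" for a
    unfolding h(2)[symmetric] by (simp add: hh)
  have cW: "continuous_on UNIV W" using reg by (rule continuous_on_regularizing)
  have W0: "W \<xi> = 0" if "\<xi> \<le> 0" for \<xi> using reg that unfolding regularizing_def by blast
  have W1: "W \<xi> = 1" if "\<xi> > \<rho>" for \<xi>
  proof -
    have "\<forall>\<xi>\<ge>\<rho>. W \<xi> = \<bar>\<xi>\<bar> powr ((real DIM('a) - 1) / 2)" using reg unfolding regularizing_def by blast
    thus ?thesis using that \<rho> by (simp add: dim)
  qed
  have root: "root_factor TYPE('a) = 1" by (simp add: root_factor_def dim)
  have cu: "continuous_on UNIV u" by (rule differentiable_imp_continuous_on_UNIV[OF smooth_imp_C2(1)[OF u(1)]])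
  obtain N where N: "N > 0" and uN: "\<And>x. norm x \<ge> N \<Longrightarrow> u x = 0"
    by (rule compactly_supported_bound[OF u(2)]) (rule that)
  define V where "V s \<xi> = of_real (W \<xi>) * u (\<xi> *\<^sub>R (s *\<^sub>R h))" for s \<xi> :: real
  define v where "v s z = integral {-N..N} (\<lambda>\<xi>. V s \<xi> * cis (z * \<xi>))" for s z
  have cV: "continuous_on A (\<lambda>y. V s (f y))" if "continuous_on A f" for A s and f :: "'b::topological_space \<Rightarrow> real"
    unfolding V_def using that by (intro continuous_intros continuous_on_compose2[OF cW] continuous_on_compose2[OF cu]) auto
  have Vsupp: "V s \<xi> = 0" if "\<bar>s\<bar> = 1" "\<xi> \<notin> {-N..N}" for s \<xi>
  proof -
    have "N \<le> \<bar>\<xi>\<bar>" using that(2) by (cases "\<xi> \<ge> 0") auto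
    hence "u (\<xi> *\<^sub>R (s *\<^sub>R h)) = 0" using that(1) h(1) by (intro uN) (simp add: abs_mult)
    thus ?thesis by (simp only: V_def mult_zero_right)
  qed
  have "continuous_on UNIV (v s)" for s
    unfolding v_def cbox_interval [symmetric]
    by (intro integral_continuous_on_param) (auto simp: case_prod_unfold intro!: continuous_intros cV)
  hence cv: "continuous_on A (\<lambda>y. v s (f y))" if "continuous_on A f" for A s and f :: "'b::topological_space \<Rightarrow> real"
    using that by (rule continuous_on_compose2) auto
  define X where "X s q R = integral {-R..R} (\<lambda>z. v s z * cis (- (z * q)))" for s q R
  have X1: "(X 1 \<kappa> \<longlongrightarrow> 2 * pi * u k) at_top"
  proof -
    have "((\<lambda>x. x *\<^sub>R h) has_vector_derivative h) (at \<kappa>)"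
      by (auto intro!: derivative_eq_intros simp: has_vector_derivative_def)
    from has_vector_derivative_compose_curve[OF this frechet_derivative_works[THEN iffD1, OF smooth_imp_C2(1)[OF u(1)]]]
    \<comment> \<open>On the open half line beyond \<rho> the function \<open>W\<close> is 1, so
      near \<kappa> the profile is \<open>u\<close> along the ray.\<close>
    have "(V 1 has_vector_derivative frechet_derivative u (at (\<kappa> *\<^sub>R h)) h) (at \<kappa>)"
      by (rule has_vector_derivative_transform_within_open[of _ _ _ "{\<rho><..}"]) (use k in \<open>auto simp: V_def W1 \<kappa>_def\<close>)
    note d = this
    have c: "continuous_on UNIV (V 1)" by (rule cV) (rule continuous_on_id)
    have s: "V 1 x = 0" if "x \<notin> {-N..N}" for x by (rule Vsupp[OF _ that]) simp
    have "(X 1 \<kappa> \<longlongrightarrow> 2 * pi * V 1 \<kappa>) at_top"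
      unfolding X_def[abs_def] v_def by (rule fourier_inversion_pointwise[OF N c s d])
    moreover have "V 1 \<kappa> = u k"
    proof -
      have "W \<kappa> = 1" using k by (intro W1) (simp add: \<kappa>_def)
      thus ?thesis by (simp add: V_def h(2))
    qed
    ultimately show ?thesis by simp
  qed
  have X2: "(X (-1) (- \<kappa>) \<longlongrightarrow> 0) at_top"
  proof -
    have "((\<lambda>_. 0) has_vector_derivative 0) (at (- \<kappa>))" by (rule has_vector_derivative_const)
    hence "(V (-1) has_vector_derivative 0) (at (- \<kappa>))"
      by (rule has_vector_derivative_transform_within_open[of _ _ _ "{..<0}"]) (use \<kappa> in \<open>auto simp: V_def W0\<close>)
    note d = this
    have c: "continuous_on UNIV (V (-1))" by (rule cV) (rule continuous_on_id)
    have s: "V (-1) x = 0" if "x \<notin> {-N..N}" for x by (rule Vsupp[OF _ that]) simp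
    have "(X (-1) (- \<kappa>) \<longlongrightarrow> 2 * pi * V (-1) (- \<kappa>)) at_top"
      unfolding X_def[abs_def] v_def by (rule fourier_inversion_pointwise[OF N c s d])
    moreover have "V (-1) (- \<kappa>) = 0" using \<kappa> by (simp add: V_def W0)
    ultimately show ?thesis by simp
  qed
  have T: "distr lborel borel (\<lambda>a. a *\<^sub>R h) = (lborel :: 'a measure)"
  proof (rule distr_lborel_linear_isometry)
    show "linear (\<lambda>a. a *\<^sub>R h)" by (rule linearI) (simp_all add: scaleR_add_left)
  qed (use h(1) dim in simp_all)
  define f where "f R x = shell_profile W u R x * exp (- (\<i> * of_real (k \<bullet> x)))" for R x
  have mf: "f R \<in> borel_measurable borel" for R
  proof -
    note [measurable] = borel_measurable_shell_profile[OF cW cu]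
    show ?thesis unfolding f_def[abs_def] by measurable
  qed
  have eq: "fourier (shell_profile W u R) k = of_real (1 / (2 * pi)) * (cis (- (R * \<kappa>)) * X 1 \<kappa> R + cis (R * \<kappa>) * X (-1) (- \<kappa>) R)"
    if R: "R > 0" for R
  proof -
    \<comment> \<open>Here \<open>s\<close> is the direction, 1 or -1: at the point a h with sign s
      the radius is s a, and one formula covers both half lines.\<close>
    define g where "g s a = of_real (1 / (2 * pi)) * (v s (s * a - R) * cis (- (a * \<kappa>)))" for s a
    have cg: "continuous_on A (g s)" for A s unfolding g_def by (intro continuous_intros cv)
    have fg: "f R (a *\<^sub>R h) = g (sgn a) a" if a: "a \<noteq> 0" "\<bar>a\<bar> < 2 * R" for a
    proof -
      have n: "norm (a *\<^sub>R h) = \<bar>a\<bar>" "(a *\<^sub>R h) /\<^sub>R \<bar>a\<bar> = sgn a *\<^sub>R h"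
        using h(1) a by (auto simp: sgn_if)
      have nq: "norm (sgn a *\<^sub>R h) = 1" using h(1) a by simp
      have i: "inv_fourier (\<lambda>\<xi>. restriction W u \<xi> (sgn a *\<^sub>R h)) (\<bar>a\<bar> - R) = of_real (1 / (2 * pi)) * v (sgn a) (\<bar>a\<bar> - R)"
      proof -
        have "inv_fourier (\<lambda>\<xi>. restriction W u \<xi> (sgn a *\<^sub>R h)) (\<bar>a\<bar> - R) = of_real (1 / (2 * pi)) *
            integral {-N..N} (\<lambda>\<xi>. root_factor TYPE('a) * of_real (W \<xi>) * u (\<xi> *\<^sub>R (sgn a *\<^sub>R h)) * cis ((\<bar>a\<bar> - R) * \<xi>))"
          by (rule inv_fourier_restriction[OF cW W0 cu uN nq])
        thus ?thesis by (simp only: v_def V_def root mult_1)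
      qed
      have "indicator {y. norm y < 2 * R} (a *\<^sub>R h) = (1 :: complex)"
        using a(2) by (simp only: indicator_def mem_Collect_eq n(1)) simp
      moreover have "complex_of_real (1 / R powr ((real DIM('a) - 1) / 2)) = 1" using R by (simp add: dim)
      moreover have "\<bar>a\<bar> = sgn a * a" by (auto simp: sgn_if)
      ultimately show ?thesis
        unfolding f_def shell_profile_def n i kh exp_i_eq_cis g_def by (simp only: mult_1 mult_1_right mult.assoc)
    qed
    have f0: "f R (a *\<^sub>R h) = 0" if "\<bar>a\<bar> \<ge> 2 * R" for a
    proof -
      have "indicator {y. norm y < 2 * R} (a *\<^sub>R h) = (0 :: complex)"
        using that h(1) by (simp add: indicator_def)
      thus ?thesis by (simp only: f_def shell_profile_def mult_zero_left mult_zero_right)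
    qed
    have si: "set_integrable lborel {a..b} (g s)" for a b s
      by (intro borel_integrable_atLeastAtMost' cg)
    have [measurable]: "g s \<in> borel_measurable borel" for s by (rule borel_measurable_continuous_onI[OF cg])
    have "fourier (shell_profile W u R) k = (LINT x|lborel. f R x)" by (simp add: fourier_def f_def)
    also have "\<dots> = (LINT a|lborel. f R (a *\<^sub>R h))"
      unfolding T[symmetric] by (rule integral_distr) (use mf in auto)
    also have "\<dots> = (LINT a|lborel. indicator {0..2 * R} a *\<^sub>R g 1 a + indicator {-(2 * R)..-0} a *\<^sub>R g (-1) a)"
    proof (rule integral_cong_AE)
      show "(\<lambda>a. f R (a *\<^sub>R h)) \<in> borel_measurable lborel"
        by (rule measurable_compose[OF _ mf]) simp
      show "AE a in lborel. f R (a *\<^sub>R h) = indicator {0..2 * R} a *\<^sub>R g 1 a + indicator {-(2 * R)..-0} a *\<^sub>R g (-1) a"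
        using AE_lborel_singleton[of 0] AE_lborel_singleton[of "2 * R"] AE_lborel_singleton[of "-(2 * R)"]
      proof eventually_elim
        case (elim a)
        consider "0 < a" "a < 2 * R" | "a < 0" "- (2 * R) < a" | "\<bar>a\<bar> > 2 * R" using elim by linarith
        thus ?case
        proof cases
          case 1 thus ?thesis using fg[of a] by simp
        next
          case 2 thus ?thesis using fg[of a] by simp
        next
          case 3 thus ?thesis using f0[of a] R by (auto simp: indicator_def)
        qed
      qed
    qed measurable
    also have "\<dots> = (LINT a:{0..2 * R}|lborel. g 1 a) + (LINT a:{-(2 * R)..-0}|lborel. g (-1) a)"
      using si[of 0 "2 * R" 1] si[of "-(2 * R)" "-0" "-1"] unfolding set_lebesgue_integral_def set_integrable_def
      by (rule Bochner_Integration.integral_add)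
    also have "\<dots> = integral {0..2 * R} (g 1) + integral {-(2 * R)..-0} (g (-1))"
      by (simp only: set_borel_integral_eq_integral(2)[OF si])
    also have "integral {-(2 * R)..-0} (g (-1)) = integral {0..2 * R} (\<lambda>a. g (-1) (- a))"
      using Henstock_Kurzweil_Integration.integral_reflect_real[of "2 * R" 0 "\<lambda>a. g (-1) (- a)"] by simp
    also have "integral {0..2 * R} (g 1) = integral {-R..R} (g 1 \<circ> (+) R)"
      using integral_shift_Icc_real[of "-R" R "g 1" R] by simp
    also have "g 1 \<circ> (+) R = (\<lambda>z. of_real (1 / (2 * pi)) * cis (- (R * \<kappa>)) * (v 1 z * cis (- (z * \<kappa>))))"
    proof
      fix z
      have "cis (- ((R + z) * \<kappa>)) = cis (- (R * \<kappa>)) * cis (- (z * \<kappa>))" by (simp add: cis_mult algebra_simps)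
      thus "(g 1 \<circ> (+) R) z = of_real (1 / (2 * pi)) * cis (- (R * \<kappa>)) * (v 1 z * cis (- (z * \<kappa>)))"
        by (simp add: g_def)
    qed
    also have "integral {-R..R} \<dots> = of_real (1 / (2 * pi)) * cis (- (R * \<kappa>)) * X 1 \<kappa> R"
      unfolding X_def by (rule integral_mult_right)
    also have "integral {0..2 * R} (\<lambda>a. g (-1) (- a)) = integral {-R..R} ((\<lambda>a. g (-1) (- a)) \<circ> (+) R)"
      using integral_shift_Icc_real[of "-R" R "\<lambda>a. g (-1) (- a)" R] by simp
    also have "(\<lambda>a. g (-1) (- a)) \<circ> (+) R = (\<lambda>z. of_real (1 / (2 * pi)) * cis (R * \<kappa>) * (v (-1) z * cis (- (z * - \<kappa>))))"
    proof
      fix z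
      have "cis ((R + z) * \<kappa>) = cis (R * \<kappa>) * cis (z * \<kappa>)" by (simp add: cis_mult algebra_simps)
      thus "((\<lambda>a. g (-1) (- a)) \<circ> (+) R) z = of_real (1 / (2 * pi)) * cis (R * \<kappa>) * (v (-1) z * cis (- (z * - \<kappa>)))"
        by (simp add: g_def)
    qed
    also have "integral {-R..R} \<dots> = of_real (1 / (2 * pi)) * cis (R * \<kappa>) * X (-1) (- \<kappa>) R"
      unfolding X_def by (rule integral_mult_right)
    finally show ?thesis by (simp only: distrib_left mult.assoc)
  qed
  have "((\<lambda>R. of_real (1 / (2 * pi)) * (cis (- (R * \<kappa>)) * (X 1 \<kappa> R - 2 * pi * u k) + cis (R * \<kappa>) * X (-1) (- \<kappa>) R)) \<longlongrightarrow> of_real (1 / (2 * pi)) * (0 + 0)) at_top"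
    by (intro tendsto_mult tendsto_add tendsto_const tendsto_cis_mult_zero LIM_zero X1 X2)
  hence "((\<lambda>R. of_real (1 / (2 * pi)) * (cis (- (R * \<kappa>)) * (X 1 \<kappa> R - 2 * pi * u k) + cis (R * \<kappa>) * X (-1) (- \<kappa>) R)) \<longlongrightarrow> 0) at_top" by simp
  thus ?thesis
  proof (rule Lim_transform_eventually[OF _ eventually_mono[OF eventually_gt_at_top[of 0]]])
    fix R :: real assume R: "R > 0"
    have "of_real (1 / (2 * pi)) * (a * (x - 2 * pi * y) + b) = of_real (1 / (2 * pi)) * (a * x + b) - a * y" for a b x y :: complex
      by (simp add: field_simps)
    thus "of_real (1 / (2 * pi)) * (cis (- (R * \<kappa>)) * (X 1 \<kappa> R - 2 * pi * u k) + cis (R * \<kappa>) * X (-1) (- \<kappa>) R) =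
        fourier (shell_profile W u R) k - cis (- (R * norm k)) * u k"
      unfolding eq[OF R] \<kappa>_def[symmetric] .
  qed
qed

text \<open>The exponent is 1/2, so the branch matters: the principal logarithm of 1 / (2 pi i) is
  ln(1 / (2 pi)) - i pi / 2, whose imaginary part lies in the principal strip. The resulting phase
  e^(-i pi / 4) is inverse to that of \<open>cap_coeff 0\<close>.\<close>

lemma root_factor_2:
  assumes "DIM('a::euclidean_space) = 2"
  shows "root_factor TYPE('a) = of_real (sqrt (1 / (2 * pi))) * cis (- (pi / 4))"
proof -
  define z where "z = complex_of_real (ln (1 / (2 * pi))) - \<i> * of_real (pi / 2)"
  have "exp z = exp (complex_of_real (ln (1 / (2 * pi)))) / exp (\<i> * of_real (pi / 2))"
    unfolding z_def by (rule exp_diff)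
  also have "exp (complex_of_real (ln (1 / (2 * pi)))) = of_real (exp (ln (1 / (2 * pi))))" by (rule exp_of_real)
  also have "exp (ln (1 / (2 * pi))) = 1 / (2 * pi)" by simp
  also have "exp (\<i> * complex_of_real (pi / 2)) = \<i>" unfolding exp_i_eq_cis by (rule cis_pi_half)
  also have "of_real (1 / (2 * pi)) / \<i> = 1 / (2 * of_real pi * \<i>)"
    by (simp only: of_real_divide of_real_mult of_real_1 of_real_numeral divide_divide_eq_left)
  finally have ez: "exp z = 1 / (2 * of_real pi * \<i>)" .
  have "Im z = - (pi / 2)" by (simp add: z_def)
  hence "Ln (exp z) = z" using pi_gt_zero by (intro Ln_exp) linarith+
  hence "root_factor TYPE('a) = exp (of_real (1 / 2) * z)"
    unfolding root_factor_def ez[symmetric] assms powr_def by simp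
  also have "of_real (1 / 2) * z = of_real (ln (1 / (2 * pi)) / 2) + \<i> * of_real (- (pi / 4))"
    by (simp add: z_def algebra_simps)
  also have "exp \<dots> = of_real (exp (ln (1 / (2 * pi)) / 2)) * cis (- (pi / 4))"
    by (simp only: exp_add exp_i_eq_cis exp_of_real)
  also have "exp (ln (1 / (2 * pi)) / 2) = sqrt (1 / (2 * pi))"
  proof (rule real_sqrt_unique[symmetric])
    show "(exp (ln (1 / (2 * pi)) / 2))\<^sup>2 = 1 / (2 * pi)" by (simp flip: exp_double)
  qed simp
  finally show ?thesis .
qed

theorem theorem1p1:
  fixes c \<rho> \<tau> :: real
    and W :: "real \<Rightarrow> real"
    and u0 :: "real ^ 'n \<Rightarrow> complex"
    and k :: "real ^ 'n"
  assumes "CARD('n) \<in> {1, 2, 3}"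
    and "c > 0"
    and "smooth u0" and "compactly_supported u0"
    and "\<rho> > 0" and "regularizing CARD('n) \<rho> W"
    and "\<tau> > 0" and "norm k > \<rho>"
  shows "((\<lambda>\<epsilon>. reconstruction_hat c \<epsilon> W (\<lambda>_. 0) u0 k (\<tau> / \<epsilon>\<^sup>2)
             - exp (- (\<i> * of_real (c * norm k * \<tau> / \<epsilon>\<^sup>2))) * u0 k)
          \<longlongrightarrow> 0) (at_right 0)"
proof -
  have reg: "regularizing DIM(real ^ 'n) \<rho> W" using assms(6) by simp
  have "norm k > 0" using assms by linarith
  hence nh: "norm (k /\<^sub>R norm k) = 1" by simp
  \<comment> \<open>With b = 0 the time and \<epsilon> occur only through R = c \<tau> /
    \<epsilon>^2, so the claim is a single limit as R tends to infinity.\<close>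
  have key: "((\<lambda>R. fourier (shell_profile W u0 R) k - cis (- (R * norm k)) * u0 k) \<longlongrightarrow> 0) at_top"
  proof -
    consider "DIM(real ^ 'n) = 1" | "DIM(real ^ 'n) = 2" | "DIM(real ^ 'n) = 3" using assms(1) by auto
    thus ?thesis
    proof cases
      case 1
      show ?thesis by (rule tendsto_reconstruction_line[OF assms(3,4) reg 1 assms(5,8)])
    next
      case 2
      obtain B where B: "card B = 1" "\<And>b. b \<in> B \<Longrightarrow> norm b = 1 \<and> (k /\<^sub>R norm k) \<bullet> b = 0"
        using obtain_orthonormal_complement[OF nh, of 1] 2 by auto
      then obtain e where e: "norm e = 1" "(k /\<^sub>R norm k) \<bullet> e = 0" by (auto simp: card_1_singleton_iff)
      show ?thesis
      proof (rule tendsto_reconstruction_axial[OF assms(3,4) reg _ _ assms(5,8) axial_polar_2[OF 2 nh e]])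
        \<comment> \<open>The normalization in dimension two: the mass 2, the pole coefficient
          sqrt(pi / 2) e^(i pi / 4) and the root sqrt(1 / (2 pi)) e^(-i pi / 4) multiply to
          1.\<close>
        have "sqrt (pi / 2) * sqrt (1 / (2 * pi)) = sqrt (1 / 4)" by (simp flip: real_sqrt_mult)
        also have "sqrt (1 / 4) = 1 / 2" by (simp add: real_sqrt_divide)
        finally have "2 * (sqrt (pi / 2) * sqrt (1 / (2 * pi))) = 1" by simp
        moreover have "cis (pi / 4) * cis (- (pi / 4)) = 1" by (simp add: cis_mult)
        moreover have "of_real (measure (count_space (UNIV :: bool set)) (space (count_space UNIV))) * cap_coeff 0 * root_factor TYPE(real ^ 'n) =
            of_real (2 * (sqrt (pi / 2) * sqrt (1 / (2 * pi)))) * (cis (pi / 4) * cis (- (pi / 4)))"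
          by (simp add: root_factor_2[OF 2] cap_coeff_def measure_count_space mult_ac)
        ultimately show "of_real (measure (count_space (UNIV :: bool set)) (space (count_space UNIV))) * cap_coeff 0 * root_factor TYPE(real ^ 'n) = 1"
          by simp
      qed (use 2 in auto)
    next
      case 3
      obtain B where B: "card B = 2" "pairwise orthogonal B" "\<And>b. b \<in> B \<Longrightarrow> norm b = 1 \<and> (k /\<^sub>R norm k) \<bullet> b = 0"
        using obtain_orthonormal_complement[OF nh, of 2] 3 by auto
      from B(1) obtain e e' where ee: "B = {e, e'}" "e \<noteq> e'" by (auto simp: card_2_iff)
      have e: "norm e = 1" "(k /\<^sub>R norm k) \<bullet> e = 0" "norm e' = 1" "(k /\<^sub>R norm k) \<bullet> e' = 0"
        using B(3)[of e] B(3)[of e'] by (simp_all add: ee)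
      have e3: "e \<bullet> e' = 0" using pairwiseD[OF B(2), of e e'] ee by (simp add: orthogonal_def)
      show ?thesis
      proof (rule tendsto_reconstruction_axial[OF assms(3,4) reg _ _ assms(5,8) axial_polar_3[OF 3 nh e e3]])
        \<comment> \<open>The normalization in dimension three: the mass 2 pi, the pole coefficient
          i and the factor 1 / (2 pi i) multiply to 1.\<close>
        have "measure (density lborel (indicator {-pi<..<pi})) (space (density lborel (indicator {-pi<..<pi::real}))) = 2 * pi"
          by (simp add: measure_def emeasure_density)
        thus "of_real (measure (density lborel (indicator {-pi<..<pi})) (space (density lborel (indicator {-pi<..<pi::real})))) * cap_coeff 1 * root_factor TYPE(real ^ 'n) = 1"
          using 3 by (simp add: cap_coeff_def root_factor_def)
      qed (use 3 in auto)
    qed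
  qed
  have "filterlim (\<lambda>\<epsilon>::real. inverse \<epsilon>) at_top (at_right 0)" by (rule filterlim_inverse_at_top_right)
  hence "filterlim (\<lambda>\<epsilon>::real. (inverse \<epsilon>)\<^sup>2) at_top (at_right 0)" by (intro filterlim_pow_at_top) auto
  hence "filterlim (\<lambda>\<epsilon>::real. c * \<tau> * (inverse \<epsilon>)\<^sup>2) at_top (at_right 0)"
    using assms by (intro filterlim_tendsto_pos_mult_at_top[OF tendsto_const]) auto
  hence "filterlim (\<lambda>\<epsilon>::real. c * (\<tau> / \<epsilon>\<^sup>2)) at_top (at_right 0)"
    by (simp add: divide_inverse power_inverse mult.assoc)
  from filterlim_compose[OF key this]
  have "((\<lambda>\<epsilon>. fourier (shell_profile W u0 (c * (\<tau> / \<epsilon>\<^sup>2))) k - cis (- (c * (\<tau> / \<epsilon>\<^sup>2) * norm k)) * u0 k) \<longlongrightarrow> 0) (at_right 0)" .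
  moreover have "exp (- (\<i> * of_real (c * norm k * \<tau> / \<epsilon>\<^sup>2))) = cis (- (c * (\<tau> / \<epsilon>\<^sup>2) * norm k))" for \<epsilon> :: real
    unfolding exp_i_eq_cis by (simp add: mult_ac)
  ultimately show ?thesis by (simp only: reconstruction_hat_eq)
qed

end
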